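(* Let $\mathfrak g$ be a simple simply laced finite-dimensional Lie algebra of rank $\ell$ (so that $\alpha_i^\vee=\alpha_i$), and let $\Lambda\in\hat{\mathfrak h}^*$ be a weight of $\hat{\mathfrak g}$ of level $k\in\mathbb Z_{<0}$ such that the following conditions hold: (i) $(\Lambda|\alpha_i)\in\mathbb Z_{\ge0}$ for $i=1,\dots,\ell$; (ii) there exists a positive root $\alpha$ of $\mathfrak g$ such that $(\Lambda+\hat\rho\,|\,\delta-\alpha)=0$; (iii) if $\beta\in\hat\Delta_+$ is orthogonal to $\Lambda+\hat\rho$, then $\beta=\delta-\alpha$; (iv) (extra hypothesis) in the character formula $$\hat R\,\mathrm{ch}\,L(\Lambda)=\sum_{w\in\hat W}c(w)\,w\big(e^{\Lambda+\hat\rho}\big),\qquad c(w)\in\mathbb Z,$$ one has $$c(\gamma):=c(t_\gamma)=(\text{linear function in }\gamma\in Q)+\text{const}.$$ Then $$\hat R\,\mathrm{ch}\,L(\Lambda)=\frac12\sum_{w\in W}\epsilon(w)\,w\sum_{\gamma\in Q}\big((\alpha|\gamma)+1\big)\,t_\gamma\big(e^{\Lambda+\hat\rho}\big).$$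
   Context: Base field $\mathbb C$. $\mathfrak g$ has invariant symmetric bilinear form $(\cdot|\cdot)$ normalized by $(\alpha|\alpha)=2$ for roots $\alpha$, Cartan subalgebra $\mathfrak h$ (identified with $\mathfrak h^*$ by the form), simple roots $\alpha_1,\dots,\alpha_\ell$, root (= coroot) lattice $Q=\sum_{i=1}^{\ell}\mathbb Z\alpha_i$, $\mathfrak n_+$ the span of the positive root spaces, Weyl group $W$, Weyl vector $\rho$ (half the sum of positive roots), dual Coxeter number $h^\vee$ (half the eigenvalue on $\mathfrak g$ of the Casimir element). Affine Lie algebra: $\hat{\mathfrak g}=\mathfrak g[t,t^{-1}]\oplus\mathbb CK\oplus\mathbb Cd$ with $[at^m,bt^r]=[a,b]t^{m+r}+m\delta_{m,-r}(a|b)K$, $[d,at^m]=m\,at^m$, $K$ central. The form extends by $(at^m|bt^r)=\delta_{m,-r}(a|b)$, $(\mathfrak g[t,t^{-1}]|\mathbb CK+\mathbb Cd)=0$, $(K|K)=(d|d)=0$, $(K|d)=1$. Cartan subalgebra $\hat{\mathfrak h}=\mathfrak h+\mathbb CK+\mathbb Cd$, identified with $\hat{\mathfrak h}^*$ by the form; under this identification $d$ corresponds to $\Lambda_0$ and $K$ to $\delta$. Borel subalgebra $\hat{\mathfrak b}=\hat{\mathfrak h}+\mathfrak n_++\bigoplus_{m>0}\mathfrak gt^m$, with corresponding set of positive roots $\hat\Delta_+$. For $\Lambda\in\hat{\mathfrak h}^*$, $L(\Lambda)$ is the irreducible $\hat{\mathfrak g}$-module containing an eigenvector of $\hat{\mathfrak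 b}$ of weight $\Lambda$ (extended by $0$ to the other summands of $\hat{\mathfrak b}$); its level (and that of $\Lambda$) is $\Lambda(K)$. The character $\mathrm{ch}\,L(\Lambda)$ is the series $h\mapsto\mathrm{tr}_{L(\Lambda)}e^h$, $h\in\hat{\mathfrak h}$, corresponding to the weight space decomposition of $L(\Lambda)$ with respect to $\hat{\mathfrak h}$. $\hat\rho=\rho+h^\vee\Lambda_0$, and $\hat R=e^{\hat\rho}\prod_{\beta\in\hat\Delta_+}(1-e^{-\beta})^{\mathrm{mult}(\beta)}$ is the affine Weyl denominator, where $\mathrm{mult}(\beta)$ is the multiplicity of the root $\beta$. For $\gamma\in\mathfrak h^*$, $t_\gamma(\lambda)=\lambda+\lambda(K)\gamma-\big((\lambda|\gamma)+\tfrac12\lambda(K)(\gamma|\gamma)\big)\delta$ for $\lambda\in\hat{\mathfrak h}^*$; the affine Weyl group is $\hat W=W\ltimes\{t_\gamma\mid\gamma\in Q\}$, and $\epsilon(w)=\det_{\hat{\mathfrak h}^*}w$. Elements of $\hat W$ act on exponentials by $w(e^\lambda)=e^{w(\lambda)}$. It is known that for every $\Lambda$ of non-critical level ($\ne-h^\vee$) a formula $\hat R\,\mathrm{ch}\,L(\Lambda)=\sum_{w\in\hat W}c(w)w(e^{\Lambda+\hat\rho})$ with integers $c(w)$ holds; this is the character formula referred to in condition (iv).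
   Formalization: The coefficients c(w), not determined by the character formula because of (ii), are additionally required to satisfy c(uw) = ε(u)c(w) for u in W; without this normalization condition (iv) can hold vacuously and the claim fails (sl_2, level −1). *)

theory Defs
  imports
    Complex_Main
    "HOL-Library.Product_Plus"
    "HOL-Library.Poly_Mapping"
    "HOL-Combinatorics.Permutations"
begin

section \<open>Finite-dimensional data\<close>

text \<open>
  A complex Lie algebra on the type \<open>'g\<close> together with the choices made for it: the invariant
  form, a Cartan subalgebra, and simple roots \<open>simple_root L i\<close> for \<open>1 \<le> i \<le> rk L\<close>.
  The dual of the Cartan subalgebra is identified with the Cartan subalgebra by the form, so roots
  and weights are elements of the Lie algebra.
\<close>

record 'g lie_data =
  scl :: "complex \<Rightarrow> 'g \<Rightarrow> 'g"
  brk :: "'g \<Rightarrow> 'g \<Rightarrow> 'g"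
  ipr :: "'g \<Rightarrow> 'g \<Rightarrow> complex"
  cartan :: "'g set"
  rk :: nat
  simple_root :: "nat \<Rightarrow> 'g"

definition fin_dim_space :: "(complex \<Rightarrow> 'a::ab_group_add \<Rightarrow> 'a) \<Rightarrow> bool" where
  "fin_dim_space s \<longleftrightarrow> vector_space s \<and> (\<exists>B. finite B \<and> module.span s B = UNIV)"

definition lie_algebra :: "('g::ab_group_add) lie_data \<Rightarrow> bool" where
  "lie_algebra L \<longleftrightarrow>
     vector_space (scl L) \<and>
     (\<forall>x. Vector_Spaces.linear (scl L) (scl L) (\<lambda>y. brk L x y)) \<and>
     (\<forall>y. Vector_Spaces.linear (scl L) (scl L) (\<lambda>x. brk L x y)) \<and>
     (\<forall>x. brk L x x = 0) \<and>
     (\<forall>x y z. brk L x (brk L y z) + brk L y (brk L z x) + brk L z (brk L x y) = 0)"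

definition simple_lie_algebra :: "('g::ab_group_add) lie_data \<Rightarrow> bool" where
  "simple_lie_algebra L \<longleftrightarrow>
     lie_algebra L \<and> (\<exists>x y. brk L x y \<noteq> 0) \<and>
     (\<forall>I. module.subspace (scl L) I \<and> (\<forall>x. \<forall>y\<in>I. brk L x y \<in> I) \<longrightarrow> I = {0} \<or> I = UNIV)"

definition abelian_subalgebra :: "('g::ab_group_add) lie_data \<Rightarrow> 'g set \<Rightarrow> bool" where
  "abelian_subalgebra L A \<longleftrightarrow>
     module.subspace (scl L) A \<and> (\<forall>x\<in>A. \<forall>y\<in>A. brk L x y = 0)"

text \<open>
  Cartan subalgebra of a semisimple Lie algebra: a maximal abelian subalgebra all of whose elements
  are ad-semisimple, i.e. (over the complex numbers) the eigenvectors of \<open>ad h\<close> span.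
\<close>

definition cartan_subalgebra :: "('g::ab_group_add) lie_data \<Rightarrow> 'g set \<Rightarrow> bool" where
  "cartan_subalgebra L H \<longleftrightarrow>
     abelian_subalgebra L H \<and>
     (\<forall>A. abelian_subalgebra L A \<and> H \<subseteq> A \<longrightarrow> A = H) \<and>
     (\<forall>h\<in>H. module.span (scl L) {x. \<exists>c. brk L h x = scl L c x} = UNIV)"

definition invariant_form :: "('g::ab_group_add) lie_data \<Rightarrow> bool" where
  "invariant_form L \<longleftrightarrow>
     (\<forall>x. Vector_Spaces.linear (scl L) (*) (\<lambda>y. ipr L x y)) \<and>
     (\<forall>x y. ipr L x y = ipr L y x) \<and>
     (\<forall>x y z. ipr L (brk L x y) z = ipr L x (brk L y z)) \<and>
     (\<forall>x. (\<forall>y. ipr L x y = 0) \<longrightarrow> x = 0)"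

definition root_space :: "('g::ab_group_add) lie_data \<Rightarrow> 'g \<Rightarrow> 'g set" where
  "root_space L \<alpha> = {x. \<forall>h\<in>cartan L. brk L h x = scl L (ipr L \<alpha> h) x}"

definition roots :: "('g::ab_group_add) lie_data \<Rightarrow> 'g set" where
  "roots L = {\<alpha> \<in> cartan L. \<alpha> \<noteq> 0 \<and> root_space L \<alpha> \<noteq> {0}}"

definition nonneg_combinations :: "('g::ab_group_add) lie_data \<Rightarrow> 'g set" where
  "nonneg_combinations L =
     {\<Sum>i\<in>{1..rk L}. scl L (of_nat (n i)) (simple_root L i) | n :: nat \<Rightarrow> nat. True}"

definition pos_roots :: "('g::ab_group_add) lie_data \<Rightarrow> 'g set" where
  "pos_roots L = roots L \<inter> nonneg_combinations L"

definition simple_root_system :: "('g::ab_group_add) lie_data \<Rightarrow> bool" where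
  "simple_root_system L \<longleftrightarrow>
     simple_root L ` {1..rk L} \<subseteq> roots L \<and>
     inj_on (simple_root L) {1..rk L} \<and>
     \<not> module.dependent (scl L) (simple_root L ` {1..rk L}) \<and>
     module.span (scl L) (simple_root L ` {1..rk L}) = cartan L \<and>
     (\<forall>\<alpha>\<in>roots L. \<alpha> \<in> nonneg_combinations L \<or> - \<alpha> \<in> nonneg_combinations L)"

text \<open>
  The last conjunct is the normalization \<open>(\<alpha>|\<alpha>) = 2\<close> for every root; in particular all roots have
  the same length, which is what simply laced means.
\<close>

definition simple_simply_laced :: "('g::ab_group_add) lie_data \<Rightarrow> bool" where
  "simple_simply_laced L \<longleftrightarrow>
     fin_dim_space (scl L) \<and> simple_lie_algebra L \<and> invariant_form L \<and>
     cartan_subalgebra L (cartan L) \<and> simple_root_system L \<and>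
     (\<forall>\<alpha>\<in>roots L. ipr L \<alpha> \<alpha> = 2)"

definition root_lattice :: "('g::ab_group_add) lie_data \<Rightarrow> 'g set" where
  "root_lattice L =
     {\<Sum>i\<in>{1..rk L}. scl L (of_int (n i)) (simple_root L i) | n :: nat \<Rightarrow> int. True}"

definition n_plus :: "('g::ab_group_add) lie_data \<Rightarrow> 'g set" where
  "n_plus L = module.span (scl L) (\<Union>\<alpha>\<in>pos_roots L. root_space L \<alpha>)"

definition weyl_vector :: "('g::ab_group_add) lie_data \<Rightarrow> 'g" where
  "weyl_vector L = scl L (1/2) (\<Sum>\<alpha>\<in>pos_roots L. \<alpha>)"

definition dual_vector :: "('g::ab_group_add) lie_data \<Rightarrow> 'g set \<Rightarrow> 'g \<Rightarrow> 'g" where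
  "dual_vector L B b = (THE y. \<forall>b'\<in>B. ipr L y b' = (if b' = b then 1 else 0))"

text \<open>The choice of basis is immaterial: the Casimir element does not depend on it.\<close>

definition casimir_ad :: "('g::ab_group_add) lie_data \<Rightarrow> 'g \<Rightarrow> 'g" where
  "casimir_ad L x =
     (let B = (SOME B. \<not> module.dependent (scl L) B \<and> module.span (scl L) B = UNIV)
      in \<Sum>b\<in>B. brk L b (brk L (dual_vector L B b) x))"

definition dual_coxeter :: "('g::ab_group_add) lie_data \<Rightarrow> complex" where
  "dual_coxeter L = (THE c. \<forall>x. casimir_ad L x = scl L (2 * c) x)"


section \<open>The affine Lie algebra\<close>

text \<open>\<open>(x, a, b)\<close> stands for \<open>(\<Sum>m. x\<^sub>m t\<^sup>m) + a K + b d\<close>.\<close>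

type_synonym 'g affine = "(int \<Rightarrow>\<^sub>0 'g) \<times> complex \<times> complex"

definition loop :: "'g::ab_group_add \<Rightarrow> int \<Rightarrow> 'g affine" where
  "loop a m = (Poly_Mapping.single m a, 0, 0)"

abbreviation emb :: "'g::ab_group_add \<Rightarrow> 'g affine" where
  "emb a \<equiv> loop a 0"

definition central_K :: "('g::ab_group_add) affine" where
  "central_K = (0, 1, 0)"

definition deriv_d :: "('g::ab_group_add) affine" where
  "deriv_d = (0, 0, 1)"

fun aff_scl :: "('g::ab_group_add) lie_data \<Rightarrow> complex \<Rightarrow> 'g affine \<Rightarrow> 'g affine" where
  "aff_scl L c (x, a, b) = (Poly_Mapping.map (scl L c) x, c * a, c * b)"

fun aff_brk :: "('g::ab_group_add) lie_data \<Rightarrow> 'g affine \<Rightarrow> 'g affine \<Rightarrow> 'g affine" where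
  "aff_brk L (x, a, b) (y, a', b') =
     ((\<Sum>m\<in>Poly_Mapping.keys x. \<Sum>r\<in>Poly_Mapping.keys y.
          Poly_Mapping.single (m + r) (brk L (Poly_Mapping.lookup x m) (Poly_Mapping.lookup y r)))
      + (\<Sum>m\<in>Poly_Mapping.keys y.
          Poly_Mapping.single m (scl L (b * of_int m) (Poly_Mapping.lookup y m)))
      - (\<Sum>m\<in>Poly_Mapping.keys x.
          Poly_Mapping.single m (scl L (b' * of_int m) (Poly_Mapping.lookup x m))),
      (\<Sum>m\<in>Poly_Mapping.keys x.
          of_int m * ipr L (Poly_Mapping.lookup x m) (Poly_Mapping.lookup y (- m))),
      0)"

fun aff_ipr :: "('g::ab_group_add) lie_data \<Rightarrow> 'g affine \<Rightarrow> 'g affine \<Rightarrow> complex" where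
  "aff_ipr L (x, a, b) (y, a', b') =
     (\<Sum>m\<in>Poly_Mapping.keys x. ipr L (Poly_Mapping.lookup x m) (Poly_Mapping.lookup y (- m)))
     + a * b' + b * a'"

text \<open>
  The dual of \<open>aff_cartan L\<close> is identified with \<open>aff_cartan L\<close> by \<open>aff_ipr L\<close>: the functional
  \<open>\<lambda>\<close> takes the value \<open>aff_ipr L \<lambda> h\<close> at \<open>h\<close>. Accordingly \<open>central_K\<close> also plays the role of
  \<open>\<delta>\<close>, and \<open>deriv_d\<close> that of \<open>\<Lambda>\<^sub>0\<close>.
\<close>

abbreviation delta :: "('g::ab_group_add) affine" where
  "delta \<equiv> central_K"

abbreviation Lambda0 :: "('g::ab_group_add) affine" where
  "Lambda0 \<equiv> deriv_d"

definition aff_cartan :: "('g::ab_group_add) lie_data \<Rightarrow> 'g affine set" where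
  "aff_cartan L =
     {emb h + aff_scl L a central_K + aff_scl L b deriv_d | h a b. h \<in> cartan L}"

definition aff_n_plus :: "('g::ab_group_add) lie_data \<Rightarrow> 'g affine set" where
  "aff_n_plus L =
     {(x, 0, 0) | x. Poly_Mapping.lookup x 0 \<in> n_plus L \<and> (\<forall>m<0. Poly_Mapping.lookup x m = 0)}"

definition aff_borel :: "('g::ab_group_add) lie_data \<Rightarrow> 'g affine set" where
  "aff_borel L = {h + n | h n. h \<in> aff_cartan L \<and> n \<in> aff_n_plus L}"

definition aff_root_space :: "('g::ab_group_add) lie_data \<Rightarrow> 'g affine \<Rightarrow> 'g affine set" where
  "aff_root_space L \<beta> = {x. \<forall>h\<in>aff_cartan L. aff_brk L h x = aff_scl L (aff_ipr L \<beta> h) x}"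

definition aff_pos_roots :: "('g::ab_group_add) lie_data \<Rightarrow> 'g affine set" where
  "aff_pos_roots L =
     {\<beta> \<in> aff_cartan L. \<beta> \<noteq> 0 \<and> aff_root_space L \<beta> \<noteq> {0} \<and> aff_root_space L \<beta> \<subseteq> aff_borel L}"

definition root_mult :: "('g::ab_group_add) lie_data \<Rightarrow> 'g affine \<Rightarrow> nat" where
  "root_mult L \<beta> = vector_space.dim (aff_scl L) (aff_root_space L \<beta>)"

definition aff_weyl_vector :: "('g::ab_group_add) lie_data \<Rightarrow> 'g affine" where
  "aff_weyl_vector L = emb (weyl_vector L) + aff_scl L (dual_coxeter L) Lambda0"


section \<open>The affine Weyl group\<close>

text \<open>
  Group elements act on the dual of \<open>aff_cartan L\<close>; the maps below are given by their usual formulas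
  on all of \<open>'g affine\<close>, which makes them act trivially on the orthogonal complement of
  \<open>aff_cartan L\<close>. Hence two of them are equal iff they agree on \<open>aff_cartan L\<close>.
\<close>

definition reflection :: "('g::ab_group_add) lie_data \<Rightarrow> 'g \<Rightarrow> 'g affine \<Rightarrow> 'g affine" where
  "reflection L \<alpha> x = x - aff_scl L (aff_ipr L x (emb \<alpha>)) (emb \<alpha>)"

inductive_set weyl_group :: "('g::ab_group_add) lie_data \<Rightarrow> ('g affine \<Rightarrow> 'g affine) set"
  for L :: "'g lie_data" where
  id: "id \<in> weyl_group L"
| step: "w \<in> weyl_group L \<Longrightarrow> \<alpha> \<in> roots L \<Longrightarrow> reflection L \<alpha> \<circ> w \<in> weyl_group L"

definition translation :: "('g::ab_group_add) lie_data \<Rightarrow> 'g \<Rightarrow> 'g affine \<Rightarrow> 'g affine" where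
  "translation L \<gamma> x =
     x + aff_scl L (aff_ipr L x central_K) (emb \<gamma>)
       - aff_scl L (aff_ipr L x (emb \<gamma>) + 1/2 * aff_ipr L x central_K * ipr L \<gamma> \<gamma>) delta"

definition aff_weyl_group :: "('g::ab_group_add) lie_data \<Rightarrow> ('g affine \<Rightarrow> 'g affine) set" where
  "aff_weyl_group L = {w \<circ> translation L \<gamma> | w \<gamma>. w \<in> weyl_group L \<and> \<gamma> \<in> root_lattice L}"

text \<open>Determinant of an endomorphism of a finite-dimensional subspace \<open>V\<close> (Leibniz formula in a basis).\<close>

definition det_on ::
  "(complex \<Rightarrow> 'a::ab_group_add \<Rightarrow> 'a) \<Rightarrow> 'a set \<Rightarrow> ('a \<Rightarrow> 'a) \<Rightarrow> complex" where
  "det_on s V f =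
     (let B = (SOME B. \<not> module.dependent s B \<and> module.span s B = V)
      in \<Sum>p\<in>{p. p permutes B}. of_int (sign p) * (\<Prod>b\<in>B. module.representation s B (f b) (p b)))"

definition weyl_sign :: "('g::ab_group_add) lie_data \<Rightarrow> ('g affine \<Rightarrow> 'g affine) \<Rightarrow> complex" where
  "weyl_sign L w = det_on (aff_scl L) (aff_cartan L) w"

text \<open>
  When \<open>\<Lambda> + \<rho>\<close> has a nontrivial stabilizer, the coefficients \<open>c(w)\<close> of a sum
  \<open>\<Sum>w. c(w) e\<^bsup>w(\<Lambda> + \<rho>)\<^esup>\<close> over the affine Weyl group are not determined by that sum.
  If \<open>\<Lambda>\<close> is dominant for the finite-dimensional Lie algebra, the numerator of the character is
  anti-invariant under the finite Weyl group and the coefficients are taken anti-invariant too,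
  so that the sum reads \<open>\<Sum>u. \<epsilon>(u) u (\<Sum>\<gamma>. c(t\<^sub>\<gamma>) t\<^sub>\<gamma>(e\<^bsup>\<Lambda> + \<rho>\<^esup>))\<close>.
  Without this normalization the values \<open>c(t\<^sub>\<gamma>)\<close> alone could be prescribed arbitrarily when
  the stabilizer is generated by a reflection.
\<close>

definition weyl_anti_invariant ::
  "('g::ab_group_add) lie_data \<Rightarrow> (('g affine \<Rightarrow> 'g affine) \<Rightarrow> int) \<Rightarrow> bool" where
  "weyl_anti_invariant L c \<longleftrightarrow>
     (\<forall>u\<in>weyl_group L. \<forall>w\<in>aff_weyl_group L. of_int (c (u \<circ> w)) = weyl_sign L u * of_int (c w))"


section \<open>Irreducible highest weight modules\<close>

definition aff_module ::
  "('g::ab_group_add) lie_data \<Rightarrow> (complex \<Rightarrow> 'v::ab_group_add \<Rightarrow> 'v) \<Rightarrow> ('g affine \<Rightarrow> 'v \<Rightarrow> 'v) \<Rightarrow> bool"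
  where
  "aff_module L s act \<longleftrightarrow>
     vector_space s \<and>
     (\<forall>x. Vector_Spaces.linear s s (act x)) \<and>
     (\<forall>v. Vector_Spaces.linear (aff_scl L) s (\<lambda>x. act x v)) \<and>
     (\<forall>x y v. act (aff_brk L x y) v = act x (act y v) - act y (act x v))"

definition irreducible_module ::
  "('g::ab_group_add) lie_data \<Rightarrow> (complex \<Rightarrow> 'v::ab_group_add \<Rightarrow> 'v) \<Rightarrow> ('g affine \<Rightarrow> 'v \<Rightarrow> 'v) \<Rightarrow> bool"
  where
  "irreducible_module L s act \<longleftrightarrow>
     aff_module L s act \<and> (\<exists>v::'v. v \<noteq> 0) \<and>
     (\<forall>U. module.subspace s U \<and> (\<forall>x. \<forall>v\<in>U. act x v \<in> U) \<longrightarrow> U = {0} \<or> U = UNIV)"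

text \<open>The module given by \<open>s\<close> and \<open>act\<close> is (a model of) \<open>L(\<Lambda>)\<close>.\<close>

definition is_L ::
  "('g::ab_group_add) lie_data \<Rightarrow> 'g affine \<Rightarrow> (complex \<Rightarrow> 'v::ab_group_add \<Rightarrow> 'v) \<Rightarrow> ('g affine \<Rightarrow> 'v \<Rightarrow> 'v) \<Rightarrow> bool"
  where
  "is_L L \<Lambda> s act \<longleftrightarrow>
     irreducible_module L s act \<and>
     (\<exists>v. v \<noteq> 0 \<and>
        (\<forall>h\<in>aff_cartan L. \<forall>n\<in>aff_n_plus L. act (h + n) v = s (aff_ipr L \<Lambda> h) v))"

definition weight_space ::
  "('g::ab_group_add) lie_data \<Rightarrow> (complex \<Rightarrow> 'v::ab_group_add \<Rightarrow> 'v) \<Rightarrow> ('g affine \<Rightarrow> 'v \<Rightarrow> 'v) \<Rightarrow> 'g affine \<Rightarrow> 'v set"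
  where
  "weight_space L s act \<mu> = {v. \<forall>h\<in>aff_cartan L. act h v = s (aff_ipr L \<mu> h) v}"


section \<open>Formal exponential series\<close>

text \<open>A series \<open>\<Sum>\<mu>. f(\<mu>) e\<^bsup>\<mu>\<^esup>\<close> is represented by its coefficient function \<open>f\<close>.\<close>

type_synonym 'g series = "'g affine \<Rightarrow> complex"

definition character ::
  "('g::ab_group_add) lie_data \<Rightarrow> (complex \<Rightarrow> 'v::ab_group_add \<Rightarrow> 'v) \<Rightarrow> ('g affine \<Rightarrow> 'v \<Rightarrow> 'v) \<Rightarrow> 'g series"
  where
  "character L s act \<mu> =
     (if \<mu> \<in> aff_cartan L then of_nat (vector_space.dim s (weight_space L s act \<mu>)) else 0)"

text \<open>
  The convolution is meant for series whose supports make each of the following sums finite, as is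
  the case for supports contained in finitely many cones \<open>\<lambda> - \<nat>\<cdot>\<close>(positive roots).
\<close>

definition series_mult ::
  "('g::ab_group_add) series \<Rightarrow> 'g series \<Rightarrow> 'g series" where
  "series_mult f g \<mu> = (\<Sum>\<nu> | f \<nu> \<noteq> 0 \<and> g (\<mu> - \<nu>) \<noteq> 0. f \<nu> * g (\<mu> - \<nu>))"

text \<open>
  Finite products live in the group algebra \<open>'g affine \<Rightarrow>\<^sub>0 complex\<close>; each coefficient of the
  infinite product is the (eventually constant) limit over finite sets of positive roots.
\<close>

definition aff_denominator :: "('g::ab_group_add) lie_data \<Rightarrow> 'g series" where
  "aff_denominator L \<mu> =
     Lim (finite_subsets_at_top (aff_pos_roots L))
       (\<lambda>F. Poly_Mapping.lookup
          (Poly_Mapping.single (aff_weyl_vector L) 1 *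
           (\<Prod>\<beta>\<in>F. (1 - Poly_Mapping.single (- \<beta>) 1) ^ root_mult L \<beta>)) \<mu>)"

text \<open>
  \<open>exp_sum I a e\<close> is \<open>\<Sum>i\<in>I. a(i) e\<^bsup>e(i)\<^esup>\<close>, meaningful when the fibres of \<open>e\<close> on \<open>I\<close> are finite.
\<close>

definition exp_sum :: "'i set \<Rightarrow> ('i \<Rightarrow> complex) \<Rightarrow> ('i \<Rightarrow> 'g affine) \<Rightarrow> ('g::ab_group_add) series" where
  "exp_sum I a e \<mu> = (\<Sum>i | i \<in> I \<and> e i = \<mu>. a i)"

text \<open>The action determined by \<open>w(e\<^bsup>\<lambda>\<^esup>) = e\<^bsup>w(\<lambda>)\<^esup>\<close>.\<close>

definition act_series ::
  "('g affine \<Rightarrow> 'g affine) \<Rightarrow> ('g::ab_group_add) series \<Rightarrow> 'g series" where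
  "act_series w f \<mu> = f (inv w \<mu>)"

end

theory Submission
  imports Defs "HOL-Library.FuncSet" "Jordan_Normal_Form.Determinant"
begin

text \<open>
  Write \<open>\<nu> = \<Lambda> + \<rho>\<close> for the shifted weight. By (ii) it is fixed by the affine reflection
  \<open>s\<^sub>\<alpha> t\<^sub>-\<^sub>\<alpha>\<close> in \<open>\<delta> - \<alpha>\<close>. Substituting this into the anti-invariant sum replaces \<open>c(\<gamma>)\<close> by
  \<open>- c(s\<^sub>\<alpha> \<gamma> - \<alpha>)\<close>, so averaging the two expressions turns the affine function \<open>c(\<gamma>) = f(\<gamma>) + b\<close> into
  \<open>(c(\<gamma>) - c(s\<^sub>\<alpha> \<gamma> - \<alpha>)) / 2 = f(\<alpha>) ((\<alpha>|\<gamma>) + 1) / 2\<close>, and only \<open>f(\<alpha>) = 1\<close> remains to be shown.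

  The coefficient of \<open>e\<^sup>\<nu>\<close> in \<open>R ch L(\<Lambda>)\<close> is \<open>1\<close>, which gives \<open>f(\<alpha>) T = 2\<close> with
  \<open>T = \<Sum> \<epsilon>(u) ((\<alpha>|\<gamma>) + 1)\<close> over the stabilizer elements \<open>u t\<^sub>\<gamma>\<close> of \<open>\<nu>\<close>. By (iii) such an element maps
  \<open>\<delta> - \<alpha>\<close> to \<open>((\<alpha>|\<gamma>) + 1) (\<delta> - \<alpha>)\<close>, so the summand is a multiplicative character of the stabilizer;
  as \<open>T \<noteq> 0\<close>, it is trivial and \<open>T\<close> is the order of the stabilizer. Since \<open>f(\<alpha>) = c(\<alpha>) - c(0)\<close> is an
  integer and the stabilizer has at least the two elements \<open>1\<close> and \<open>s\<^sub>\<alpha> t\<^sub>-\<^sub>\<alpha>\<close>, \<open>f(\<alpha>) = 1\<close> follows. In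
  particular, no general description of stabilizers in affine Weyl groups is required.
\<close>

section \<open>Eigenvectors and the determinant of a reflection\<close>

text \<open>Because \<nu> has a nontrivial stabilizer, the numerator does not determine the
  coefficients \<open>c\<close>; only sums over a fibre of w \<mapsto> w \<nu> can be compared.
  Right multiplication by a stabilizer element permutes every fibre. This one device serves twice:
  with the reflection in \<delta> - \<alpha> it yields the averaged coefficients, and with an
  arbitrary stabilizer element it shows that the character on the stabilizer is trivial.

  The averaged coefficient comes from additivity alone: \<gamma> and its image differ by the integer
  multiple (\<alpha>|\<gamma>) + 1 of \<alpha>, so the constant b cancels and f is evaluated only on
  multiples of \<alpha>.

  The normalization rests on a height element H = \<rho>' + N d of the affine Cartan subalgebra, for
  which both the denominator and the character have a unique top term.

  \<open>weyl_sign\<close> is a Leibniz determinant in a chosen basis. It is evaluated only at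
  reflections, where the matrix is a rank-one perturbation of the identity.\<close>

context vector_space
begin

text \<open>The operator T - a kills the component with eigenvalue a and multiplies the one with
  eigenvalue c by c - a, which is nonzero; induction then removes one eigenvalue at a time. A
  component is indexed by its own eigenvalue, so distinct indices automatically mean distinct
  eigenvalues.\<close>

lemma eigen_components_in_subspace:
  assumes lin: "Vector_Spaces.linear scale scale T" and U: "subspace U" "\<And>x. x \<in> U \<Longrightarrow> T x \<in> U"
    and "finite F"
  shows "(\<And>c. c \<in> F \<Longrightarrow> T (y c) = scale c (y c)) \<Longrightarrow> (\<Sum>c\<in>F. y c) \<in> U \<Longrightarrow> c \<in> F \<Longrightarrow> y c \<in> U"
  using \<open>finite F\<close>
proof (induction F arbitrary: y c rule: finite_induct)
  case empty
  then show ?case by simp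
next
  case (insert a F)
  interpret T: Vector_Spaces.linear scale scale T by fact
  let ?x = "\<Sum>c\<in>insert a F. y c"
  have "T ?x - scale a ?x = (\<Sum>c\<in>insert a F. scale (c - a) (y c))"
    by (simp only: T.sum scale_sum_right sum_subtractf[symmetric])
       (intro sum.cong refl, simp add: insert.prems(1) scale_left_diff_distrib)
  also have "\<dots> = (\<Sum>c\<in>F. scale (c - a) (y c))"
    using insert.hyps by simp
  finally have *: "(\<Sum>c\<in>F. scale (c - a) (y c)) \<in> U"
    using subspace_diff[OF U(1) U(2)[OF insert.prems(2)] subspace_scale[OF U(1) insert.prems(2), of a]]
    by simp
  have F: "y c \<in> U" if "c \<in> F" for c
  proof -
    have "scale (c - a) (y c) \<in> U"
    proof (rule insert.IH[where y = "\<lambda>c. scale (c - a) (y c)"])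
      show "T (scale (c - a) (y c)) = scale c (scale (c - a) (y c))" if "c \<in> F" for c
        using insert.prems(1)[of c] that by (simp add: T.scale mult.commute)
    qed (use * that in auto)
    then have "scale (1 / (c - a)) (scale (c - a) (y c)) \<in> U"
      by (rule subspace_scale[OF U(1)])
    moreover have "c \<noteq> a" using that insert.hyps by auto
    ultimately show ?thesis by simp
  qed
  have "y a = ?x - (\<Sum>c\<in>F. y c)" using insert.hyps by simp
  also have "\<dots> \<in> U"
    by (rule subspace_diff[OF U(1) insert.prems(2) subspace_sum[OF U(1) F]])
  finally have "y a \<in> U" .
  with F insert.prems(3) show ?case by blast
qed

lemma span_eigenvectors_decomposition:
  assumes lin: "Vector_Spaces.linear scale scale T"
    and x: "x \<in> span {x. \<exists>c\<in>C. T x = scale c x}"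
  shows "\<exists>F y. finite F \<and> F \<subseteq> C \<and> (\<forall>c\<in>F. T (y c) = scale c (y c)) \<and> x = (\<Sum>c\<in>F. y c)"
proof -
  interpret T: Vector_Spaces.linear scale scale T by fact
  obtain t r where t: "finite t" "t \<subseteq> {x. \<exists>c\<in>C. T x = scale c x}" "x = (\<Sum>a\<in>t. scale (r a) a)"
    using x unfolding span_explicit by blast
  from t(2) have "\<forall>a\<in>t. \<exists>c. c \<in> C \<and> T a = scale c a" by blast
  then obtain e where e: "\<And>a. a \<in> t \<Longrightarrow> e a \<in> C \<and> T a = scale (e a) a"
    using bchoice[of t "\<lambda>a c. c \<in> C \<and> T a = scale c a"] by blast
  show ?thesis
  proof (intro exI conjI ballI)
    show "finite (e ` t)" "e ` t \<subseteq> C" using t e by auto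
    show "x = (\<Sum>c\<in>e ` t. \<Sum>a\<in>{a \<in> t. e a = c}. scale (r a) a)"
      unfolding t(3) by (rule sum.image_gen) fact
    show "T (\<Sum>a\<in>{a \<in> t. e a = c}. scale (r a) a) = scale c (\<Sum>a\<in>{a \<in> t. e a = c}. scale (r a) a)" for c
      by (simp only: T.sum scale_sum_right) (intro sum.cong refl, simp add: T.scale e mult.commute)
  qed
qed

text \<open>Moving x to the other side turns its expansion into a decomposition of 0 with the extra
  component - x at c. The components of 0 lie in the invariant subspace {0}. Later this separates
  weights by the eigenvalues of a height element.\<close>

lemma eigenvector_not_in_other_span:
  assumes lin: "Vector_Spaces.linear scale scale T"
    and x: "x \<in> span {x. \<exists>c\<in>C. T x = scale c x}" "T x = scale c x" "c \<notin> C"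
  shows "x = 0"
proof -
  interpret T: Vector_Spaces.linear scale scale T by fact
  obtain F y where F: "finite F" "F \<subseteq> C" "\<forall>c\<in>F. T (y c) = scale c (y c)"
    "x = (\<Sum>c\<in>F. y c)"
    using span_eigenvectors_decomposition[OF lin x(1)] by blast
  have c: "c \<notin> F" using F(2) x(3) by blast
  let ?y = "y(c := - x)"
  have "?y c \<in> {0}"
  proof (rule eigen_components_in_subspace[OF lin, where F = "insert c F" and y = ?y])
    have "(\<Sum>c\<in>F. ?y c) = (\<Sum>c\<in>F. y c)" using c by (intro sum.cong) auto
    then show "(\<Sum>c\<in>insert c F. ?y c) \<in> {0}" using F c by simp
    show "T (?y c') = scale c' (?y c')" if "c' \<in> insert c F" for c'
      using that c F(3) x(2) by (auto simp: T.neg)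
  qed (use F in auto)
  then show ?thesis by simp
qed

text \<open>Commuting diagonalizable operators: the joint eigenspace U of the operators treated so
  far is stable under the next one, so the components of a vector of U for that operator stay in
  U.\<close>

lemma simultaneous_eigenvectors_span:
  assumes "finite I"
  shows "(\<And>i. i \<in> I \<Longrightarrow> Vector_Spaces.linear scale scale (T i)) \<Longrightarrow>
    (\<And>i j x. i \<in> I \<Longrightarrow> j \<in> I \<Longrightarrow> T i (T j x) = T j (T i x)) \<Longrightarrow>
    (\<And>i. i \<in> I \<Longrightarrow> span {x. \<exists>c. T i x = scale c x} = UNIV) \<Longrightarrow>
    span {x. \<forall>i\<in>I. \<exists>c. T i x = scale c x} = UNIV"
  using assms
proof (induction I rule: finite_induct)
  case empty
  then show ?case by simp
next
  case (insert j I)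
  let ?A = "\<lambda>I. {x. \<forall>i\<in>I. \<exists>c. T i x = scale c x}"
  interpret Tj: Vector_Spaces.linear scale scale "T j" by (simp add: insert.prems(1))
  have "x \<in> span (?A (insert j I))" if x: "x \<in> ?A I" for x
  proof -
    from x have "\<forall>i\<in>I. \<exists>c. T i x = scale c x" by blast
    then obtain e where e: "\<And>i. i \<in> I \<Longrightarrow> T i x = scale (e i) x"
      using bchoice[of I "\<lambda>i c. T i x = scale c x"] by blast
    define U where "U = {x. \<forall>i\<in>I. T i x = scale (e i) x}"
    have U: "subspace U"
    proof (rule subspaceI)
      show "0 \<in> U" unfolding U_def
        using insert.prems(1) by (auto dest!: module_hom.zero[OF Vector_Spaces.linear.axioms(3)])
      show "y + z \<in> U" if "y \<in> U" "z \<in> U" for y z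
        using that insert.prems(1) unfolding U_def by (auto simp: Vector_Spaces.linear_iff scale_right_distrib)
      show "scale c y \<in> U" if "y \<in> U" for y c
        using that insert.prems(1) unfolding U_def by (auto simp: Vector_Spaces.linear_iff mult.commute)
    qed
    have TU: "T j y \<in> U" if "y \<in> U" for y
      using that insert.prems(2)[of _ j] unfolding U_def by (auto simp: Tj.scale)
    have "x \<in> span {x. \<exists>c\<in>UNIV. T j x = scale c x}"
      using insert.prems(3)[of j] by simp
    then obtain F y
      where F: "finite F" "\<forall>c\<in>F. T j (y c) = scale c (y c)" "x = (\<Sum>c\<in>F. y c)"
      using span_eigenvectors_decomposition[OF Tj.linear_axioms, of x UNIV] by blast
    have "x \<in> U" using e by (simp add: U_def)
    then have yU: "y c \<in> U" if "c \<in> F" for c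
      using eigen_components_in_subspace[OF Tj.linear_axioms U TU F(1), of y c] F(2,3) that
      by simp
    have "y c \<in> ?A (insert j I)" if "c \<in> F" for c
      using that F(2) yU[OF that] unfolding U_def by blast
    then show ?thesis unfolding F(3) by (intro span_sum span_base)
  qed
  then have "span (?A I) \<subseteq> span (?A (insert j I))"
    by (intro span_minimal) auto
  moreover have "span (?A I) = UNIV"
    using insert.prems by (intro insert.IH) auto
  ultimately show ?case by auto
qed

text \<open>This is the same choice of basis as in \<open>det_on\<close>, so the lemma is what makes
  that definition usable.\<close>

lemma finite_basis_of_subspace:
  assumes "finite S" "V \<subseteq> span S" "subspace V"
  defines "B \<equiv> SOME B. independent B \<and> span B = V"
  shows "finite B" "independent B" "span B = V"
proof -
  obtain B' where B': "B' \<subseteq> V" "independent B'" "V \<subseteq> span B'"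
    using maximal_independent_subset by blast
  then have "independent B' \<and> span B' = V"
    by (meson assms(3) order_antisym span_minimal)
  then have "independent B \<and> span B = V"
    unfolding B_def by (rule someI[where P = "\<lambda>B. independent B \<and> span B = V"])
  then show "independent B" "span B = V" by auto
  then show "finite B"
    using independent_span_bound[OF assms(1)] assms(2) span_superset by blast
qed

end

section \<open>Determinants of rank-one perturbations of the identity\<close>

lemma det_one_minus_rank_one:
  fixes a \<phi> :: "nat \<Rightarrow> complex"
  shows "det (mat n n (\<lambda>(i, j). (if i = j then 1 else 0) - \<phi> i * a j)) = 1 - (\<Sum>i<n. \<phi> i * a i)"
proof -
  define u where "u = mat n 1 (\<lambda>(i, j). \<phi> i)"
  define v where "v = mat 1 n (\<lambda>(i, j). a j)"
  define M where "M = mat n n (\<lambda>(i, j). (if i = j then 1 else 0) - \<phi> i * a j)"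
  have M: "M = 1\<^sub>m n - u * v"
    by (rule eq_matI) (auto simp: M_def u_def v_def scalar_prod_def)
  have [simp]: "u \<in> carrier_mat n 1" "v \<in> carrier_mat 1 n" "M \<in> carrier_mat n n"
    by (auto simp: u_def v_def M_def)
  have w: "1\<^sub>m 1 - v * u \<in> carrier_mat 1 1"
      by (rule carrier_matI) (simp_all add: u_def v_def)
  \<comment> \<open>Bordering \<open>1 - u v\<close> to \<open>A\<close> and \<open>1 - v u\<close> to \<open>C\<close> gives \<open>A B = B C\<close>.\<close>
  define A where "A = four_block_mat M u (0\<^sub>m 1 n) (1\<^sub>m 1)"
  define B where "B = four_block_mat (1\<^sub>m n) (0\<^sub>m n 1) v (1\<^sub>m 1)"
  define C where "C = four_block_mat (1\<^sub>m n) u (0\<^sub>m 1 n) (1\<^sub>m 1 - v * u)"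
  have "A * B = four_block_mat (M * 1\<^sub>m n + u * v) (M * 0\<^sub>m n 1 + u * 1\<^sub>m 1)
      (0\<^sub>m 1 n * 1\<^sub>m n + 1\<^sub>m 1 * v) (0\<^sub>m 1 n * 0\<^sub>m n 1 + 1\<^sub>m 1 * 1\<^sub>m 1)"
    unfolding A_def B_def by (rule mult_four_block_mat[of _ n n _ 1 _ 1 _ _ n _ 1]) (auto simp del: One_nat_def)
  also have "\<dots> = four_block_mat (1\<^sub>m n) u v (1\<^sub>m 1)"
  proof (intro arg_cong4[where f = four_block_mat])
    show "M * 1\<^sub>m n + u * v = 1\<^sub>m n"
      by (rule eq_matI) (auto simp: M_def u_def v_def scalar_prod_def)
    show "M * 0\<^sub>m n 1 + u * 1\<^sub>m 1 = u"
      by (simp add: right_mult_zero_mat[of M n n] right_mult_one_mat[of u n 1] left_add_zero_mat[of u n 1] del: One_nat_def)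
    show "0\<^sub>m 1 n * 1\<^sub>m n + 1\<^sub>m 1 * v = v"
      by (simp add: right_mult_one_mat[of _ 1 n] left_mult_one_mat[of v 1 n] left_add_zero_mat[of v 1 n] del: One_nat_def)
  qed auto
  also have "\<dots> = four_block_mat (1\<^sub>m n * 1\<^sub>m n + 0\<^sub>m n 1 * 0\<^sub>m 1 n) (1\<^sub>m n * u + 0\<^sub>m n 1 * (1\<^sub>m 1 - v * u))
      (v * 1\<^sub>m n + 1\<^sub>m 1 * 0\<^sub>m 1 n) (v * u + 1\<^sub>m 1 * (1\<^sub>m 1 - v * u))"
  proof (intro arg_cong4[where f = four_block_mat])
    show "u = 1\<^sub>m n * u + 0\<^sub>m n 1 * (1\<^sub>m 1 - v * u)"
      by (simp add: left_mult_zero_mat[OF w] left_mult_one_mat[of u n 1] right_add_zero_mat[of u n 1]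
          del: One_nat_def)
    show "v = v * 1\<^sub>m n + 1\<^sub>m 1 * 0\<^sub>m 1 n"
      by (simp add: right_mult_one_mat[of v 1 n] left_mult_one_mat[of _ 1 n] right_add_zero_mat[of v 1 n]
          del: One_nat_def)
    show "1\<^sub>m 1 = v * u + 1\<^sub>m 1 * (1\<^sub>m 1 - v * u)"
      unfolding left_mult_one_mat[OF w] by (rule eq_matI) (auto simp: u_def v_def)
  qed auto
  also have "\<dots> = B * C"
    unfolding B_def C_def by (rule mult_four_block_mat[of _ n n _ 1 _ 1 _ _ n _ 1, symmetric]) (auto simp: w simp del: One_nat_def)
  finally have "det (A * B) = det (B * C)" by simp
  moreover have "A \<in> carrier_mat (n + 1) (n + 1)" "B \<in> carrier_mat (n + 1) (n + 1)"
    "C \<in> carrier_mat (n + 1) (n + 1)"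
    unfolding A_def B_def C_def using w by (auto intro!: four_block_carrier_mat simp del: One_nat_def)
  ultimately have "det A * det B = det B * det C" by (simp add: det_mult)
  moreover have "det A = det M * det (1\<^sub>m 1)"
    unfolding A_def by (rule det_four_block_mat_lower_left_zero) (auto simp del: One_nat_def)
  moreover have "det B = det (1\<^sub>m n) * det (1\<^sub>m 1)"
    unfolding B_def by (rule det_four_block_mat_upper_right_zero) (auto simp del: One_nat_def)
  moreover have "det C = det (1\<^sub>m n) * det (1\<^sub>m 1 - v * u)"
    unfolding C_def by (rule det_four_block_mat_lower_left_zero[OF _ _ _ w]) (auto simp del: One_nat_def)
  ultimately have "det M = det (1\<^sub>m 1 - v * u)" by simp
  also have "\<dots> = 1 - (\<Sum>i<n. \<phi> i * a i)"
    by (subst det_single) (auto simp: u_def v_def scalar_prod_def lessThan_atLeast0 mult.commute)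
  finally show ?thesis by (simp add: M_def)
qed

text \<open>\<open>det_on\<close> sums over permutations of a set of vectors, \<open>det\<close>
  over permutations of indices. Transport along the enumeration e matches the two sums and preserves
  signs.\<close>

lemma sum_permutations_reindex:
  assumes e: "bij_betw e {0..<n} B"
  shows "(\<Sum>p | p permutes B. of_int (sign p) * (\<Prod>b\<in>B. M b (p b)))
    = det (mat n n (\<lambda>(i, j). M (e i) (e j) :: complex))"
proof -
  have inj: "inj_on e {0..<n}" using e by (simp add: bij_betw_def)
  let ?m = "map_permutation {0..<n} e" and ?m' = "map_permutation B (inv_into {0..<n} e)"
  have e': "bij_betw (inv_into {0..<n} e) B {0..<n}" using e by (rule bij_betw_inv_into)
  have "(\<Sum>p | p permutes B. of_int (sign p) * (\<Prod>b\<in>B. M b (p b)))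
    = (\<Sum>p | p permutes {0..<n}. of_int (sign p) * (\<Prod>i\<in>{0..<n}. M (e i) (e (p i))))"
  proof (rule sum.reindex_bij_witness[of _ ?m ?m'])
    fix p assume p: "p \<in> {p. p permutes B}"
    show "?m (?m' p) = p"
      using p e e' by (intro map_permutation_compose_inv) (auto simp: bij_betw_inv_into_right)
    show m': "?m' p \<in> {p. p permutes {0..<n}}"
      using map_permutation_permutes[OF e'] p by auto
    have *: "p (e i) = e (?m' p i)" if "i < n" for i
      using map_permutation_apply[OF inj, of i "?m' p"] \<open>?m (?m' p) = p\<close> that by simp
    have "sign p = sign (?m' p)"
      using m' inj by (subst \<open>?m (?m' p) = p\<close>[symmetric], subst sign_map_permutation) auto
    moreover have "(\<Prod>b\<in>B. M b (p b)) = (\<Prod>i\<in>{0..<n}. M (e i) (p (e i)))"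
      using prod.reindex_bij_betw[OF e, of "\<lambda>b. M b (p b)"] by simp
    ultimately show "of_int (sign (?m' p)) * (\<Prod>i\<in>{0..<n}. M (e i) (e (?m' p i))) = of_int (sign p) * (\<Prod>b\<in>B. M b (p b))"
      using * by simp
  next
    fix p assume p: "p \<in> {p. p permutes {0..<n}}"
    show "?m' (?m p) = p"
      using p e e' inj by (intro map_permutation_compose_inv) auto
    show "?m p \<in> {p. p permutes B}"
      using map_permutation_permutes[OF e] p by auto
  qed
  also have "\<dots> = det (mat n n (\<lambda>(i, j). M (e i) (e j)))"
    by (subst det_def'[of _ n])
       (auto simp: sign_def permutes_in_image intro!: sum.cong prod.cong)
  finally show ?thesis .
qed

text \<open>In the basis B, f is the identity minus the rank-one matrix with entries \<phi>(b) times
  a coordinate of a. The trace of the latter is \<phi> applied to the expansion of a, that is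
  \<phi>(a).\<close>

lemma det_on_reflection:
  fixes s :: "complex \<Rightarrow> 'b::ab_group_add \<Rightarrow> 'b"
  assumes "vector_space s" "finite S" "V \<subseteq> module.span s S" "module.subspace s V" "a \<in> V"
    and \<phi>: "Vector_Spaces.linear s (*) \<phi>" and f: "\<And>x. f x = x - s (\<phi> x) a"
  shows "det_on s V f = 1 - \<phi> a"
proof -
  interpret vector_space s by fact
  interpret phi: Vector_Spaces.linear s "(*)" \<phi> by fact
  define B where "B = (SOME B. independent B \<and> span B = V)"
  have B: "finite B" "independent B" "span B = V"
    using finite_basis_of_subspace[OF assms(2-4)] by (auto simp: B_def)
  obtain e where e: "bij_betw e {0..<card B} B"
    using ex_bij_betw_nat_finite[OF B(1)] by blast
  have eB: "e i \<in> B" if "i < card B" for i using e that by (auto simp: bij_betw_def)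
  let ?r = "representation B"
  have r: "?r (f (e i)) (e j) = (if i = j then 1 else 0) - \<phi> (e i) * ?r a (e j)"
    if "i < card B" "j < card B" for i j
  proof -
    have "e i \<in> span B" "a \<in> span B" using eB that assms(5) B(3) by (auto intro: span_base)
    then have "?r (f (e i)) (e j) = ?r (e i) (e j) - \<phi> (e i) * ?r a (e j)"
      unfolding f by (simp add: representation_diff representation_scale span_scale B(2))
    moreover have "e i = e j \<longleftrightarrow> i = j"
      using e that by (auto simp: bij_betw_def inj_on_def)
    ultimately show ?thesis using representation_basis[OF B(2) eB[OF that(1)]] by auto
  qed
  have "det_on s V f = det (mat (card B) (card B) (\<lambda>(i, j). ?r (f (e i)) (e j)))"
    unfolding det_on_def Let_def B_def[symmetric] by (rule sum_permutations_reindex[OF e])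
  also have "mat (card B) (card B) (\<lambda>(i, j). ?r (f (e i)) (e j))
      = mat (card B) (card B) (\<lambda>(i, j). (if i = j then 1 else 0) - \<phi> (e i) * ?r a (e j))"
    by (rule eq_matI) (auto simp: r)
  also have "det \<dots> = 1 - (\<Sum>i<card B. \<phi> (e i) * ?r a (e i))"
    by (rule det_one_minus_rank_one)
  also have "(\<Sum>i<card B. \<phi> (e i) * ?r a (e i)) = (\<Sum>b\<in>B. \<phi> b * ?r a b)"
    using sum.reindex_bij_betw[OF e, of "\<lambda>b. \<phi> b * ?r a b"] by (simp add: lessThan_atLeast0)
  also have "\<dots> = \<phi> (\<Sum>b\<in>B. s (?r a b) b)"
    by (simp add: phi.sum phi.scale mult.commute)
  also have "(\<Sum>b\<in>B. s (?r a b) b) = a"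
    using assms(5) B by (intro sum_representation_eq) auto
  finally show ?thesis .
qed

section \<open>Root systems of simply laced Lie algebras\<close>

locale simply_laced_lie_algebra =
  fixes L :: "('g::ab_group_add) lie_data"
  assumes ssl: "simple_simply_laced L"
begin

sublocale vector_space "scl L"
  using ssl by (auto simp: simple_simply_laced_def simple_lie_algebra_def lie_algebra_def)

lemma brk_linear_right: "Vector_Spaces.linear (scl L) (scl L) (\<lambda>y. brk L x y)"
  and brk_linear_left: "Vector_Spaces.linear (scl L) (scl L) (\<lambda>x. brk L x y)"
  and brk_self [simp]: "brk L x x = 0"
  and brk_jacobi_cyclic: "brk L x (brk L y z) + brk L y (brk L z x) + brk L z (brk L x y) = 0"
  using ssl by (auto simp: simple_simply_laced_def simple_lie_algebra_def lie_algebra_def)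

lemma brk_simps:
  "brk L x (y + z) = brk L x y + brk L x z" "brk L (x + y) z = brk L x z + brk L y z"
  "brk L x (scl L c y) = scl L c (brk L x y)" "brk L (scl L c x) y = scl L c (brk L x y)"
  using brk_linear_right brk_linear_left by (auto simp: Vector_Spaces.linear_iff)

lemma brk_zero [simp]: "brk L x 0 = 0" "brk L 0 x = 0"
  using brk_simps(3)[of x 0 0] brk_simps(4)[of 0 0 x] by simp_all

lemma brk_antisym: "brk L x y = - brk L y x"
proof -
  have "0 = brk L (x + y) (x + y)" by simp
  also have "\<dots> = brk L x (x + y) + brk L y (x + y)" by (rule brk_simps)
  also have "\<dots> = brk L x y + brk L y x" by (simp add: brk_simps)
  finally show ?thesis by (simp add: eq_neg_iff_add_eq_0)
qed

lemma brk_minus [simp]: "brk L x (- y) = - brk L x y" "brk L (- x) y = - brk L x y"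
  using brk_simps(3)[of x "-1" y] brk_simps(4)[of "-1" x y] by simp_all

lemma brk_jacobi: "brk L x (brk L y z) = brk L (brk L x y) z + brk L y (brk L x z)"
  using brk_jacobi_cyclic[of x y z] brk_antisym[of z x] brk_antisym[of z "brk L x y"]
  by (simp add: algebra_simps eq_neg_iff_add_eq_0)

lemma ipr_linear: "Vector_Spaces.linear (scl L) (*) (\<lambda>y. ipr L x y)"
  and ipr_sym: "ipr L x y = ipr L y x"
  and ipr_invariant: "ipr L (brk L x y) z = ipr L x (brk L y z)"
  and ipr_nondegenerate: "(\<And>y. ipr L x y = 0) \<Longrightarrow> x = 0"
  using ssl unfolding simple_simply_laced_def invariant_form_def by blast+

lemma ipr_simps [simp]:
  "ipr L x (y + z) = ipr L x y + ipr L x z" "ipr L (x + y) z = ipr L x z + ipr L y z"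
  "ipr L x (scl L c y) = c * ipr L x y" "ipr L (scl L c x) y = c * ipr L x y"
proof -
  show *: "ipr L x (y + z) = ipr L x y + ipr L x z" "ipr L x (scl L c y) = c * ipr L x y" for x y z c
    using ipr_linear[of x] by (auto simp: Vector_Spaces.linear_iff)
  show "ipr L (x + y) z = ipr L x z + ipr L y z" "ipr L (scl L c x) y = c * ipr L x y"
    using *(1)[where x = z and y = x and z = y] *(2)[where x = y and y = x and c = c] by (simp_all add: ipr_sym)
qed

lemma ipr_zero [simp]: "ipr L x 0 = 0" "ipr L 0 x = 0"
  using ipr_simps(3)[of x 0 0] ipr_simps(4)[of 0 0 x] by simp_all

lemma ipr_minus [simp]: "ipr L x (- y) = - ipr L x y" "ipr L (- x) y = - ipr L x y"
  using ipr_simps(3)[of x "-1" y] ipr_simps(4)[of "-1" x y] by simp_all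

lemma ipr_diff [simp]: "ipr L x (y - z) = ipr L x y - ipr L x z" "ipr L (x - y) z = ipr L x z - ipr L y z"
  using ipr_simps(1)[of x y "- z"] ipr_simps(2)[of x "- y" z] by simp_all

lemma ipr_sum: "ipr L x (sum f A) = (\<Sum>a\<in>A. ipr L x (f a))"
  by (induction A rule: infinite_finite_induct) simp_all

lemma finite_spanning_set: "\<exists>B. finite B \<and> span B = UNIV"
  using ssl by (auto simp: simple_simply_laced_def fin_dim_space_def)

lemma finite_independent: "independent B \<Longrightarrow> finite B"
  using finite_spanning_set independent_span_bound by blast

section \<open>The Cartan subalgebra and the form on it\<close>

lemma subspace_cartan: "subspace (cartan L)"
  and cartan_abelian: "x \<in> cartan L \<Longrightarrow> y \<in> cartan L \<Longrightarrow> brk L x y = 0"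
  and cartan_maximal: "abelian_subalgebra L A \<Longrightarrow> cartan L \<subseteq> A \<Longrightarrow> A = cartan L"
  and cartan_semisimple: "h \<in> cartan L \<Longrightarrow> span {x. \<exists>c. brk L h x = scl L c x} = UNIV"
  using ssl by (auto simp: simple_simply_laced_def cartan_subalgebra_def abelian_subalgebra_def)

lemmas cartan_closed [intro] = subspace_0[OF subspace_cartan] subspace_add[OF subspace_cartan]
  subspace_scale[OF subspace_cartan] subspace_neg[OF subspace_cartan] subspace_diff[OF subspace_cartan]

lemma simple_roots_in_roots: "i \<in> {1..rk L} \<Longrightarrow> simple_root L i \<in> roots L"
  and simple_roots_inj: "inj_on (simple_root L) {1..rk L}"
  and simple_roots_independent: "independent (simple_root L ` {1..rk L})"
  and simple_roots_span: "span (simple_root L ` {1..rk L}) = cartan L"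
  and root_sign: "\<beta> \<in> roots L \<Longrightarrow> \<beta> \<in> nonneg_combinations L \<or> - \<beta> \<in> nonneg_combinations L"
  and root_norm: "\<beta> \<in> roots L \<Longrightarrow> ipr L \<beta> \<beta> = 2"
  using ssl unfolding simple_simply_laced_def simple_root_system_def by auto

lemma rootsD: assumes "\<beta> \<in> roots L" shows "\<beta> \<in> cartan L" "\<beta> \<noteq> 0" "\<exists>x\<in>root_space L \<beta>. x \<noteq> 0"
  using assms by (auto simp: roots_def root_space_def)

lemma simple_roots_cartan: "i \<in> {1..rk L} \<Longrightarrow> simple_root L i \<in> cartan L"
  using simple_roots_in_roots rootsD by blast

text \<open>If x commutes with the Cartan subalgebra, then x and the Cartan subalgebra together span
  an abelian subalgebra, which maximality collapses.\<close>

lemma cartan_centralizer: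
  assumes "\<And>h. h \<in> cartan L \<Longrightarrow> brk L h x = 0"
  shows "x \<in> cartan L"
proof -
  let ?A = "{scl L c x + h | c h. h \<in> cartan L}"
  have "subspace ?A"
  proof (rule subspaceI)
    show "0 \<in> ?A" by (auto intro!: exI[of _ 0] exI[of _ "0::complex"])
    show "u + v \<in> ?A" if uv: "u \<in> ?A" "v \<in> ?A" for u v
    proof -
      obtain c h d k where *: "u = scl L c x + h" "v = scl L d x + k" "h \<in> cartan L" "k \<in> cartan L"
        using uv by blast
      then have "u + v = scl L (c + d) x + (h + k)" by (simp add: scale_left_distrib)
      with * show ?thesis by blast
    qed
    show "scl L a u \<in> ?A" if u: "u \<in> ?A" for a u
    proof -
      obtain c h where *: "u = scl L c x + h" "h \<in> cartan L" using u by blast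
      then have "scl L a u = scl L (a * c) x + scl L a h" by (simp add: scale_right_distrib)
      with * show ?thesis by blast
    qed
  qed
  moreover have "brk L x h = 0" if "h \<in> cartan L" for h
    using assms[OF that] brk_antisym[of x h] by simp
  ultimately have "abelian_subalgebra L ?A"
    using assms cartan_abelian by (auto simp: abelian_subalgebra_def brk_simps)
  moreover have "cartan L \<subseteq> ?A"
  proof
    fix h assume "h \<in> cartan L"
    then have "h = scl L 0 x + h \<and> h \<in> cartan L" by simp
    then show "h \<in> ?A" by blast
  qed
  ultimately have "?A = cartan L" by (rule cartan_maximal)
  moreover have "x \<in> ?A" using subspace_0[OF subspace_cartan] by (auto intro!: exI[of _ 0] exI[of _ "1::complex"])
  ultimately show ?thesis by blast
qed

lemma cartan_induct [consumes 1, case_names subspace simple]: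
  assumes "h \<in> cartan L" "subspace {h. P h}" "\<And>i. i \<in> {1..rk L} \<Longrightarrow> P (simple_root L i)"
  shows "P h"
proof -
  have "span (simple_root L ` {1..rk L}) \<subseteq> {h. P h}"
    using assms(2,3) by (intro span_minimal) auto
  then show ?thesis using assms(1) simple_roots_span by auto
qed

lemma joint_eigenvectors_span:
  "span {x. \<forall>i\<in>{1..rk L}. \<exists>c. brk L (simple_root L i) x = scl L c x} = UNIV"
proof (rule simultaneous_eigenvectors_span)
  fix i j x assume "i \<in> {1..rk L}" "j \<in> {1..rk L}"
  then show "brk L (simple_root L i) (brk L (simple_root L j) x)
      = brk L (simple_root L j) (brk L (simple_root L i) x)"
    by (subst brk_jacobi) (simp add: cartan_abelian simple_roots_cartan)
qed (auto simp: brk_linear_right cartan_semisimple simple_roots_cartan)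

lemma subspace_brk_eigen: "Vector_Spaces.linear (scl L) (*) f \<Longrightarrow> subspace {h. brk L h x = scl L (f h) x}"
  by (auto simp: subspace_def brk_simps Vector_Spaces.linear_iff scale_left_distrib)
     (metis scale_zero_left mult_zero_left)

lemma subspace_ipr_0: "subspace {y. ipr L x y = 0}"
  by (auto simp: subspace_def)

text \<open>The form is assumed nondegenerate only on the whole algebra, so h is tested against
  joint eigenvectors y. If some simple root acts on y by c \<noteq> 0, invariance moves that root
  onto h, where the bracket vanishes, and c (h|y) = 0. Otherwise y centralizes the Cartan
  subalgebra, hence lies in it.\<close>

lemma cartan_nondegenerate:
  assumes h: "h \<in> cartan L" and 0: "\<And>k. k \<in> cartan L \<Longrightarrow> ipr L h k = 0"
  shows "h = 0"
proof (rule ipr_nondegenerate)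
  fix y
  have "span {x. \<forall>i\<in>{1..rk L}. \<exists>c. brk L (simple_root L i) x = scl L c x} \<subseteq> {y. ipr L h y = 0}"
  proof (rule span_minimal[OF _ subspace_ipr_0], rule subsetI)
    fix y assume y: "y \<in> {x. \<forall>i\<in>{1..rk L}. \<exists>c. brk L (simple_root L i) x = scl L c x}"
    show "y \<in> {y. ipr L h y = 0}"
    proof (cases "\<forall>i\<in>{1..rk L}. brk L (simple_root L i) y = 0")
      case True
      have "y \<in> cartan L"
      proof (rule cartan_centralizer)
        fix k assume "k \<in> cartan L"
        then show "brk L k y = 0"
          by (induction k rule: cartan_induct) (use True in \<open>auto simp: subspace_def brk_simps\<close>)
      qed
      then show ?thesis using 0 by simp
    next
      case False
      then obtain i where i: "i \<in> {1..rk L}" "brk L (simple_root L i) y \<noteq> 0" by blast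
      with y obtain c where c: "brk L (simple_root L i) y = scl L c y" by blast
      with i have "c \<noteq> 0" by auto
      moreover have "c * ipr L h y = ipr L (brk L h (simple_root L i)) y"
        using c by (simp add: ipr_invariant)
      ultimately show ?thesis
        using cartan_abelian[OF h simple_roots_cartan[OF i(1)]] by simp
    qed
  qed
  then show "ipr L h y = 0" unfolding joint_eigenvectors_span by auto
qed

lemma cartan_eqI:
  assumes "h \<in> cartan L" "h' \<in> cartan L" "\<And>k. k \<in> cartan L \<Longrightarrow> ipr L h k = ipr L h' k"
  shows "h = h'"
  using cartan_nondegenerate[of "h - h'"] assms by auto

lemma simple_root_coeffs_zero:
  assumes "(\<Sum>i\<in>{1..rk L}. scl L (c i) (simple_root L i)) = 0" "i \<in> {1..rk L}"
  shows "c i = 0"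
proof -
  let ?u = "\<lambda>v. c (inv_into {1..rk L} (simple_root L) v)"
  have "(\<Sum>v\<in>simple_root L ` {1..rk L}. scl L (?u v) v) = (\<Sum>i\<in>{1..rk L}. scl L (c i) (simple_root L i))"
    by (subst sum.reindex[OF simple_roots_inj]) (rule sum.cong[OF refl], simp only: o_def inv_into_f_f[OF simple_roots_inj])
  with assms(1) have "?u (simple_root L i) = 0"
    using assms(2) by (intro independentD[OF simple_roots_independent _ order_refl]) auto
  then show ?thesis using assms(2) by (simp only: inv_into_f_f[OF simple_roots_inj])
qed

text \<open>The map T is injective on the Cartan subalgebra by nondegeneracy and maps into the span
  of the simple roots; counting dimensions makes it surjective there. A preimage of the combination
  with coefficients c is the required \<beta>.\<close>

lemma cartan_dual:
  "\<exists>\<beta>\<in>cartan L. \<forall>i\<in>{1..rk L}. ipr L \<beta> (simple_root L i) = c i"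
proof -
  define I where "I = {1..rk L}"
  define S where "S = simple_root L ` I"
  define T where "T h = (\<Sum>i\<in>I. scl L (ipr L h (simple_root L i)) (simple_root L i))" for h
  have lin: "Vector_Spaces.linear (scl L) (scl L) T"
    using vector_space_axioms
    by (auto simp: Vector_Spaces.linear_iff T_def scale_left_distrib sum.distrib scale_sum_right)
  interpret T: Vector_Spaces.linear "scl L" "scl L" T by (rule lin)
  have S: "finite S" "independent S" "span S = cartan L"
    using simple_roots_independent simple_roots_span by (auto simp: S_def I_def)
  have T0: "h = 0" if h: "h \<in> cartan L" "T h = 0" for h
  proof (rule cartan_nondegenerate[OF h(1)])
    fix k assume "k \<in> cartan L"
    then show "ipr L h k = 0"
      by (induction k rule: cartan_induct)
         (use h(2) simple_root_coeffs_zero[of "\<lambda>i. ipr L h (simple_root L i)"] in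
           \<open>auto simp: subspace_ipr_0 T_def I_def\<close>)
  qed
  have inj: "inj_on T (cartan L)"
    using T.inj_on_iff_eq_0[OF subspace_cartan] T0 by blast
  have indT: "independent (T ` S)"
    using T.independent_injective_image[OF S(2)] inj S(3) by simp
  have TS: "T x \<in> span S" for x
    unfolding T_def S_def by (intro span_sum span_scale span_base) auto
  have card: "card (T ` S) = card S"
    using inj S(3) span_superset[of S] by (intro card_image) (auto intro: inj_on_subset)
  have "span S \<subseteq> span (T ` S)"
  proof
    fix a assume a: "a \<in> span S"
    show "a \<in> span (T ` S)"
    \<comment> \<open>The dimension count: a missed vector would extend the image of S to an
      independent set larger than the spanning set S.\<close>
    proof (rule ccontr)
      assume "a \<notin> span (T ` S)"
      then have "independent (insert a (T ` S))" "a \<notin> T ` S"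
        using indT independent_insertI span_base by blast+
      then have "card (insert a (T ` S)) \<le> card S"
        using independent_span_bound[OF S(1), of "insert a (T ` S)"] a TS by auto
      with \<open>a \<notin> T ` S\<close> card S(1) show False by simp
    qed
  qed
  moreover have "(\<Sum>i\<in>I. scl L (c i) (simple_root L i)) \<in> span S"
    unfolding S_def by (intro span_sum span_scale span_base) auto
  ultimately obtain \<beta> where \<beta>: "\<beta> \<in> cartan L" "(\<Sum>i\<in>I. scl L (c i) (simple_root L i)) = T \<beta>"
    using T.span_image[of S] S(3) by auto
  then have "(\<Sum>i\<in>I. scl L (ipr L \<beta> (simple_root L i) - c i) (simple_root L i)) = 0"
    by (simp add: T_def scale_left_diff_distrib sum_subtractf)
  then have "\<forall>i\<in>I. ipr L \<beta> (simple_root L i) - c i = 0"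
    using simple_root_coeffs_zero[of "\<lambda>i. ipr L \<beta> (simple_root L i) - c i"] by (simp add: I_def)
  with \<beta>(1) show ?thesis by (auto simp: I_def)
qed

section \<open>Root spaces and their pairing\<close>

lemma subspace_root_space: "subspace (root_space L \<beta>)"
  by (auto simp: subspace_def root_space_def brk_simps scale_right_distrib mult.commute)

lemma root_space_0: "root_space L 0 = cartan L"
  using cartan_abelian cartan_centralizer by (auto simp: root_space_def)

text \<open>The eigenvalues of a joint eigenvector on the simple roots are prescribed values of a
  functional, which \<open>cartan_dual\<close> realizes by an element \<beta>. The case \<beta> = 0
  contributes the Cartan subalgebra.\<close>

lemma root_decomposition: "span (\<Union>\<beta>\<in>cartan L. root_space L \<beta>) = UNIV"
proof -
  have "{x. \<forall>i\<in>{1..rk L}. \<exists>c. brk L (simple_root L i) x = scl L c x} \<subseteq> (\<Union>\<beta>\<in>cartan L. root_space L \<beta>)"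
  proof
    fix x assume "x \<in> {x. \<forall>i\<in>{1..rk L}. \<exists>c. brk L (simple_root L i) x = scl L c x}"
    then have "\<forall>i\<in>{1..rk L}. \<exists>c. brk L (simple_root L i) x = scl L c x" by blast
    then obtain c where c: "\<forall>i\<in>{1..rk L}. brk L (simple_root L i) x = scl L (c i) x"
      using bchoice[of "{1..rk L}" "\<lambda>i c. brk L (simple_root L i) x = scl L c x"] by blast
    obtain \<beta> where \<beta>: "\<beta> \<in> cartan L" "\<forall>i\<in>{1..rk L}. ipr L \<beta> (simple_root L i) = c i"
      using cartan_dual by blast
    have "brk L h x = scl L (ipr L \<beta> h) x" if "h \<in> cartan L" for h
      using that by (induction h rule: cartan_induct)
        (use c \<beta>(2) in \<open>auto simp: subspace_brk_eigen ipr_linear\<close>)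
    then show "x \<in> (\<Union>\<beta>\<in>cartan L. root_space L \<beta>)"
      using \<beta>(1) by (auto simp: root_space_def)
  qed
  then have "span {x. \<forall>i\<in>{1..rk L}. \<exists>c. brk L (simple_root L i) x = scl L c x}
      \<subseteq> span (\<Union>\<beta>\<in>cartan L. root_space L \<beta>)" by (rule span_mono)
  then show ?thesis unfolding joint_eigenvectors_span by auto
qed

lemma brk_root_space:
  assumes "x \<in> root_space L \<beta>" "y \<in> root_space L \<gamma>"
  shows "brk L x y \<in> root_space L (\<beta> + \<gamma>)"
  using assms by (auto simp: root_space_def brk_jacobi[of _ x y] brk_simps scale_left_distrib)

lemma ipr_root_space:
  assumes "x \<in> root_space L \<beta>" "y \<in> root_space L \<gamma>" "\<beta> \<in> cartan L" "\<gamma> \<in> cartan L" "ipr L x y \<noteq> 0"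
  shows "\<gamma> = - \<beta>"
proof (rule cartan_eqI)
  fix h assume h: "h \<in> cartan L"
  have "ipr L \<beta> h * ipr L x y = ipr L (brk L h x) y"
    using assms(1) h by (simp add: root_space_def)
  also have "\<dots> = - ipr L x (brk L h y)"
    by (subst brk_antisym) (simp add: ipr_invariant)
  also have "\<dots> = - ipr L \<gamma> h * ipr L x y"
    using assms(2) h by (simp add: root_space_def)
  finally show "ipr L \<gamma> h = ipr L (- \<beta>) h"
    using assms(5) by (auto simp: eq_neg_iff_add_eq_0 add.commute simp flip: distrib_right)
qed (use assms in auto)

lemma dual_root_vector:
  assumes "x \<in> root_space L \<beta>" "\<beta> \<in> cartan L" "x \<noteq> 0"
  shows "\<exists>y\<in>root_space L (- \<beta>). ipr L x y \<noteq> 0"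
proof (rule ccontr)
  assume neg: "\<not> ?thesis"
  have "span (\<Union>\<beta>\<in>cartan L. root_space L \<beta>) \<subseteq> {y. ipr L x y = 0}"
    using neg ipr_root_space[OF assms(1) _ assms(2)] subspace_ipr_0
    by (intro span_minimal) blast+
  then show False using assms(3) ipr_nondegenerate by (auto simp: root_decomposition)
qed

text \<open>A nonzero vector of weight \<beta> pairs nontrivially with some member of a finite basis
  J of root vectors, and that member must have weight - \<beta>. So J bounds the number of
  weights.\<close>

lemma finite_weights: "finite {\<beta>\<in>cartan L. root_space L \<beta> \<noteq> {0}}"
proof -
  obtain J where J: "J \<subseteq> (\<Union>\<beta>\<in>cartan L. root_space L \<beta>)" "independent J"
    "(\<Union>\<beta>\<in>cartan L. root_space L \<beta>) \<subseteq> span J"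
    using maximal_independent_subset by blast
  then have span: "span J = UNIV"
    using span_minimal[OF J(3) subspace_span] root_decomposition by auto
  have fin: "finite J" using J(2) by (rule finite_independent)
  have "\<forall>j\<in>J. \<exists>\<beta>. \<beta> \<in> cartan L \<and> j \<in> root_space L \<beta>" using J(1) by blast
  then obtain w where w: "\<forall>j\<in>J. w j \<in> cartan L \<and> j \<in> root_space L (w j)"
    using bchoice[of J "\<lambda>j \<beta>. \<beta> \<in> cartan L \<and> j \<in> root_space L \<beta>"] by blast
  have "{\<beta>\<in>cartan L. root_space L \<beta> \<noteq> {0}} \<subseteq> (\<lambda>j. - w j) ` J"
  proof
    fix \<beta> assume "\<beta> \<in> {\<beta>\<in>cartan L. root_space L \<beta> \<noteq> {0}}"
    then obtain x where x: "\<beta> \<in> cartan L" "x \<in> root_space L \<beta>" "x \<noteq> 0"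
      using subspace_0[OF subspace_root_space] by blast
    have "\<exists>j\<in>J. ipr L x j \<noteq> 0"
    proof (rule ccontr)
      assume "\<not> ?thesis"
      then have "span J \<subseteq> {y. ipr L x y = 0}" using subspace_ipr_0 by (intro span_minimal) blast+
      then show False using x(3) ipr_nondegenerate by (auto simp: span)
    qed
    then obtain j where "j \<in> J" "ipr L x j \<noteq> 0" by blast
    with w ipr_root_space[OF x(2) _ x(1)] have "w j = - \<beta>" by blast
    with \<open>j \<in> J\<close> show "\<beta> \<in> (\<lambda>j. - w j) ` J" by force
  qed
  then show ?thesis using fin finite_surj by blast
qed

lemma finite_roots: "finite (roots L)"
  using finite_weights by (rule finite_subset[rotated]) (auto simp: roots_def)

lemma uminus_roots: "\<beta> \<in> roots L \<Longrightarrow> - \<beta> \<in> roots L"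
proof -
  assume \<beta>: "\<beta> \<in> roots L"
  then obtain x where "x \<in> root_space L \<beta>" "x \<noteq> 0" using rootsD by blast
  then obtain y where "y \<in> root_space L (- \<beta>)" "ipr L x y \<noteq> 0"
    using dual_root_vector rootsD[OF \<beta>] by blast
  then have "root_space L (- \<beta>) \<noteq> {0}" by force
  then show "- \<beta> \<in> roots L"
    unfolding roots_def using rootsD(1,2)[OF \<beta>] cartan_closed(4) by simp
qed

lemma brk_opposite_root_vectors:
  assumes "x \<in> root_space L \<beta>" "y \<in> root_space L (- \<beta>)" "\<beta> \<in> cartan L"
  shows "brk L x y = scl L (ipr L x y) \<beta>"
proof (rule cartan_eqI)
  show "brk L x y \<in> cartan L"
    using brk_root_space[OF assms(1,2)] by (simp add: root_space_0)
  fix h assume h: "h \<in> cartan L"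
  have "ipr L (brk L x y) h = ipr L h (brk L x y)" by (rule ipr_sym)
  also have "\<dots> = ipr L (brk L h x) y" by (simp add: ipr_invariant)
  also have "\<dots> = ipr L (scl L (ipr L x y) \<beta>) h"
    using assms(1) h by (simp add: root_space_def mult.commute)
  finally show "ipr L (brk L x y) h = ipr L (scl L (ipr L x y) \<beta>) h" .
qed (use assms in auto)

section \<open>Root strings through sl(2)\<close>

lemma funpow_root_space:
  assumes "e \<in> root_space L \<alpha>" "x \<in> root_space L \<beta>"
  shows "(brk L e ^^ p) x \<in> root_space L (\<beta> + scl L (of_nat p) \<alpha>)"
proof (induction p)
  case (Suc p)
  show ?case
    using brk_root_space[OF assms(1) Suc] by (simp add: scale_left_distrib add_ac)
qed (use assms in auto)

lemma weight_chain_terminates: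
  assumes "\<alpha> \<in> cartan L" "\<alpha> \<noteq> 0" "\<beta> \<in> cartan L"
    and x: "\<And>p. x p \<in> root_space L (\<beta> + scl L (of_nat p) \<alpha>)"
  shows "\<exists>p. x p = 0"
proof (rule ccontr)
  assume neg: "\<not> ?thesis"
  let ?w = "\<lambda>p::nat. \<beta> + scl L (of_nat p) \<alpha>"
  have "inj ?w" using assms(2) by (auto simp: inj_on_def)
  moreover have "range ?w \<subseteq> {\<beta>\<in>cartan L. root_space L \<beta> \<noteq> {0}}"
    using neg x assms(1,3) by blast
  ultimately show False
    using finite_weights finite_imageD[of ?w UNIV] finite_subset infinite_UNIV_nat by blast
qed

text \<open>The sl(2) relation for a highest weight vector z, with \<alpha> itself in the role of
  the neutral element since (\<alpha>|\<alpha>) = 2. At j = 0 the truncated \<open>j - 1\<close> is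
  harmless, as the factor j vanishes.\<close>

lemma lowering_chain:
  assumes "e \<in> root_space L \<alpha>" "f \<in> root_space L (- \<alpha>)" "brk L e f = \<alpha>"
    "\<alpha> \<in> cartan L" "ipr L \<alpha> \<alpha> = 2" "z \<in> root_space L \<mu>" "brk L e z = 0"
  shows "brk L e ((brk L f ^^ j) z)
    = scl L (of_nat j * (ipr L \<mu> \<alpha> - of_nat j + 1)) ((brk L f ^^ (j - 1)) z)"
proof (induction j)
  case 0
  then show ?case using assms(7) by simp
next
  case (Suc j)
  let ?w = "(brk L f ^^ j) z"
  have "brk L \<alpha> ?w = scl L (ipr L (\<mu> + scl L (of_nat j) (- \<alpha>)) \<alpha>) ?w"
    using funpow_root_space[OF assms(2,6)] assms(4) by (auto simp: root_space_def)
  then have *: "brk L \<alpha> ?w = scl L (ipr L \<mu> \<alpha> - 2 * of_nat j) ?w"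
    using assms(5) by (simp add: mult.commute)
  have **: "brk L f (brk L e ?w) = scl L (of_nat j * (ipr L \<mu> \<alpha> - of_nat j + 1)) ?w"
    by (subst Suc) (cases j; simp add: brk_simps)
  have "brk L e ((brk L f ^^ Suc j) z) = brk L (brk L e f) ?w + brk L f (brk L e ?w)"
    by (simp add: brk_jacobi[of e])
  also have "\<dots> = scl L (ipr L \<mu> \<alpha> - 2 * of_nat j + of_nat j * (ipr L \<mu> \<alpha> - of_nat j + 1)) ?w"
    by (simp only: assms(3) * ** scale_left_distrib)
  also have "ipr L \<mu> \<alpha> - 2 * of_nat j + of_nat j * (ipr L \<mu> \<alpha> - of_nat j + 1)
      = of_nat (Suc j) * (ipr L \<mu> \<alpha> - of_nat (Suc j) + 1)"
    by (simp add: algebra_simps)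
  finally show ?case by simp
qed

text \<open>Raise a vector of weight \<beta> p times until it is killed next, then lower the result
  z until it dies after q steps. \<open>lowering_chain\<close> at q + 1 forces (\<mu>|\<alpha>) = q
  for the top weight \<mu> = \<beta> + p \<alpha>, and the vectors met on the way down are
  nonzero.\<close>

lemma weight_string:
  assumes \<alpha>: "\<alpha> \<in> roots L" and \<beta>: "\<beta> \<in> cartan L" "root_space L \<beta> \<noteq> {0}"
  obtains p q :: nat where "ipr L \<beta> \<alpha> = of_nat q - 2 * of_nat p"
    "\<And>j. j \<le> q \<Longrightarrow> root_space L (\<beta> + scl L (of_nat p - of_nat j) \<alpha>) \<noteq> {0}"
proof -
  note \<alpha>' = rootsD[OF \<alpha>]
  obtain e where e: "e \<in> root_space L \<alpha>" "e \<noteq> 0" using \<alpha>' by blast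
  obtain y where y: "y \<in> root_space L (- \<alpha>)" "ipr L e y \<noteq> 0"
    using dual_root_vector[OF e(1) \<alpha>'(1) e(2)] by blast
  define f where "f = scl L (1 / ipr L e y) y"
  have f: "f \<in> root_space L (- \<alpha>)"
    unfolding f_def by (rule subspace_scale[OF subspace_root_space y(1)])
  have ef: "brk L e f = \<alpha>"
    using brk_opposite_root_vectors[OF e(1) f \<alpha>'(1)] y(2) by (simp add: f_def)
  obtain x where x: "x \<in> root_space L \<beta>" "x \<noteq> 0"
    using \<beta>(2) subspace_0[OF subspace_root_space] by blast
  \<comment> \<open>The shift by \<open>Suc\<close> makes p the last exponent with a nonzero value;
    exponent 0 gives x, which is nonzero.\<close>
  define p where "p = (LEAST p. (brk L e ^^ Suc p) x = 0)"
  have "\<exists>p. (brk L e ^^ p) x = 0"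
    by (rule weight_chain_terminates[OF \<alpha>'(1,2) \<beta>(1) funpow_root_space[OF e(1) x(1)]])
  then obtain p0 where p0: "(brk L e ^^ p0) x = 0" by blast
  then have "(brk L e ^^ Suc p0) x = 0" by simp
  then have p: "(brk L e ^^ Suc p) x = 0" unfolding p_def by (rule LeastI)
  define z where "z = (brk L e ^^ p) x"
  have z: "z \<noteq> 0" "brk L e z = 0"
  proof -
    show "brk L e z = 0" using p by (simp add: z_def)
    show "z \<noteq> 0"
    proof (cases p)
      case 0
      then show ?thesis using x by (simp add: z_def)
    next
      case (Suc p')
      then show ?thesis using not_less_Least[of p' "\<lambda>p. (brk L e ^^ Suc p) x = 0"] p_def
        by (auto simp: z_def)
    qed
  qed
  define \<mu> where "\<mu> = \<beta> + scl L (of_nat p) \<alpha>"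
  have z\<mu>: "z \<in> root_space L \<mu>" unfolding z_def \<mu>_def by (rule funpow_root_space[OF e(1) x(1)])
  have \<mu>: "\<mu> \<in> cartan L" using \<beta> \<alpha>' by (auto simp: \<mu>_def)
  define q where "q = (LEAST q. (brk L f ^^ Suc q) z = 0)"
  have "\<exists>q. (brk L f ^^ q) z = 0"
    using \<alpha>' by (intro weight_chain_terminates[OF _ _ \<mu> funpow_root_space[OF f z\<mu>]]) auto
  then obtain q0 where q0: "(brk L f ^^ q0) z = 0" by blast
  then have "(brk L f ^^ Suc q0) z = 0" by simp
  then have q: "(brk L f ^^ Suc q) z = 0" unfolding q_def by (rule LeastI)
  have nz: "(brk L f ^^ j) z \<noteq> 0" if "j \<le> q" for j
  proof (cases j)
    case 0
    then show ?thesis using z by simp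
  next
    case (Suc j')
    then show ?thesis using not_less_Least[of j' "\<lambda>q. (brk L f ^^ Suc q) z = 0"] q_def that by auto
  qed
  have "scl L (of_nat (Suc q) * (ipr L \<mu> \<alpha> - of_nat (Suc q) + 1)) ((brk L f ^^ (Suc q - 1)) z) = 0"
    using lowering_chain[OF e(1) f ef \<alpha>'(1) root_norm[OF \<alpha>] z\<mu> z(2), of "Suc q"] q by simp
  then have "ipr L \<mu> \<alpha> = of_nat q" using nz[of q] by (auto simp del: of_nat_Suc) (simp add: of_nat_Suc)
  then have 1: "ipr L \<beta> \<alpha> = of_nat q - 2 * of_nat p"
    using root_norm[OF \<alpha>] by (simp add: \<mu>_def eq_diff_eq mult.commute)
  show ?thesis
  proof (rule that[OF 1])
    fix j assume "j \<le> q"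
    have "\<mu> + scl L (of_nat j) (- \<alpha>) = \<beta> + scl L (of_nat p - of_nat j) \<alpha>"
      by (simp add: \<mu>_def scale_left_diff_distrib)
    then show "root_space L (\<beta> + scl L (of_nat p - of_nat j) \<alpha>) \<noteq> {0}"
      using funpow_root_space[OF f z\<mu>, of j] nz[OF \<open>j \<le> q\<close>] by auto
  qed
qed

lemma ipr_roots_int:
  assumes "\<alpha> \<in> roots L" "\<beta> \<in> roots L"
  shows "ipr L \<beta> \<alpha> \<in> \<int>"
proof -
  obtain p q :: nat where "ipr L \<beta> \<alpha> = of_nat q - 2 * of_nat p"
    by (rule weight_string[OF assms(1) rootsD(1)[OF assms(2)]]) (use assms in \<open>auto simp: roots_def\<close>)
  then show ?thesis by simp
qed

text \<open>On the string with top \<beta> + p \<alpha>, the reflected weight is reached after q - p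
  steps, because p - (q - p) = - (\<beta>|\<alpha>). This needs p \<le> q, that is
  (\<beta>|\<alpha>) \<ge> 0; otherwise - \<alpha> is used, which gives the same reflection.\<close>

lemma reflection_roots:
  assumes \<alpha>: "\<alpha> \<in> roots L" and \<beta>: "\<beta> \<in> roots L"
  shows "\<beta> - scl L (ipr L \<beta> \<alpha>) \<alpha> \<in> roots L"
proof -
  have *: "root_space L (\<beta> - scl L (ipr L \<beta> \<alpha>) \<alpha>) \<noteq> {0}"
    if \<alpha>: "\<alpha> \<in> roots L" and n: "ipr L \<beta> \<alpha> = of_int n" "n \<ge> 0" for \<alpha> n
  proof -
    obtain p q :: nat where pq: "ipr L \<beta> \<alpha> = of_nat q - 2 * of_nat p"
      "\<And>j. j \<le> q \<Longrightarrow> root_space L (\<beta> + scl L (of_nat p - of_nat j) \<alpha>) \<noteq> {0}"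
      by (rule weight_string[OF \<alpha> rootsD(1)[OF \<beta>]]) (use \<beta> in \<open>auto simp: roots_def\<close>)
    have "of_int n = (of_int (int q - 2 * int p) :: complex)" using pq(1) n(1) by simp
    then have "n = int q - 2 * int p" by (simp only: of_int_eq_iff)
    with n(2) have "p \<le> q" by simp
    have "of_nat p - of_nat (q - p) = - ipr L \<beta> \<alpha>" using \<open>p \<le> q\<close> pq(1) by simp
    then show ?thesis using pq(2)[of "q - p"] by simp
  qed
  obtain n where n: "ipr L \<beta> \<alpha> = of_int n" using ipr_roots_int[OF assms] by (auto elim: Ints_cases)
  have "root_space L (\<beta> - scl L (ipr L \<beta> \<alpha>) \<alpha>) \<noteq> {0}"
  proof (cases "n \<ge> 0")
    case True
    then show ?thesis using *[OF \<alpha> n] by simp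
  next
    case False
    then show ?thesis using *[OF uminus_roots[OF \<alpha>], of "- n"] n by simp
  qed
  moreover have "\<beta> - scl L (ipr L \<beta> \<alpha>) \<alpha> \<noteq> 0"
  proof
    assume "\<beta> - scl L (ipr L \<beta> \<alpha>) \<alpha> = 0"
    then have "ipr L (\<beta> - scl L (ipr L \<beta> \<alpha>) \<alpha>) (\<beta> - scl L (ipr L \<beta> \<alpha>) \<alpha>) = 0" by simp
    then show False using root_norm \<alpha> \<beta> by (simp add: algebra_simps ipr_sym[of \<alpha> \<beta>])
  qed
  ultimately show ?thesis
    using rootsD(1)[OF \<alpha>] rootsD(1)[OF \<beta>] unfolding roots_def
    by (auto intro: subspace_diff[OF subspace_cartan] subspace_scale[OF subspace_cartan])
qed

section \<open>The root lattice and heights\<close>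

lemma root_latticeI: "(\<Sum>i\<in>{1..rk L}. scl L (of_int (m i)) (simple_root L i)) \<in> root_lattice L"
  unfolding root_lattice_def by (intro CollectI exI[of _ m] conjI refl TrueI)

lemma root_lattice_0: "0 \<in> root_lattice L"
  unfolding root_lattice_def by (auto intro!: exI[of _ "\<lambda>_. 0"])

lemma root_lattice_add: "x \<in> root_lattice L \<Longrightarrow> y \<in> root_lattice L \<Longrightarrow> x + y \<in> root_lattice L"
proof -
  assume "x \<in> root_lattice L" "y \<in> root_lattice L"
  then obtain m n where "x = (\<Sum>i\<in>{1..rk L}. scl L (of_int (m i)) (simple_root L i))"
    "y = (\<Sum>i\<in>{1..rk L}. scl L (of_int (n i)) (simple_root L i))"
    unfolding root_lattice_def by blast
  then have "x + y = (\<Sum>i\<in>{1..rk L}. scl L (of_int (m i + n i)) (simple_root L i))"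
    by (simp add: scale_left_distrib sum.distrib)
  then show ?thesis by (simp only: root_latticeI)
qed

lemma root_lattice_scl: "x \<in> root_lattice L \<Longrightarrow> scl L (of_int k) x \<in> root_lattice L"
proof -
  assume "x \<in> root_lattice L"
  then obtain m where "x = (\<Sum>i\<in>{1..rk L}. scl L (of_int (m i)) (simple_root L i))"
    unfolding root_lattice_def by blast
  then have "scl L (of_int k) x = (\<Sum>i\<in>{1..rk L}. scl L (of_int (k * m i)) (simple_root L i))"
    by (simp add: scale_sum_right)
  then show ?thesis by (simp only: root_latticeI)
qed

lemma root_lattice_diff: "x \<in> root_lattice L \<Longrightarrow> y \<in> root_lattice L \<Longrightarrow> x - y \<in> root_lattice L"
  using root_lattice_add[of x "scl L (of_int (-1)) y"] root_lattice_scl[of y "-1"] by simp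

lemma root_lattice_minus: "x \<in> root_lattice L \<Longrightarrow> - x \<in> root_lattice L"
  using root_lattice_scl[of x "-1"] by simp

lemma nonneg_combinations_root_lattice: "x \<in> nonneg_combinations L \<Longrightarrow> x \<in> root_lattice L"
proof -
  assume "x \<in> nonneg_combinations L"
  then obtain n :: "nat \<Rightarrow> nat" where "x = (\<Sum>i\<in>{1..rk L}. scl L (of_nat (n i)) (simple_root L i))"
    unfolding nonneg_combinations_def by blast
  then have "x = (\<Sum>i\<in>{1..rk L}. scl L (of_int (int (n i))) (simple_root L i))" by simp
  then show ?thesis by (simp only: root_latticeI)
qed

lemma roots_in_lattice: "\<beta> \<in> roots L \<Longrightarrow> \<beta> \<in> root_lattice L"
  using root_sign[of \<beta>] nonneg_combinations_root_lattice root_lattice_minus[of "- \<beta>"] by fastforce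

lemma ipr_root_lattice_int:
  assumes "\<alpha> \<in> roots L" "\<gamma> \<in> root_lattice L"
  shows "ipr L \<alpha> \<gamma> \<in> \<int>"
proof -
  obtain m where m: "\<gamma> = (\<Sum>i\<in>{1..rk L}. scl L (of_int (m i)) (simple_root L i))"
    using assms(2) unfolding root_lattice_def by blast
  show ?thesis unfolding m ipr_sum
    using assms(1) by (intro Ints_sum) (auto intro!: Ints_mult ipr_roots_int simple_roots_in_roots)
qed

lemma root_lattice_reflection:
  assumes "\<alpha> \<in> roots L" "\<gamma> \<in> root_lattice L"
  shows "\<gamma> - scl L (ipr L \<gamma> \<alpha>) \<alpha> \<in> root_lattice L"
proof -
  obtain n where "ipr L \<gamma> \<alpha> = of_int n"
    using ipr_root_lattice_int[OF assms] by (auto elim: Ints_cases simp: ipr_sym)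
  then show ?thesis
    using root_lattice_diff[OF assms(2) root_lattice_scl[OF roots_in_lattice[OF assms(1)], of n]] by simp
qed

lemma exists_height_vector:
  obtains \<rho>' where "\<rho>' \<in> cartan L" "\<And>\<beta>. \<beta> \<in> pos_roots L \<Longrightarrow> \<exists>n::nat. n > 0 \<and> ipr L \<rho>' \<beta> = of_nat n"
proof -
  \<comment> \<open>Prescribing the pairing 1 with every simple root makes (\<rho>'|\<beta>) the
    height of \<beta> by construction.\<close>
  obtain \<rho>' where \<rho>: "\<rho>' \<in> cartan L" "\<forall>i\<in>{1..rk L}. ipr L \<rho>' (simple_root L i) = 1"
    using cartan_dual[of "\<lambda>_. 1"] by blast
  show ?thesis
  proof (rule that[OF \<rho>(1)])
    fix \<beta> assume \<beta>: "\<beta> \<in> pos_roots L"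
    then obtain n :: "nat \<Rightarrow> nat" where n: "\<beta> = (\<Sum>i\<in>{1..rk L}. scl L (of_nat (n i)) (simple_root L i))"
      unfolding pos_roots_def nonneg_combinations_def by blast
    have "ipr L \<rho>' \<beta> = (\<Sum>i\<in>{1..rk L}. of_nat (n i))"
      unfolding n ipr_sum by (rule sum.cong[OF refl]) (use \<rho>(2) in simp)
    then have 1: "ipr L \<rho>' \<beta> = of_nat (\<Sum>i\<in>{1..rk L}. n i)" by simp
    have "(\<Sum>i\<in>{1..rk L}. n i) \<noteq> 0"
    proof
      assume "(\<Sum>i\<in>{1..rk L}. n i) = 0"
      then have "\<forall>i\<in>{1..rk L}. n i = 0" by (subst (asm) sum_eq_0_iff) auto
      then have "\<beta> = 0" unfolding n by (intro sum.neutral) auto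
      with \<beta> show False using rootsD by (auto simp: pos_roots_def)
    qed
    with 1 show "\<exists>n::nat. n > 0 \<and> ipr L \<rho>' \<beta> = of_nat n" by blast
  qed
qed

lemma pos_roots_cases: "\<beta> \<in> roots L \<Longrightarrow> \<beta> \<in> pos_roots L \<or> - \<beta> \<in> pos_roots L"
  using root_sign uminus_roots by (auto simp: pos_roots_def)

end

section \<open>The affine Lie algebra\<close>

definition fin_part :: "('g::ab_group_add) affine \<Rightarrow> 'g" where
  "fin_part x = Poly_Mapping.lookup (fst x) 0"

text \<open>With h in the Cartan subalgebra these are the elements of \<open>aff_cartan\<close>.
  Read as a weight, a is the coefficient of \<delta> and b that of \<Lambda>0, so
  \<open>snd (snd _)\<close> is the level throughout.\<close>

abbreviation aff_elem :: "('g::ab_group_add) \<Rightarrow> complex \<Rightarrow> complex \<Rightarrow> 'g affine" where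
  "aff_elem h a b \<equiv> (Poly_Mapping.single 0 h, a, b)"

lemma fin_part_simps [simp]:
  "fin_part (x + y) = fin_part x + fin_part y" "fin_part (x - y) = fin_part x - fin_part y"
  "fin_part (aff_elem h a b) = h" "fin_part (emb h) = h" "fin_part central_K = 0" "fin_part deriv_d = 0"
  by (auto simp: fin_part_def lookup_add lookup_minus loop_def central_K_def deriv_d_def)

lemma affine_eqI:
  fixes x y :: "('g::ab_group_add) affine"
  assumes "\<And>m. Poly_Mapping.lookup (fst x) m = Poly_Mapping.lookup (fst y) m" "snd x = snd y"
  shows "x = y"
  using assms by (auto intro!: prod_eqI poly_mapping_eqI)

lemma loop_add: "loop (x + y) m = loop x m + loop y m"
  by (simp add: loop_def single_add)

lemma loop_0 [simp]: "loop 0 m = 0"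
  by (simp add: loop_def zero_prod_def)

context simply_laced_lie_algebra
begin

lemma lookup_aff_scl [simp]:
  "Poly_Mapping.lookup (fst (aff_scl L c x)) m = scl L c (Poly_Mapping.lookup (fst x) m)"
  by (cases x) (simp add: Poly_Mapping.map.rep_eq when_def)

lemma snd_aff_scl [simp]: "snd (aff_scl L c x) = (c * fst (snd x), c * snd (snd x))"
  by (cases x) simp

sublocale aff: vector_space "aff_scl L"
  by unfold_locales
    (auto intro!: affine_eqI simp: lookup_add scale_right_distrib scale_left_distrib algebra_simps
      simp del: aff_scl.simps)

lemma fin_part_scl [simp]: "fin_part (aff_scl L c x) = scl L c (fin_part x)"
  by (simp add: fin_part_def)

lemma aff_scl_loop: "aff_scl L c (loop x m) = loop (scl L c x) m"
  by (rule affine_eqI) (auto simp: loop_def lookup_single when_def simp del: aff_scl.simps)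

lemma aff_scl_emb: "aff_scl L c (emb x) = emb (scl L c x)"
  by (rule aff_scl_loop)

text \<open>For h = 0 the key set is empty and the sum is 0; the hypothesis on f covers this
  case.\<close>

lemma sum_keys_single_0:
  "(\<And>m. f m 0 = 0) \<Longrightarrow> (\<Sum>m\<in>Poly_Mapping.keys (Poly_Mapping.single 0 h). f m (Poly_Mapping.lookup (Poly_Mapping.single 0 h) m))
    = (f 0 h :: 'c::comm_monoid_add)"
  by (cases "h = 0") auto

lemma aff_ipr_cartan_left:
  "aff_ipr L (aff_elem h a b) x = ipr L h (fin_part x) + a * snd (snd x) + b * fst (snd x)"
  by (cases x) (simp add: fin_part_def sum_keys_single_0[of "\<lambda>m y. ipr L y (Poly_Mapping.lookup _ (- m))"])

lemma aff_ipr_cartan_right: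
  "aff_ipr L x (aff_elem h a b) = ipr L (fin_part x) h + fst (snd x) * b + snd (snd x) * a"
proof -
  obtain xs a' b' where x: "x = (xs, a', b')" by (cases x)
  have "(\<Sum>m\<in>Poly_Mapping.keys xs. ipr L (Poly_Mapping.lookup xs m) (Poly_Mapping.lookup (Poly_Mapping.single 0 h) (- m)))
      = (\<Sum>m\<in>Poly_Mapping.keys xs. if m = 0 then ipr L (Poly_Mapping.lookup xs 0) h else 0)"
    by (rule sum.cong) (auto simp: lookup_single)
  also have "\<dots> = ipr L (Poly_Mapping.lookup xs 0) h"
    by (auto simp: sum.delta in_keys_iff)
  finally show ?thesis by (simp add: x fin_part_def)
qed

lemma emb_eq: "emb h = aff_elem h 0 0" and central_K_eq: "central_K = aff_elem 0 1 0"
  and deriv_d_eq: "deriv_d = aff_elem 0 0 1"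
  by (simp_all add: loop_def central_K_def deriv_d_def)

lemma aff_ipr_emb: "aff_ipr L x (emb h) = ipr L (fin_part x) h"
  and aff_ipr_K: "aff_ipr L x central_K = snd (snd x)"
  using aff_ipr_cartan_right[of x 0 1 0] by (simp_all add: emb_eq central_K_def aff_ipr_cartan_right)

lemma aff_scl_elem: "aff_scl L c (aff_elem h a b) = aff_elem (scl L c h) (c * a) (c * b)"
  by (rule affine_eqI) (auto simp: lookup_single when_def)

lemma aff_elem_add: "aff_elem h a b + aff_elem h' a' b' = aff_elem (h + h') (a + a') (b + b')"
  by (simp add: single_add)

lemma aff_elem_diff: "aff_elem h a b - aff_elem h' a' b' = aff_elem (h - h') (a - a') (b - b')"
  by (simp add: single_diff)

lemma aff_elem_eq_iff: "aff_elem h a b = aff_elem h' a' b' \<longleftrightarrow> h = h' \<and> a = a' \<and> b = b'"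
  by (auto dest: arg_cong[where f = "\<lambda>p. Poly_Mapping.lookup p 0"])

lemma aff_cartan_iff: "x \<in> aff_cartan L \<longleftrightarrow> (\<exists>h a b. h \<in> cartan L \<and> x = aff_elem h a b)"
proof -
  have "emb h + aff_scl L a central_K + aff_scl L b deriv_d = aff_elem h a b" for h a b
    by (simp only: emb_eq central_K_eq deriv_d_eq aff_scl_elem aff_elem_add) simp
  then show ?thesis unfolding aff_cartan_def by auto
qed

lemma subspace_aff_cartan: "aff.subspace (aff_cartan L)"
proof (rule aff.subspaceI)
  have "0 = aff_elem (0 :: 'g) 0 0" by (simp add: zero_prod_def)
  then show "0 \<in> aff_cartan L" using cartan_closed(1) unfolding aff_cartan_iff by blast
  show "x + y \<in> aff_cartan L" if "x \<in> aff_cartan L" "y \<in> aff_cartan L" for x y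
    using that aff_elem_add cartan_closed(2) unfolding aff_cartan_iff by metis
  show "aff_scl L c x \<in> aff_cartan L" if "x \<in> aff_cartan L" for c x
    using that aff_scl_elem cartan_closed(3) unfolding aff_cartan_iff by metis
qed

lemma loop_linear: "Vector_Spaces.linear (scl L) (aff_scl L) (\<lambda>x. loop x m)"
  using vector_space_axioms aff.vector_space_axioms
  by (auto simp: Vector_Spaces.linear_iff loop_add aff_scl_loop)

lemma aff_cartan_finitely_spanned: "\<exists>S. finite S \<and> aff_cartan L \<subseteq> aff.span S"
proof -
  interpret emb: Vector_Spaces.linear "scl L" "aff_scl L" emb by (rule loop_linear)
  let ?S = "emb ` simple_root L ` {1..rk L} \<union> {central_K, deriv_d}"
  have "aff_cartan L \<subseteq> aff.span ?S"
  proof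
    fix x assume "x \<in> aff_cartan L"
    then obtain h a b where h: "h \<in> cartan L" and x: "x = emb h + aff_scl L a central_K + aff_scl L b deriv_d"
      unfolding aff_cartan_def by blast
    have "emb h \<in> aff.span (emb ` simple_root L ` {1..rk L})"
      using emb.span_image[of "simple_root L ` {1..rk L}"] h simple_roots_span by blast
    then have "emb h \<in> aff.span ?S" by (rule subsetD[OF aff.span_mono, rotated]) blast
    then show "x \<in> aff.span ?S"
      unfolding x by (intro aff.span_add aff.span_scale) (auto intro: aff.span_base)
  qed
  then show ?thesis by (intro exI[of _ ?S]) auto
qed

lemma weyl_sign_reflection:
  assumes "\<alpha> \<in> roots L"
  shows "weyl_sign L (reflection L \<alpha>) = - 1"
proof -
  obtain S where S: "finite S" "aff_cartan L \<subseteq> aff.span S" using aff_cartan_finitely_spanned by blast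
  have "emb \<alpha> \<in> aff_cartan L"
    unfolding aff_cartan_iff emb_eq using rootsD(1)[OF assms] by blast
  moreover have "Vector_Spaces.linear (aff_scl L) (*) (\<lambda>x. aff_ipr L x (emb \<alpha>))"
    unfolding Vector_Spaces.linear_iff aff_ipr_emb using aff.vector_space_axioms ipr_linear[of 0]
    by (simp add: Vector_Spaces.linear_iff)
  ultimately have "weyl_sign L (reflection L \<alpha>) = 1 - aff_ipr L (emb \<alpha>) (emb \<alpha>)"
    unfolding weyl_sign_def
    by (rule det_on_reflection[OF aff.vector_space_axioms S subspace_aff_cartan]) (rule reflection_def)
  then show ?thesis using root_norm[OF assms] by (simp add: aff_ipr_emb)
qed

section \<open>Affine roots, their root spaces and their heights\<close>

lemma lookup_aff_brk_cartan:
  "Poly_Mapping.lookup (fst (aff_brk L (aff_elem h a b) x)) k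
    = brk L h (Poly_Mapping.lookup (fst x) k) + scl L (b * of_int k) (Poly_Mapping.lookup (fst x) k)"
proof -
  obtain xs a' b' where x: "x = (xs, a', b')" by (cases x)
  let ?l = "Poly_Mapping.lookup" and ?s = "Poly_Mapping.single"
  have s: "?l (\<Sum>r\<in>Poly_Mapping.keys xs. ?s r (f r (?l xs r))) k = f k (?l xs k)"
    if "\<And>r. f r 0 = (0::'g)" for f :: "int \<Rightarrow> 'g \<Rightarrow> 'g"
  proof -
    have "?l (\<Sum>r\<in>Poly_Mapping.keys xs. ?s r (f r (?l xs r))) k
      = (\<Sum>r\<in>Poly_Mapping.keys xs. if r = k then f k (?l xs k) else 0)"
      unfolding lookup_sum by (rule sum.cong) (auto simp: lookup_single when_def)
    also have "\<dots> = f k (?l xs k)" using that by (auto simp: in_keys_iff)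
    finally show ?thesis .
  qed
  have "(\<Sum>m\<in>Poly_Mapping.keys (?s 0 h). \<Sum>r\<in>Poly_Mapping.keys xs. ?s (m + r) (brk L (?l (?s 0 h) m) (?l xs r)))
      = (\<Sum>r\<in>Poly_Mapping.keys xs. ?s r (brk L h (?l xs r)))"
    by (subst sum_keys_single_0[of "\<lambda>m y. \<Sum>r\<in>Poly_Mapping.keys xs. ?s (m + r) (brk L y (?l xs r))"]) simp_all
  moreover have "(\<Sum>m\<in>Poly_Mapping.keys (?s 0 h). ?s m (scl L (b' * of_int m) (?l (?s 0 h) m))) = 0"
    by (subst sum_keys_single_0[of "\<lambda>m y. ?s m (scl L (b' * of_int m) y)"]) simp_all
  ultimately show ?thesis
    using s[of "\<lambda>_. brk L h"] s[of "\<lambda>r. scl L (b * of_int r)"]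
    by (simp add: x lookup_add lookup_minus)
qed

lemma snd_aff_brk_cartan: "snd (aff_brk L (aff_elem h a b) x) = (0, 0)"
  by (cases x) (simp add: sum_keys_single_0[of "\<lambda>m y. of_int m * ipr L y (Poly_Mapping.lookup _ (- m))"])

text \<open>The three kinds of Cartan elements are tested separately: K acts by 0, which forces b =
  0; d reads off the degree, which must be a; the finite part puts the coefficient into a finite
  root space. Brackets with Cartan elements have no K or d component, so a nonzero weight leaves
  none in x.\<close>

lemma aff_root_space_iff:
  assumes h0: "h0 \<in> cartan L" and nz: "aff_elem h0 a b \<noteq> 0"
  shows "x \<in> aff_root_space L (aff_elem h0 a b) \<longleftrightarrow> snd x = (0, 0) \<and>
    (\<forall>k. Poly_Mapping.lookup (fst x) k \<noteq> 0 \<longrightarrow>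
      b = 0 \<and> a = of_int k \<and> Poly_Mapping.lookup (fst x) k \<in> root_space L h0)"
    (is "?lhs \<longleftrightarrow> ?rhs")
proof
  let ?x = "Poly_Mapping.lookup (fst x)"
  assume x: ?lhs
  have eq: "aff_brk L (aff_elem h a' b') x = aff_scl L (ipr L h0 h + a * b' + b * a') x"
    if "h \<in> cartan L" for h a' b'
  proof -
    have "aff_elem h a' b' \<in> aff_cartan L" using that unfolding aff_cartan_iff by blast
    then show ?thesis using x unfolding aff_root_space_def by (simp add: aff_ipr_cartan_left)
  qed
  have eq1: "brk L h (?x k) + scl L (b' * of_int k) (?x k) = scl L (ipr L h0 h + a * b' + b * a') (?x k)"
    if "h \<in> cartan L" for h a' b' k
    using arg_cong[OF eq[OF that], of "\<lambda>y. Poly_Mapping.lookup (fst y) k"]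
    by (simp add: lookup_aff_brk_cartan)
  have eq2: "(ipr L h0 h + a * b' + b * a') * fst (snd x) = 0 \<and> (ipr L h0 h + a * b' + b * a') * snd (snd x) = 0"
    if "h \<in> cartan L" for h a' b'
    using arg_cong[OF eq[OF that], of snd] unfolding snd_aff_brk_cartan by simp
  have "\<exists>h\<in>cartan L. \<exists>a' b'. ipr L h0 h + a * b' + b * a' \<noteq> 0"
  proof (rule ccontr)
    assume "\<not> ?thesis"
    then have *: "ipr L h0 h + a * b' + b * a' = 0" if "h \<in> cartan L" for h a' b' using that by blast
    have "h0 = 0" using *[of _ 0 0] by (intro cartan_nondegenerate[OF h0]) simp
    moreover have "a = 0" "b = 0" using *[OF cartan_closed(1), of 0 1] *[OF cartan_closed(1), of 1 0] by simp_all
    ultimately show False using nz by (simp add: zero_prod_def)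
  qed
  then have "snd x = (0, 0)" using eq2 by (metis mult_eq_0_iff prod.collapse)
  moreover have "b = 0 \<and> a = of_int k \<and> ?x k \<in> root_space L h0" if k: "?x k \<noteq> 0" for k
  proof -
    have "b = 0" using eq1[OF cartan_closed(1), where k = k and a' = 1 and b' = 0] k by simp
    moreover have "scl L (of_int k) (?x k) = scl L a (?x k)" using eq1[OF cartan_closed(1), where k = k and a' = 0 and b' = 1] by simp
    then have "a = of_int k" using k by simp
    moreover have "?x k \<in> root_space L h0" using eq1[where k = k and a' = 0 and b' = 0] by (simp add: root_space_def)
    ultimately show ?thesis by blast
  qed
  ultimately show ?rhs by blast
next
  assume x: ?rhs
  have "aff_brk L h x = aff_scl L (aff_ipr L (aff_elem h0 a b) h) x" if "h \<in> aff_cartan L" for h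
  proof -
    obtain h' a' b' where h: "h = aff_elem h' a' b'" "h' \<in> cartan L" using \<open>h \<in> aff_cartan L\<close> aff_cartan_iff by blast
    show ?thesis
    proof (rule affine_eqI)
      show "snd (aff_brk L h x) = snd (aff_scl L (aff_ipr L (aff_elem h0 a b) h) x)"
        unfolding h snd_aff_brk_cartan using x by simp
      fix k
      show "Poly_Mapping.lookup (fst (aff_brk L h x)) k
        = Poly_Mapping.lookup (fst (aff_scl L (aff_ipr L (aff_elem h0 a b) h) x)) k"
      proof (cases "Poly_Mapping.lookup (fst x) k = 0")
        case False
        then have "b = 0" "a = of_int k" "Poly_Mapping.lookup (fst x) k \<in> root_space L h0" using x by blast+
        then show ?thesis
          unfolding h lookup_aff_brk_cartan lookup_aff_scl
          by (simp add: aff_ipr_cartan_left root_space_def h(2) scale_left_distrib mult.commute)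
      qed (simp add: h lookup_aff_brk_cartan)
    qed
  qed
  then show ?lhs unfolding aff_root_space_def by blast
qed

lemma subspace_n_plus: "subspace (n_plus L)"
  unfolding n_plus_def by (rule subspace_span)

lemma aff_n_plus_iff:
  "x \<in> aff_n_plus L \<longleftrightarrow> snd x = (0, 0) \<and> fin_part x \<in> n_plus L \<and> (\<forall>m<0. Poly_Mapping.lookup (fst x) m = 0)"
  by (cases x) (auto simp: aff_n_plus_def fin_part_def)

lemma subspace_aff_n_plus: "aff.subspace (aff_n_plus L)"
  using subspace_n_plus by (auto simp: aff.subspace_def subspace_def aff_n_plus_iff lookup_add fin_part_def zero_prod_def)

lemma subspace_aff_borel: "aff.subspace (aff_borel L)"
  unfolding aff_borel_def by (rule aff.subspace_sums[OF subspace_aff_cartan subspace_aff_n_plus])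

lemma aff_n_plus_borel: "x \<in> aff_n_plus L \<Longrightarrow> x \<in> aff_borel L"
  unfolding aff_borel_def
  by (intro CollectI exI[of _ 0] exI[of _ x]) (simp add: aff.subspace_0[OF subspace_aff_cartan])

lemma aff_cartan_borel: "x \<in> aff_cartan L \<Longrightarrow> x \<in> aff_borel L"
  unfolding aff_borel_def
  by (intro CollectI exI[of _ x] exI[of _ 0]) (simp add: aff.subspace_0[OF subspace_aff_n_plus])

text \<open>The element is \<beta> + n \<delta>, whose root space lives in degree n only. This turns
  condition (iii) into a statement about pairs of a finite root and an integer.\<close>

lemma real_root_in_aff_pos_roots:
  assumes \<beta>: "\<beta> \<in> roots L" and n: "n > 0 \<or> n = 0 \<and> \<beta> \<in> pos_roots L"
  shows "aff_elem \<beta> (of_int n) 0 \<in> aff_pos_roots L"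
proof -
  let ?b = "aff_elem \<beta> (of_int n) 0"
  note \<beta>' = rootsD[OF \<beta>]
  have nz: "?b \<noteq> 0" using \<beta>'(2) aff_elem_eq_iff[of \<beta> "of_int n" 0 0 0 0] by (simp add: zero_prod_def)
  note iff = aff_root_space_iff[OF \<beta>'(1) nz]
  obtain z where z: "z \<in> root_space L \<beta>" "z \<noteq> 0" using \<beta>' by blast
  have "loop z n \<in> aff_root_space L ?b"
    unfolding iff using z by (auto simp: loop_def lookup_single when_def)
  moreover have "loop z n \<noteq> 0"
    using z(2) by (auto simp: loop_def zero_prod_def dest: arg_cong[where f = "\<lambda>p. Poly_Mapping.lookup p n"])
  ultimately have "aff_root_space L ?b \<noteq> {0}" by blast
  moreover have "aff_root_space L ?b \<subseteq> aff_borel L"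
  proof
    fix x assume "x \<in> aff_root_space L ?b"
    then have x: "snd x = (0, 0)" "\<And>k. Poly_Mapping.lookup (fst x) k \<noteq> 0 \<Longrightarrow> n = k \<and> Poly_Mapping.lookup (fst x) k \<in> root_space L \<beta>"
      unfolding iff by auto
    have "fin_part x \<in> n_plus L"
    proof (cases "fin_part x = 0")
      case True
      then show ?thesis using subspace_0[OF subspace_n_plus] by simp
    next
      case False
      then have "n = 0 \<and> fin_part x \<in> root_space L \<beta>" using x(2)[of 0] by (simp add: fin_part_def)
      then show ?thesis using n unfolding n_plus_def by (intro span_base) auto
    qed
    moreover have "Poly_Mapping.lookup (fst x) m = 0" if "m < 0" for m
      by (rule ccontr) (use x(2)[of m] n that in auto)
    ultimately show "x \<in> aff_borel L"
      using x(1) by (intro aff_n_plus_borel) (simp add: aff_n_plus_iff)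
  qed
  moreover have "?b \<in> aff_cartan L" using \<beta>' unfolding aff_cartan_iff by blast
  ultimately show ?thesis using nz unfolding aff_pos_roots_def by blast
qed

text \<open>The height element has natural numbers as eigenvalues on the Cartan subalgebra and on
  \<open>n_plus L\<close>, but a negative integer as eigenvalue of z.\<close>

lemma negative_root_vector_not_borel:
  assumes "- \<beta> \<in> pos_roots L" "z \<in> root_space L \<beta>" "h \<in> cartan L" "n \<in> n_plus L" "z = h + n"
  shows "z = 0"
proof -
  obtain \<rho>' where \<rho>: "\<rho>' \<in> cartan L" "\<And>\<beta>. \<beta> \<in> pos_roots L \<Longrightarrow> \<exists>n::nat. n > 0 \<and> ipr L \<rho>' \<beta> = of_nat n"
    using exists_height_vector by blast
  let ?E = "{x. \<exists>c\<in>range (of_nat :: nat \<Rightarrow> complex). brk L \<rho>' x = scl L c x}"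
  have "h \<in> span ?E" using \<rho>(1) assms(3) cartan_abelian by (intro span_base) (auto intro!: exI[of _ 0])
  moreover have "n_plus L \<subseteq> span ?E"
    unfolding n_plus_def
  proof (rule span_mono, rule subsetI)
    fix x assume "x \<in> (\<Union>\<alpha>\<in>pos_roots L. root_space L \<alpha>)"
    then obtain \<gamma> where \<gamma>: "\<gamma> \<in> pos_roots L" "x \<in> root_space L \<gamma>" by blast
    then have "brk L \<rho>' x = scl L (ipr L \<rho>' \<gamma>) x" using \<rho>(1) by (simp add: root_space_def ipr_sym)
    with \<rho>(2)[OF \<gamma>(1)] show "x \<in> ?E" by force
  qed
  ultimately have 1: "z \<in> span ?E" using assms(4,5) by (auto intro: span_add)
  obtain m :: nat where m: "m > 0" "ipr L \<rho>' (- \<beta>) = of_nat m" using \<rho>(2)[OF assms(1)] by blast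
  then have "ipr L \<rho>' \<beta> = - of_nat m" by (simp add: minus_equation_iff)
  then have 2: "brk L \<rho>' z = scl L (- of_nat m) z" using assms(2) \<rho>(1) by (simp add: root_space_def ipr_sym)
  have "(- of_nat m :: complex) \<notin> range of_nat"
  proof
    assume "(- of_nat m :: complex) \<in> range of_nat"
    then obtain k :: nat where "(- of_nat m :: complex) = of_nat k" by blast
    then have "(of_nat (m + k) :: complex) = 0" by (metis add.right_inverse of_nat_add)
    with m(1) show False by (simp only: of_nat_eq_0_iff)
  qed
  then show ?thesis by (rule eigenvector_not_in_other_span[OF brk_linear_right 1 2])
qed

lemma aff_pos_roots_cases:
  assumes "\<beta> \<in> aff_pos_roots L"
  obtains h0 m where "\<beta> = aff_elem h0 (of_int m) 0" "m > 0 \<and> (h0 = 0 \<or> h0 \<in> roots L) \<or> m = 0 \<and> h0 \<in> pos_roots L"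
proof -
  obtain h0 a b where \<beta>: "\<beta> = aff_elem h0 a b" "h0 \<in> cartan L" "aff_elem h0 a b \<noteq> 0"
    "aff_root_space L \<beta> \<noteq> {0}" "aff_root_space L \<beta> \<subseteq> aff_borel L"
    using assms unfolding aff_pos_roots_def aff_cartan_iff by blast
  have "0 \<in> aff_root_space L \<beta>" unfolding \<beta>(1) aff_root_space_iff[OF \<beta>(2,3)] by (simp add: zero_prod_def)
  then obtain x where x: "x \<in> aff_root_space L \<beta>" "x \<noteq> 0" using \<beta>(4) by blast
  note x' = x(1)[unfolded \<beta>(1) aff_root_space_iff[OF \<beta>(2,3)]]
  have "\<exists>k. Poly_Mapping.lookup (fst x) k \<noteq> 0"
  proof (rule ccontr)
    assume "\<not> ?thesis"
    then have "x = 0" using x' by (intro affine_eqI) (auto simp: zero_prod_def)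
    with x show False by blast
  qed
  then obtain k where k: "Poly_Mapping.lookup (fst x) k \<noteq> 0" by blast
  with x' have ab: "b = 0" "a = of_int k" and xk: "Poly_Mapping.lookup (fst x) k \<in> root_space L h0" by blast+
  obtain h n where hn: "x = h + n" "h \<in> aff_cartan L" "n \<in> aff_n_plus L"
    using x(1) \<beta>(5) unfolding aff_borel_def by blast
  obtain h' a' b' where h': "h = aff_elem h' a' b'" "h' \<in> cartan L" using hn(2) aff_cartan_iff by blast
  have root: "h0 = 0 \<or> h0 \<in> roots L" using \<beta>(2) k xk by (auto simp: roots_def)
  have "k \<ge> 0"
    using k hn(3) by (intro leI notI) (auto simp: hn(1) h' lookup_add lookup_single aff_n_plus_iff)
  show ?thesis
  proof (rule that)
    show "\<beta> = aff_elem h0 (of_int k) 0" using \<beta>(1) ab by simp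
    show "k > 0 \<and> (h0 = 0 \<or> h0 \<in> roots L) \<or> k = 0 \<and> h0 \<in> pos_roots L"
    proof (cases "k > 0")
      case False
      with \<open>k \<ge> 0\<close> have k0: "k = 0" by simp
      then have "h0 \<noteq> 0" using \<beta>(3) ab by (auto simp: zero_prod_def)
      with root have "h0 \<in> roots L" by blast
      have "Poly_Mapping.lookup (fst x) 0 = h' + fin_part n"
        by (simp add: hn(1) h'(1) lookup_add fin_part_def)
      then have "- h0 \<notin> pos_roots L"
        using negative_root_vector_not_borel[of h0 "Poly_Mapping.lookup (fst x) 0" h' "fin_part n"]
          xk k h'(2) hn(3) unfolding k0 aff_n_plus_iff by blast
      then show ?thesis using k0 \<open>h0 \<in> roots L\<close> pos_roots_cases by blast
    qed (use root in blast)
  qed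
qed

lemma aff_sum_loops:
  fixes x :: "'g affine"
  shows "x = (\<Sum>m\<in>Poly_Mapping.keys (fst x). loop (Poly_Mapping.lookup (fst x) m) m) + (0, snd x)"
proof (rule affine_eqI)
  have "snd (\<Sum>m\<in>M. loop (f m) m) = (0, 0)" for M and f :: "int \<Rightarrow> 'g"
    by (induction M rule: infinite_finite_induct) (auto simp: loop_def zero_prod_def)
  then show "snd x = snd ((\<Sum>m\<in>Poly_Mapping.keys (fst x). loop (Poly_Mapping.lookup (fst x) m) m) + (0, snd x))"
    by (simp only: snd_add snd_conv) (simp flip: zero_prod_def)
  have fst: "fst (\<Sum>m\<in>M. loop (f m) m) = (\<Sum>m\<in>M. Poly_Mapping.single m (f m))" for M and f :: "int \<Rightarrow> 'g"
    by (induction M rule: infinite_finite_induct) (auto simp: loop_def)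
  fix k
  have "(\<Sum>m\<in>Poly_Mapping.keys (fst x). Poly_Mapping.lookup (Poly_Mapping.single m (Poly_Mapping.lookup (fst x) m)) k)
      = (\<Sum>m\<in>Poly_Mapping.keys (fst x). if m = k then Poly_Mapping.lookup (fst x) k else 0)"
    by (rule sum.cong) (auto simp: lookup_single when_def)
  then show "Poly_Mapping.lookup (fst x) k
      = Poly_Mapping.lookup (fst ((\<Sum>m\<in>Poly_Mapping.keys (fst x). loop (Poly_Mapping.lookup (fst x) m) m) + (0, snd x))) k"
    by (auto simp: fst lookup_sum in_keys_iff)
qed

text \<open>H = \<rho>' + N d grades the affine algebra so that positive roots have positive
  integral height. The last property is a triangular decomposition: vectors strictly lowered by H,
  plus the Borel subalgebra, make up everything.\<close>

lemma exists_affine_height: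
  obtains H where "H \<in> aff_cartan L"
    "\<forall>\<beta>\<in>aff_pos_roots L. \<exists>n::nat. n > 0 \<and> aff_ipr L \<beta> H = of_nat n"
    "\<forall>x. \<exists>y\<in>aff.span {y. \<exists>j::nat. j > 0 \<and> aff_brk L H y = aff_scl L (- of_nat j) y}. \<exists>b\<in>aff_borel L. x = y + b"
proof -
  obtain \<rho>' where \<rho>: "\<rho>' \<in> cartan L" "\<And>\<beta>. \<beta> \<in> pos_roots L \<Longrightarrow> \<exists>n::nat. n > 0 \<and> ipr L \<rho>' \<beta> = of_nat n"
    using exists_height_vector by blast
  have "\<forall>\<beta>\<in>roots L. \<exists>n::int. ipr L \<rho>' \<beta> = of_int n"
  proof
    fix \<beta> assume "\<beta> \<in> roots L"
    then consider "\<beta> \<in> pos_roots L" | "- \<beta> \<in> pos_roots L" using pos_roots_cases by blast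
    then show "\<exists>n::int. ipr L \<rho>' \<beta> = of_int n"
    proof cases
      case 1
      then show ?thesis using \<rho>(2) by (metis of_int_of_nat_eq)
    next
      case 2
      then obtain n :: nat where "ipr L \<rho>' (- \<beta>) = of_nat n" using \<rho>(2) by blast
      then have "ipr L \<rho>' \<beta> = of_int (- int n)" by (simp add: minus_equation_iff)
      then show ?thesis by blast
    qed
  qed
  then obtain ht :: "'g \<Rightarrow> int" where ht: "\<forall>\<beta>\<in>roots L. ipr L \<rho>' \<beta> = of_int (ht \<beta>)" by metis
  \<comment> \<open>N exceeds the absolute height of every finite root, so the degree in t dominates
    the sign of the total height.\<close>
  define N where "N = 1 + (\<Sum>\<beta>\<in>roots L. \<bar>ht \<beta>\<bar>)"
  have N: "\<bar>ht \<beta>\<bar> < N" if "\<beta> \<in> roots L" for \<beta>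
    using member_le_sum[OF that, of "\<lambda>\<beta>. \<bar>ht \<beta>\<bar>"] finite_roots by (simp add: N_def)
  have "(\<Sum>\<beta>\<in>roots L. \<bar>ht \<beta>\<bar>) \<ge> 0" by (rule sum_nonneg) simp
  then have N0: "N > 0" unfolding N_def by linarith
  define H where "H = aff_elem \<rho>' 0 (of_int N)"
  have H: "H \<in> aff_cartan L" using \<rho>(1) unfolding H_def aff_cartan_iff by blast
  have N_mult: "m * N \<ge> N" if "m > 0" for m :: int
    using that N0 mult_right_mono[of 1 m N] by simp
  have pos: "\<exists>n::nat. n > 0 \<and> aff_ipr L \<beta> H = of_nat n" if \<beta>: "\<beta> \<in> aff_pos_roots L" for \<beta>
  proof -
    obtain h0 m where hm: "\<beta> = aff_elem h0 (of_int m) 0"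
      "m > 0 \<and> (h0 = 0 \<or> h0 \<in> roots L) \<or> m = 0 \<and> h0 \<in> pos_roots L"
      using aff_pos_roots_cases[OF \<beta>] by blast
    have eq: "aff_ipr L \<beta> H = ipr L \<rho>' h0 + of_int (m * N)"
      by (simp add: hm(1) H_def aff_ipr_cartan_left ipr_sym)
    from hm(2) consider "m > 0" "h0 = 0" | "m > 0" "h0 \<in> roots L" | "m = 0" "h0 \<in> pos_roots L" by blast
    then have "\<exists>n::int. n > 0 \<and> aff_ipr L \<beta> H = of_int n"
    proof cases
      case 1
      then show ?thesis using eq N_mult[of m] N0 by (intro exI[of _ "m * N"]) auto
    next
      case 2
      then have "aff_ipr L \<beta> H = of_int (ht h0 + m * N)" using eq ht by simp
      moreover have "ht h0 + m * N > 0" using N[OF 2(2)] N_mult[OF 2(1)] by linarith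
      ultimately show ?thesis by blast
    next
      case 3
      then show ?thesis using eq \<rho>(2)[OF 3(2)] by (metis add.right_neutral mult_zero_left of_int_0 of_int_of_nat_eq of_nat_0_less_iff)
    qed
    then obtain n :: int where "n > 0" "aff_ipr L \<beta> H = of_int n" by blast
    then show ?thesis by (intro exI[of _ "nat n"]) auto
  qed
  let ?D = "{y. \<exists>j::nat. j > 0 \<and> aff_brk L H y = aff_scl L (- of_nat j) y}"
  let ?X = "{y + b | y b. y \<in> aff.span ?D \<and> b \<in> aff_borel L}"
  have X: "aff.subspace ?X" by (rule aff.subspace_sums[OF aff.subspace_span subspace_aff_borel])
  have DX: "y \<in> ?X" if "y \<in> ?D" for y
    by (rule CollectI, rule exI[of _ y], rule exI[of _ 0])
      (simp only: aff.span_base[OF that] aff.subspace_0[OF subspace_aff_borel] add_0_right simp_thms)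
  have BX: "b \<in> ?X" if "b \<in> aff_borel L" for b
    by (rule CollectI, rule exI[of _ 0], rule exI[of _ b])
      (simp only: aff.span_zero that add_0_left simp_thms)
  have brk_loop: "aff_brk L H (loop z m) = aff_scl L (ipr L \<rho>' \<beta> + of_int (m * N)) (loop z m)"
    if "z \<in> root_space L \<beta>" for z m \<beta>
  proof (rule affine_eqI)
    show "snd (aff_brk L H (loop z m)) = snd (aff_scl L (ipr L \<rho>' \<beta> + of_int (m * N)) (loop z m))"
      unfolding H_def snd_aff_brk_cartan by (simp add: loop_def)
    show "Poly_Mapping.lookup (fst (aff_brk L H (loop z m))) k
      = Poly_Mapping.lookup (fst (aff_scl L (ipr L \<rho>' \<beta> + of_int (m * N)) (loop z m))) k" for k
      using that \<rho>(1) unfolding H_def lookup_aff_brk_cartan lookup_aff_scl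
      by (auto simp: loop_def lookup_single when_def root_space_def ipr_sym scale_left_distrib mult.commute)
  qed
  have homog: "loop z m \<in> ?X" if z: "z \<in> root_space L \<beta>" "\<beta> \<in> cartan L" for z m \<beta>
  proof (cases "z = 0")
    case True
    then show ?thesis using aff.subspace_0[OF X] by simp
  next
    case False
    then have root: "\<beta> = 0 \<or> \<beta> \<in> roots L" using z by (auto simp: roots_def)
    have D: "loop z m \<in> ?X" if j: "ipr L \<rho>' \<beta> + of_int (m * N) = of_int j" "j < 0" for j
    proof (rule DX, rule CollectI, rule exI[of _ "nat (- j)"])
      show "nat (- j) > 0 \<and> aff_brk L H (loop z m) = aff_scl L (- of_nat (nat (- j))) (loop z m)"
        unfolding brk_loop[OF z(1)] j(1) using j(2) by simp
    qed
    \<comment> \<open>The first four cases are degrees \<ge> 0, where only negative finite roots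
      fall outside the Borel subalgebra; in negative degree everything is strictly lowered.\<close>
    consider "m > 0" | "m = 0" "\<beta> = 0" | "m = 0" "\<beta> \<in> pos_roots L" | "m = 0" "- \<beta> \<in> pos_roots L"
      | "m < 0" "\<beta> = 0" | "m < 0" "\<beta> \<in> roots L"
      using root pos_roots_cases linorder_less_linear[of m 0] by blast
    then show ?thesis
    proof cases
      case 1
      then have "loop z m \<in> aff_n_plus L"
        using subspace_0[OF subspace_n_plus]
        by (auto simp: aff_n_plus_iff loop_def fin_part_def lookup_single when_def)
      then show ?thesis by (intro BX aff_n_plus_borel)
    next
      case 2
      then have "loop z m \<in> aff_cartan L" using z root_space_0 emb_eq unfolding aff_cartan_iff by blast
      then show ?thesis by (intro BX aff_cartan_borel)
    next
      case 3
      then have "z \<in> n_plus L" using z unfolding n_plus_def by (intro span_base) blast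
      then have "loop z m \<in> aff_n_plus L"
        using 3 by (auto simp: aff_n_plus_iff loop_def fin_part_def lookup_single when_def)
      then show ?thesis by (intro BX aff_n_plus_borel)
    next
      case 4
      then obtain n :: nat where n: "n > 0" "ipr L \<rho>' (- \<beta>) = of_nat n" using \<rho>(2) by blast
      then have "ipr L \<rho>' \<beta> = - of_nat n" by (simp add: minus_equation_iff)
      then show ?thesis using D[of "- int n"] 4 n by simp
    next
      case 5
      then show ?thesis using D[of "m * N"] N0 by (simp add: mult_neg_pos)
    next
      case 6
      then have "ht \<beta> + m * N < 0" using N[OF 6(2)] N_mult[of "- m"] by simp
      then show ?thesis using D[of "ht \<beta> + m * N"] ht 6 by simp
    qed
  qed
  have loopX: "loop z m \<in> ?X" for z m
  proof -
    interpret lp: Vector_Spaces.linear "scl L" "aff_scl L" "\<lambda>x. loop x m" by (rule loop_linear)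
    have "subspace {z. loop z m \<in> ?X}" by (rule lp.subspace_linear_preimage[OF X])
    then have "span (\<Union>\<beta>\<in>cartan L. root_space L \<beta>) \<subseteq> {z. loop z m \<in> ?X}"
      by (intro span_minimal) (use homog in blast)+
    then show ?thesis using root_decomposition by blast
  qed
  have "x \<in> ?X" for x
  proof -
    obtain xs a b where x: "x = (xs, a, b)" by (cases x)
    have "(0, a, b) = aff_elem (0::'g) a b" by simp
    then have "(0, a, b) \<in> aff_cartan L" using cartan_closed(1) unfolding aff_cartan_iff by blast
    then have "(0, snd x) \<in> ?X" unfolding x by (intro BX aff_cartan_borel) simp
    then have "(\<Sum>m\<in>Poly_Mapping.keys (fst x). loop (Poly_Mapping.lookup (fst x) m) m) + (0, snd x) \<in> ?X"
      using loopX by (intro aff.subspace_add[OF X] aff.subspace_sum[OF X])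
    then show ?thesis by (subst aff_sum_loops)
  qed
  then have "\<forall>x. \<exists>y\<in>aff.span ?D. \<exists>b\<in>aff_borel L. x = y + b" by blast
  with H pos show ?thesis by (intro that) blast+
qed

lemma aff_ipr_cartan_linear:
  assumes "H \<in> aff_cartan L"
  shows "aff_ipr L (x + y) H = aff_ipr L x H + aff_ipr L y H"
    "aff_ipr L (x - y) H = aff_ipr L x H - aff_ipr L y H"
    "aff_ipr L (- x) H = - aff_ipr L x H" "aff_ipr L 0 H = 0"
proof -
  obtain h a b where H: "H = aff_elem h a b" using assms aff_cartan_iff by blast
  show add: "aff_ipr L (x + y) H = aff_ipr L x H + aff_ipr L y H" for x y
    by (simp add: H aff_ipr_cartan_right algebra_simps)
  show diff: "aff_ipr L (x - y) H = aff_ipr L x H - aff_ipr L y H" for x y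
    by (simp add: H aff_ipr_cartan_right algebra_simps)
  show zero: "aff_ipr L 0 H = 0" using diff[of 0 0] by simp
  show "aff_ipr L (- x) H = - aff_ipr L x H" using diff[of 0 x] zero by simp
qed

lemma aff_cartan_eqI:
  assumes "x \<in> aff_cartan L" "y \<in> aff_cartan L" "\<And>h. h \<in> aff_cartan L \<Longrightarrow> aff_ipr L x h = aff_ipr L y h"
  shows "x = y"
proof -
  obtain h a b h' a' b' where xy: "x = aff_elem h a b" "h \<in> cartan L" "y = aff_elem h' a' b'" "h' \<in> cartan L"
    using assms(1,2) aff_cartan_iff by metis
  have eq: "ipr L h k + a * q + b * p = ipr L h' k + a' * q + b' * p" if "k \<in> cartan L" for k p q
  proof -
    have "aff_elem k p q \<in> aff_cartan L" using that aff_cartan_iff by blast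
    from assms(3)[OF this] show ?thesis unfolding xy aff_ipr_cartan_left by simp
  qed
  have "h = h'" using eq[where p = 0 and q = 0] by (intro cartan_eqI xy) simp
  moreover have "a = a'" "b = b'"
    using eq[OF cartan_closed(1), where p = 0 and q = 1] eq[OF cartan_closed(1), where p = 1 and q = 0] by simp_all
  ultimately show ?thesis by (simp add: xy)
qed

end

section \<open>The leading coefficient of the numerator\<close>

context simply_laced_lie_algebra
begin

text \<open>Every finite partial product is 1 plus terms of negative height. A coefficient at \<nu>
  with \<nu> - \<rho> outside \<open>Neg\<close> is therefore the same for all finite sets F, and
  its limit is immediate.\<close>

lemma denominator_support:
  assumes H: "H \<in> aff_cartan L" "\<forall>\<beta>\<in>aff_pos_roots L. \<exists>n::nat. n > 0 \<and> aff_ipr L \<beta> H = of_nat n"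
  shows "aff_denominator L (aff_weyl_vector L) = 1"
    "aff_denominator L \<nu> \<noteq> 0 \<Longrightarrow> \<nu> = aff_weyl_vector L \<or>
      (\<exists>n::nat. n > 0 \<and> aff_ipr L \<nu> H = aff_ipr L (aff_weyl_vector L) H - of_nat n)"
proof -
  note ipr = aff_ipr_cartan_linear[OF H(1)]
  define Neg where "Neg = {\<kappa>. \<exists>n::nat. n > 0 \<and> aff_ipr L \<kappa> H = - of_nat n}"
  have Neg_add: "x + y \<in> Neg" if xy: "x \<in> Neg" "y \<in> Neg" for x y
  proof -
    obtain m n :: nat where "m > 0" "n > 0" "aff_ipr L x H = - of_nat m" "aff_ipr L y H = - of_nat n"
      using xy by (auto simp: Neg_def)
    then have "m + n > 0" "aff_ipr L (x + y) H = - of_nat (m + n)" by (simp_all add: ipr)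
    then show ?thesis unfolding Neg_def by blast
  qed
  have Neg_0: "0 \<notin> Neg" by (auto simp: Neg_def ipr)
  \<comment> \<open>Congruence to 1 modulo negative heights. It passes to products because pq - 1 =
    (p - 1)(q - 1) + (p - 1) + (q - 1).\<close>
  let ?good = "\<lambda>p :: 'g affine \<Rightarrow>\<^sub>0 complex. Poly_Mapping.keys (p - 1) \<subseteq> Neg"
  have good_mult: "?good (p * q)" if pq: "?good p" "?good q" for p q
  proof -
    have "p * q - 1 = (p - 1) * (q - 1) + ((p - 1) + (q - 1))" by (simp add: algebra_simps)
    moreover have "Poly_Mapping.keys ((p - 1) * (q - 1)) \<subseteq> Neg"
      using keys_mult[of "p - 1" "q - 1"] pq Neg_add by blast
    ultimately show ?thesis
      using pq Poly_Mapping.keys_add[of "(p - 1) * (q - 1)" "(p - 1) + (q - 1)"]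
        Poly_Mapping.keys_add[of "p - 1" "q - 1"] by (simp only:) blast
  qed
  have good_power: "?good (p ^ n)" if "?good p" for p n
    by (induction n) (simp_all add: good_mult that)
  have good_root: "?good (1 - Poly_Mapping.single (- \<beta>) 1)" if "\<beta> \<in> aff_pos_roots L" for \<beta>
    using H(2) that by (auto simp: Neg_def ipr)
  have good_prod: "?good (\<Prod>\<beta>\<in>F. (1 - Poly_Mapping.single (- \<beta>) 1) ^ root_mult L \<beta>)"
    if "F \<subseteq> aff_pos_roots L" "finite F" for F
    using that(2,1)
  proof (induction F rule: finite_induct)
    case (insert \<beta> F)
    show ?case unfolding prod.insert[OF insert.hyps]
      using insert by (intro good_mult good_power good_root) auto
  qed simp
  let ?\<rho> = "aff_weyl_vector L"
  let ?P = "\<lambda>F. Poly_Mapping.single ?\<rho> 1 * (\<Prod>\<beta>\<in>F. (1 - Poly_Mapping.single (- \<beta>) 1) ^ root_mult L \<beta>)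
    :: 'g affine \<Rightarrow>\<^sub>0 complex"
  have coeff: "Poly_Mapping.lookup (?P F) \<nu> = (if \<nu> = ?\<rho> then 1 else 0)"
    if F: "F \<subseteq> aff_pos_roots L" "finite F" and \<nu>: "\<nu> - ?\<rho> \<notin> Neg" for F \<nu>
  proof -
    let ?p = "\<Prod>\<beta>\<in>F. (1 - Poly_Mapping.single (- \<beta>) (1::complex)) ^ root_mult L \<beta>"
    have "?P F = Poly_Mapping.single ?\<rho> 1 + Poly_Mapping.single ?\<rho> 1 * (?p - 1)" by (simp add: algebra_simps)
    moreover have "\<nu> \<notin> Poly_Mapping.keys (Poly_Mapping.single ?\<rho> 1 * (?p - 1))"
    proof
      assume "\<nu> \<in> Poly_Mapping.keys (Poly_Mapping.single ?\<rho> 1 * (?p - 1))"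
      then obtain a b where ab: "\<nu> = a + b" "a \<in> Poly_Mapping.keys (Poly_Mapping.single ?\<rho> (1::complex))"
        "b \<in> Poly_Mapping.keys (?p - 1)"
        using keys_mult by blast
      moreover from ab(2) have "a = ?\<rho>" unfolding keys_single by (simp split: if_splits)
      ultimately have "\<nu> - ?\<rho> \<in> Poly_Mapping.keys (?p - 1)" by simp
      then show False using good_prod[OF F] \<nu> by blast
    qed
    ultimately show ?thesis by (auto simp: lookup_add in_keys_iff lookup_single when_def)
  qed
  have lim: "aff_denominator L \<nu> = (if \<nu> = ?\<rho> then 1 else 0)" if "\<nu> - ?\<rho> \<notin> Neg" for \<nu>
    unfolding aff_denominator_def
  proof (rule tendsto_Lim)
    show "((\<lambda>F. Poly_Mapping.lookup (?P F) \<nu>) \<longlongrightarrow> (if \<nu> = ?\<rho> then 1 else 0)) (finite_subsets_at_top (aff_pos_roots L))"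
      by (rule tendsto_eventually, rule eventually_finite_subsets_at_top_weakI) (rule coeff[OF _ _ that])
  qed simp
  show "aff_denominator L ?\<rho> = 1" using lim[of ?\<rho>] Neg_0 by simp
  show "\<nu> = ?\<rho> \<or> (\<exists>n::nat. n > 0 \<and> aff_ipr L \<nu> H = aff_ipr L ?\<rho> H - of_nat n)"
    if "aff_denominator L \<nu> \<noteq> 0"
  proof (cases "\<nu> - ?\<rho> \<in> Neg")
    case True
    then obtain n :: nat where "n > 0" "aff_ipr L \<nu> H - aff_ipr L ?\<rho> H = - of_nat n"
      by (auto simp: Neg_def ipr)
    then have "aff_ipr L \<nu> H = aff_ipr L ?\<rho> H - of_nat n" by (simp add: diff_eq_eq)
    with \<open>n > 0\<close> show ?thesis by blast
  next
    case False
    then show ?thesis using lim[OF False] that by (auto split: if_splits)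
  qed
qed

text \<open>Irreducibility makes the module generated by v under strictly lowering elements. Hence H
  has eigenvalue c0 only on the line of v, and all its other eigenvalues are c0 minus a positive
  integer.\<close>

lemma character_support:
  fixes s :: "complex \<Rightarrow> 'v::ab_group_add \<Rightarrow> 'v"
  assumes mod: "is_L L \<Lambda> s act" and \<Lambda>: "\<Lambda> \<in> aff_cartan L" and H: "H \<in> aff_cartan L"
    and decomp: "\<forall>x. \<exists>y\<in>aff.span {y. \<exists>j::nat. j > 0 \<and> aff_brk L H y = aff_scl L (- of_nat j) y}.
      \<exists>b\<in>aff_borel L. x = y + b"
  shows "character L s act \<Lambda> = 1"
    "character L s act \<mu> \<noteq> 0 \<Longrightarrow> \<mu> = \<Lambda> \<or> (\<exists>n::nat. n > 0 \<and> aff_ipr L \<mu> H = aff_ipr L \<Lambda> H - of_nat n)"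
proof -
  have am: "aff_module L s act"
    and irr: "\<And>U. module.subspace s U \<Longrightarrow> (\<And>x v. v \<in> U \<Longrightarrow> act x v \<in> U) \<Longrightarrow> U = {0} \<or> U = UNIV"
    using mod unfolding is_L_def irreducible_module_def by blast+
  obtain v where v: "v \<noteq> 0"
    "\<And>h n. h \<in> aff_cartan L \<Longrightarrow> n \<in> aff_n_plus L \<Longrightarrow> act (h + n) v = s (aff_ipr L \<Lambda> h) v"
    using mod unfolding is_L_def by blast
  interpret V: vector_space s using am unfolding aff_module_def by blast
  have lin: "Vector_Spaces.linear s s (act x)" for x using am unfolding aff_module_def by blast
  have act_simps: "act x (u + w) = act x u + act x w" "act x (s c w) = s c (act x w)"
    "act (x + y) w = act x w + act y w" "act (aff_scl L c x) w = s c (act x w)"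
    "act (aff_brk L x y) w = act x (act y w) - act y (act x w)" for x y u w c
    using am unfolding aff_module_def Vector_Spaces.linear_iff by blast+
  have act_0: "act x 0 = 0" "act 0 w = 0" for x w
    using act_simps(2)[of x 0 0] act_simps(4)[of 0 0 w] by simp_all
  define D where "D = {y. \<exists>j::nat. j > 0 \<and> aff_brk L H y = aff_scl L (- of_nat j) y}"
  define c0 where "c0 = aff_ipr L \<Lambda> H"
  define C where "C = {c0 - of_nat j | j :: nat. j > 0}"
  define Low where "Low = {w. \<exists>c\<in>C. act H w = s c w}"
  \<comment> \<open>Elements of D send v and \<open>Low\<close> into \<open>Low\<close>, so Z
    contains v and is closed under D; it will turn out to be the whole module.\<close>
  define Z where "Z = {a + b | a b. a \<in> V.span {v} \<and> b \<in> V.span Low}"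
  have hv: "act h v = s (aff_ipr L \<Lambda> h) v" if "h \<in> aff_cartan L" for h
    using v(2)[OF that aff.subspace_0[OF subspace_aff_n_plus]] by simp
  have Hv: "act H v = s c0 v" using hv[OF H] by (simp add: c0_def)
  have Z: "V.subspace Z" unfolding Z_def by (rule V.subspace_sums) auto
  have vZ: "w \<in> Z" if "w \<in> V.span {v}" for w
    unfolding Z_def by (rule CollectI, rule exI[of _ w], rule exI[of _ 0]) (simp add: that V.span_zero)
  have LZ: "w \<in> Z" if "w \<in> Low" for w
    unfolding Z_def by (rule CollectI, rule exI[of _ 0], rule exI[of _ w]) (simp add: that V.span_zero V.span_base)
  have act_D: "act y w \<in> Low" if y: "y \<in> D" and w: "w \<in> insert v Low" for y w
  proof -
    obtain j :: nat where j: "j > 0" "aff_brk L H y = aff_scl L (- of_nat j) y" using y by (auto simp: D_def)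
    obtain i :: nat where i: "act H w = s (c0 - of_nat i) w"
    proof (cases "w = v")
      case True
      then show ?thesis using that[of 0] Hv by simp
    next
      case False
      then show ?thesis using that w by (auto simp: Low_def C_def)
    qed
    have "act H (act y w) = act (aff_brk L H y) w + act y (act H w)" by (simp add: act_simps(5))
    also have "\<dots> = s (- of_nat j + (c0 - of_nat i)) (act y w)"
      unfolding j(2) i act_simps V.scale_left_distrib ..
    also have "- of_nat j + (c0 - of_nat i) = c0 - of_nat (i + j)" by simp
    finally show ?thesis unfolding Low_def C_def using j(1) by blast
  qed
  have Z_D: "act y w \<in> Z" if y: "y \<in> D" and w: "w \<in> Z" for y w
  proof -
    have sub: "V.subspace {w. act y w \<in> Z}"
    proof -
      interpret l: Vector_Spaces.linear s s "act y" by (rule lin)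
      show ?thesis by (rule l.subspace_linear_preimage[OF Z])
    qed
    have "V.span {v} \<subseteq> {w. act y w \<in> Z}" "V.span Low \<subseteq> {w. act y w \<in> Z}"
      using act_D[OF y] LZ by (intro V.span_minimal[OF _ sub]; blast)+
    moreover obtain a b where "w = a + b" "a \<in> V.span {v}" "b \<in> V.span Low" using w unfolding Z_def by blast
    ultimately show ?thesis using V.subspace_add[OF sub] by blast
  qed
  \<comment> \<open>The smallest subspace containing v and closed under D. It is shown to be a
    submodule, hence everything, and by minimality it lies in Z.\<close>
  define U where "U = \<Inter>{A. V.subspace A \<and> v \<in> A \<and> (\<forall>y\<in>D. \<forall>w\<in>A. act y w \<in> A)}"
  have U: "V.subspace U" unfolding U_def by (rule V.subspace_Inter) blast
  have vU: "v \<in> U" by (auto simp: U_def)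
  have U_min: "U \<subseteq> A" if "V.subspace A" "v \<in> A" "\<And>y w. y \<in> D \<Longrightarrow> w \<in> A \<Longrightarrow> act y w \<in> A" for A
    using that unfolding U_def by blast
  have U_D: "act y w \<in> U" if "y \<in> D" "w \<in> U" for y w
    using that unfolding U_def by blast
  have U_spanD: "act y w \<in> U" if "y \<in> aff.span D" "w \<in> U" for y w
  proof -
    have "aff.subspace {y. act y w \<in> U}"
      by (rule aff.subspaceI) (auto simp: act_0 act_simps V.subspace_0[OF U] V.subspace_add[OF U] V.subspace_scale[OF U])
    then have "aff.span D \<subseteq> {y. act y w \<in> U}" using U_D that(2) by (intro aff.span_minimal) blast+
    then show ?thesis using that(1) by blast
  qed
  \<comment> \<open>\<open>[b, y]\<close> splits into parts in \<open>D\<close> and in the Borel subalgebra, so the vectors of \<open>U\<close> that the Borel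
    subalgebra keeps in \<open>U\<close> are again closed under \<open>D\<close>; this replaces the PBW theorem.\<close>
  have U_borel: "U \<subseteq> {w \<in> U. \<forall>b\<in>aff_borel L. act b w \<in> U}"
  proof (rule U_min)
    show "V.subspace {w \<in> U. \<forall>b\<in>aff_borel L. act b w \<in> U}"
      by (rule V.subspaceI) (auto simp: act_0 act_simps V.subspace_0[OF U] V.subspace_add[OF U] V.subspace_scale[OF U])
    show "v \<in> {w \<in> U. \<forall>b\<in>aff_borel L. act b w \<in> U}"
      using vU v(2) V.subspace_scale[OF U] unfolding aff_borel_def by auto
    fix y w assume y: "y \<in> D" and w: "w \<in> {w \<in> U. \<forall>b\<in>aff_borel L. act b w \<in> U}"
    have "act b (act y w) \<in> U" if b: "b \<in> aff_borel L" for b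
    proof -
      obtain y' b' where yb: "y' \<in> aff.span D" "b' \<in> aff_borel L" "aff_brk L b y = y' + b'"
        using decomp unfolding D_def by blast
      have "act b (act y w) = act (aff_brk L b y) w + act y (act b w)" by (simp add: act_simps(5))
      also have "\<dots> = act y' w + act b' w + act y (act b w)" by (simp add: yb(3) act_simps(3))
      also have "\<dots> \<in> U"
        using w b yb y U_spanD U_D by (intro V.subspace_add[OF U]) auto
      finally show ?thesis .
    qed
    then show "act y w \<in> {w \<in> U. \<forall>b\<in>aff_borel L. act b w \<in> U}" using U_D[OF y] w by blast
  qed
  have "act x w \<in> U" if "w \<in> U" for x w
  proof -
    obtain y b where yb: "y \<in> aff.span D" "b \<in> aff_borel L" "x = y + b" using decomp unfolding D_def by blast
    moreover have "act b w \<in> U" using U_borel that yb(2) by blast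
    ultimately show ?thesis using U_spanD[OF yb(1) that] V.subspace_add[OF U] by (simp add: act_simps(3))
  qed
  then have "U = {0} \<or> U = UNIV" by (rule irr[OF U])
  then have "U = UNIV" using vU v(1) by blast
  moreover have "U \<subseteq> Z" by (rule U_min[OF Z]) (auto intro: Z_D vZ V.span_base)
  ultimately have Z_UNIV: "Z = UNIV" by blast
  have c0: "c0 \<notin> C" by (auto simp: C_def)
  \<comment> \<open>In w = a + b both w and a have eigenvalue c0, so b has it too; but b lies in the
    span of eigenvectors with eigenvalues in C.\<close>
  have top: "w \<in> V.span {v}" if w: "act H w = s c0 w" for w
  proof -
    obtain a b where ab: "w = a + b" "a \<in> V.span {v}" "b \<in> V.span Low" using Z_UNIV unfolding Z_def by blast
    obtain k where "a = s k v" using ab(2) by (auto simp: V.span_singleton)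
    then have "act H a = s c0 a" by (simp add: act_simps Hv mult.commute)
    then have "act H b = s c0 b" using w by (simp add: ab(1) act_simps V.scale_right_distrib)
    then have "b = 0" using V.eigenvector_not_in_other_span[OF lin ab(3)[unfolded Low_def] _ c0] by blast
    then show ?thesis using ab by simp
  qed
  have weight_\<Lambda>: "weight_space L s act \<Lambda> = V.span {v}"
  proof
    show "weight_space L s act \<Lambda> \<subseteq> V.span {v}"
      using top H by (auto simp: weight_space_def c0_def)
    show "V.span {v} \<subseteq> weight_space L s act \<Lambda>"
      by (auto simp: V.span_singleton weight_space_def act_simps hv mult.commute)
  qed
  then show "character L s act \<Lambda> = 1"
    using \<Lambda> v(1) V.dim_span_eq_card_independent[of "{v}"] by (simp add: character_def)
  assume "character L s act \<mu> \<noteq> 0"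
  then have \<mu>: "\<mu> \<in> aff_cartan L" "V.dim (weight_space L s act \<mu>) \<noteq> 0"
    by (auto simp: character_def split: if_splits)
  have "\<not> weight_space L s act \<mu> \<subseteq> {0}"
  proof
    assume "weight_space L s act \<mu> \<subseteq> {0}"
    then have "V.dim (weight_space L s act \<mu>) \<le> card ({} :: 'v set)" by (intro V.dim_le_card) auto
    with \<mu>(2) show False by simp
  qed
  then obtain w where w: "w \<noteq> 0" "\<And>h. h \<in> aff_cartan L \<Longrightarrow> act h w = s (aff_ipr L \<mu> h) w"
    unfolding weight_space_def by blast
  have "V.span {v} \<subseteq> V.span {w. \<exists>c\<in>insert c0 C. act H w = s c w}" "V.span Low \<subseteq> V.span {w. \<exists>c\<in>insert c0 C. act H w = s c w}"
    unfolding Low_def by (intro V.span_mono; use Hv in blast)+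
  then have "Z \<subseteq> V.span {w. \<exists>c\<in>insert c0 C. act H w = s c w}"
    unfolding Z_def by (auto intro: V.span_add)
  then have "w \<in> V.span {w. \<exists>c\<in>insert c0 C. act H w = s c w}" using Z_UNIV by blast
  then have "aff_ipr L \<mu> H \<in> insert c0 C"
    using V.eigenvector_not_in_other_span[OF lin _ w(2)[OF H]] w(1) by blast
  then show "\<mu> = \<Lambda> \<or> (\<exists>n::nat. n > 0 \<and> aff_ipr L \<mu> H = aff_ipr L \<Lambda> H - of_nat n)"
  proof
    assume "aff_ipr L \<mu> H = c0"
    then have "w \<in> V.span {v}" using top w(2)[OF H] by simp
    then have "act h w = s (aff_ipr L \<Lambda> h) w" if "h \<in> aff_cartan L" for h
      using that weight_\<Lambda> by (auto simp: weight_space_def)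
    then have "\<mu> = \<Lambda>" using w by (intro aff_cartan_eqI \<mu> \<Lambda>) (metis V.scale_cancel_right)
    then show ?thesis ..
  qed (auto simp: C_def c0_def)
qed

text \<open>In a contributing product of exponentials the two heights are at most those of \<rho>
  and \<Lambda> and add up to the sum of these, so both are maximal. The convolution thus reduces to
  one term.\<close>

lemma character_leading_coefficient:
  assumes mod: "is_L L \<Lambda> s act" and \<Lambda>: "\<Lambda> \<in> aff_cartan L"
  shows "series_mult (aff_denominator L) (character L s act) (\<Lambda> + aff_weyl_vector L) = 1"
proof -
  obtain H where H: "H \<in> aff_cartan L"
    "\<forall>\<beta>\<in>aff_pos_roots L. \<exists>n::nat. n > 0 \<and> aff_ipr L \<beta> H = of_nat n"
    "\<forall>x. \<exists>y\<in>aff.span {y. \<exists>j::nat. j > 0 \<and> aff_brk L H y = aff_scl L (- of_nat j) y}. \<exists>b\<in>aff_borel L. x = y + b"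
    using exists_affine_height by blast
  let ?\<rho> = "aff_weyl_vector L"
  note R = denominator_support[OF H(1,2)] and ch = character_support[OF mod \<Lambda> H(1,3)]
  have "{\<nu>. aff_denominator L \<nu> \<noteq> 0 \<and> character L s act (\<Lambda> + ?\<rho> - \<nu>) \<noteq> 0} = {?\<rho>}"
  proof (intro equalityI subsetI)
    fix \<nu> assume "\<nu> \<in> {\<nu>. aff_denominator L \<nu> \<noteq> 0 \<and> character L s act (\<Lambda> + ?\<rho> - \<nu>) \<noteq> 0}"
    then have nz: "aff_denominator L \<nu> \<noteq> 0" "character L s act (\<Lambda> + ?\<rho> - \<nu>) \<noteq> 0" by auto
    show "\<nu> \<in> {?\<rho>}"
    proof (rule ccontr)
      assume "\<nu> \<notin> {?\<rho>}"
      then obtain n :: nat where n: "n > 0" "aff_ipr L \<nu> H = aff_ipr L ?\<rho> H - of_nat n"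
        using R(2)[OF nz(1)] by blast
      then have "aff_ipr L (\<Lambda> + ?\<rho> - \<nu>) H = aff_ipr L \<Lambda> H + of_nat n"
        by (simp add: aff_ipr_cartan_linear[OF H(1)])
      moreover obtain m :: nat where "aff_ipr L (\<Lambda> + ?\<rho> - \<nu>) H = aff_ipr L \<Lambda> H - of_nat m"
        using ch(2)[OF nz(2)] by (metis diff_zero of_nat_0)
      ultimately have "(of_nat n :: complex) = - of_nat m" by simp
      then have "(of_nat (m + n) :: complex) = 0" by (simp only: of_nat_add) simp
      with n(1) show False by (simp only: of_nat_eq_0_iff)
    qed
  qed (use R(1) ch(1) in auto)
  then show ?thesis using R(1) ch(1) by (simp add: series_mult_def)
qed

end

section \<open>The affine Weyl group\<close>

text \<open>Elements of \<open>weyl_group L\<close> change an affine element only in its component in degree \<open>0\<close>.\<close>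

definition weyl_lift :: "('g::ab_group_add \<Rightarrow> 'g) \<Rightarrow> 'g affine \<Rightarrow> 'g affine" where
  "weyl_lift f x = x + emb (f (fin_part x) - fin_part x)"

definition weyl_restrict :: "('g::ab_group_add affine \<Rightarrow> 'g affine) \<Rightarrow> 'g \<Rightarrow> 'g" where
  "weyl_restrict w h = fin_part (w (emb h))"

lemma fin_part_weyl_lift [simp]: "fin_part (weyl_lift f x) = f (fin_part x)"
  by (simp add: weyl_lift_def)

lemma weyl_restrict_lift [simp]: "weyl_restrict (weyl_lift f) = f"
  by (simp add: fun_eq_iff weyl_restrict_def)

lemma snd_weyl_lift [simp]: "snd (weyl_lift f x) = snd x"
  by (cases x) (simp add: weyl_lift_def loop_def)

lemma snd_loop [simp]: "snd (loop x m) = (0, 0)"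
  by (simp add: loop_def)

context simply_laced_lie_algebra
begin

text \<open>Properties of the finite action that composition with a reflection preserves; it may
  hold for maps outside the Weyl group. The requirement that f h - h lie in the Cartan subalgebra
  controls f on all of the Lie algebra, so that its values on roots determine it.\<close>

definition weyl_map :: "('g \<Rightarrow> 'g) \<Rightarrow> bool" where
  "weyl_map f \<longleftrightarrow>
     Vector_Spaces.linear (scl L) (scl L) f \<and>
     (\<forall>h k. ipr L (f h) (f k) = ipr L h k) \<and>
     (\<forall>h. f h - h \<in> cartan L) \<and>
     (\<forall>\<beta>\<in>roots L. f \<beta> \<in> roots L) \<and>
     (\<forall>\<gamma>\<in>root_lattice L. f \<gamma> \<in> root_lattice L)"

lemma weyl_map_inj:
  assumes "weyl_map f"
  shows "inj f"
proof (rule injI)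
  fix x y assume eq: "f x = f y"
  have "x - y = 0"
  proof (rule ipr_nondegenerate)
    fix z
    have "ipr L x z = ipr L y z" using assms eq unfolding weyl_map_def by metis
    then show "ipr L (x - y) z = 0" by simp
  qed
  then show "x = y" by simp
qed

lemma weyl_map_reflection:
  assumes f: "weyl_map f" and \<alpha>: "\<alpha> \<in> roots L"
  shows "weyl_map (\<lambda>h. f h - scl L (ipr L (f h) \<alpha>) \<alpha>)"
proof -
  have lin: "f (x + y) = f x + f y" "f (scl L c x) = scl L c (f x)" for x y c
    using f by (auto simp: weyl_map_def Vector_Spaces.linear_iff)
  have "Vector_Spaces.linear (scl L) (scl L) (\<lambda>h. f h - scl L (ipr L (f h) \<alpha>) \<alpha>)"
    using vector_space_axioms
    by (simp add: Vector_Spaces.linear_iff lin scale_left_distrib scale_right_diff_distrib algebra_simps)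
  moreover have "ipr L (f h - scl L (ipr L (f h) \<alpha>) \<alpha>) (f k - scl L (ipr L (f k) \<alpha>) \<alpha>) = ipr L h k" for h k
    using f root_norm[OF \<alpha>] by (simp add: weyl_map_def ipr_sym[of \<alpha> "f k"] algebra_simps)
  moreover have "f h - scl L (ipr L (f h) \<alpha>) \<alpha> - h \<in> cartan L" for h
  proof -
    have "f h - h - scl L (ipr L (f h) \<alpha>) \<alpha> \<in> cartan L"
      using f rootsD(1)[OF \<alpha>] unfolding weyl_map_def
      by (intro subspace_diff[OF subspace_cartan, of "f h - h"] subspace_scale[OF subspace_cartan]) auto
    then show ?thesis by (simp add: algebra_simps)
  qed
  ultimately show ?thesis
    using f reflection_roots[OF \<alpha>] root_lattice_reflection[OF \<alpha>] by (simp add: weyl_map_def)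
qed

lemma reflection_weyl_lift:
  "reflection L \<alpha> (weyl_lift f x) = weyl_lift (\<lambda>h. f h - scl L (ipr L (f h) \<alpha>) \<alpha>) x"
proof -
  have "loop (f (fin_part x) - fin_part x) 0 - loop (scl L c \<alpha>) 0
    = loop (f (fin_part x) - scl L c \<alpha> - fin_part x) 0" for c
    by (simp add: loop_def zero_prod_def algebra_simps flip: single_diff)
  then show ?thesis
    unfolding reflection_def aff_ipr_emb fin_part_weyl_lift aff_scl_emb
    by (simp only: weyl_lift_def add_diff_eq[symmetric])
qed

lemma weyl_map_id: "weyl_map id"
  using linear_id cartan_closed(1) by (auto simp: weyl_map_def)

lemma weyl_lift_id: "weyl_lift id = (id :: 'g affine \<Rightarrow> 'g affine)"
  by (rule ext) (simp add: weyl_lift_def loop_def zero_prod_def)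

lemma weyl_group_lift:
  assumes "w \<in> weyl_group L"
  shows "weyl_map (weyl_restrict w)" "w = weyl_lift (weyl_restrict w)"
proof -
  have "\<exists>f. weyl_map f \<and> w = weyl_lift f"
    using assms
  proof induction
    case id
    then show ?case using weyl_map_id weyl_lift_id by metis
  next
    case (step w \<alpha>)
    then obtain f where f: "weyl_map f" "w = weyl_lift f" by blast
    then have "reflection L \<alpha> \<circ> w = weyl_lift (\<lambda>h. f h - scl L (ipr L (f h) \<alpha>) \<alpha>)"
      by (simp add: fun_eq_iff reflection_weyl_lift)
    then show ?case using weyl_map_reflection[OF f(1) step.hyps(2)] by blast
  qed
  then show "weyl_map (weyl_restrict w)" "w = weyl_lift (weyl_restrict w)" by auto
qed

lemma reflection_weyl_group: "\<alpha> \<in> roots L \<Longrightarrow> reflection L \<alpha> \<in> weyl_group L"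
  using weyl_group.step[OF weyl_group.id, of \<alpha>] by simp

lemma weyl_group_comp: "u \<in> weyl_group L \<Longrightarrow> v \<in> weyl_group L \<Longrightarrow> u \<circ> v \<in> weyl_group L"
proof (induction rule: weyl_group.induct)
  case (step w \<alpha>)
  then show ?case unfolding comp_assoc using weyl_group.step by blast
qed simp

lemma reflection_involution:
  assumes "\<alpha> \<in> roots L"
  shows "reflection L \<alpha> \<circ> reflection L \<alpha> = id"
proof
  fix x
  have "reflection L \<alpha> (reflection L \<alpha> (weyl_lift id x)) = weyl_lift id x"
    using root_norm[OF assms] by (simp add: reflection_weyl_lift) (simp add: weyl_lift_def)
  then show "(reflection L \<alpha> \<circ> reflection L \<alpha>) x = id x" by (simp add: weyl_lift_id)
qed

lemma weyl_group_inverse: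
  "u \<in> weyl_group L \<Longrightarrow> \<exists>v\<in>weyl_group L. u \<circ> v = id \<and> v \<circ> u = id"
proof (induction rule: weyl_group.induct)
  case id
  then show ?case using weyl_group.id by (intro bexI[of _ id]) auto
next
  case (step w \<alpha>)
  then obtain v where v: "v \<in> weyl_group L" "w \<circ> v = id" "v \<circ> w = id" by blast
  note r = reflection_involution[OF step.hyps(2)]
  have "(reflection L \<alpha> \<circ> w) \<circ> (v \<circ> reflection L \<alpha>) = reflection L \<alpha> \<circ> (w \<circ> v) \<circ> reflection L \<alpha>"
    "(v \<circ> reflection L \<alpha>) \<circ> (reflection L \<alpha> \<circ> w) = v \<circ> (reflection L \<alpha> \<circ> reflection L \<alpha>) \<circ> w"
    by (simp_all only: comp_assoc)
  then show ?case
    using v r weyl_group_comp[OF v(1) reflection_weyl_group[OF step.hyps(2)]]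
    by (intro bexI[of _ "v \<circ> reflection L \<alpha>"]) (simp_all only: comp_id id_comp r v simp_thms)
qed

lemma weyl_group_bij: "u \<in> weyl_group L \<Longrightarrow> bij u"
  using weyl_group_inverse o_bij by metis

text \<open>The difference f x - g x lies in the Cartan subalgebra and, since f and g are
  isometries, is orthogonal to every f \<beta>. As f permutes the finite set of roots, these include
  all simple roots.\<close>

lemma weyl_map_eqI:
  assumes f: "weyl_map f" and g: "weyl_map g" and eq: "\<And>\<beta>. \<beta> \<in> roots L \<Longrightarrow> f \<beta> = g \<beta>"
  shows "f = g"
proof
  fix x
  have surj: "f ` roots L = roots L"
    using f weyl_map_inj[OF f] finite_roots by (intro endo_inj_surj) (auto simp: weyl_map_def intro: inj_on_subset)
  have "f x - g x \<in> cartan L"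
    using subspace_diff[OF subspace_cartan, of "f x - x" "g x - x"] f g by (simp add: weyl_map_def)
  moreover have "ipr L (f x - g x) k = 0" if "k \<in> cartan L" for k
    using that
  proof (induction k rule: cartan_induct)
    case (simple i)
    then obtain \<beta> where \<beta>: "\<beta> \<in> roots L" "simple_root L i = f \<beta>"
      using surj simple_roots_in_roots by blast
    have "ipr L (f x) (f \<beta>) = ipr L (g x) (g \<beta>)" using f g by (simp add: weyl_map_def)
    then show ?case using \<beta> eq by simp
  qed (rule subspace_ipr_0)
  ultimately show "f x = g x" using cartan_nondegenerate[of "f x - g x"] by simp
qed

lemma finite_weyl_group: "finite (weyl_group L)"
proof -
  have "inj_on (\<lambda>f. restrict f (roots L)) {f. weyl_map f}"
  proof (rule inj_onI)
    fix f g assume "f \<in> {f. weyl_map f}" "g \<in> {f. weyl_map f}" "restrict f (roots L) = restrict g (roots L)"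
    then show "f = g" by (intro weyl_map_eqI) (simp_all, metis restrict_apply')
  qed
  moreover have "(\<lambda>f. restrict f (roots L)) ` {f. weyl_map f} \<subseteq> roots L \<rightarrow>\<^sub>E roots L"
    by (auto simp: weyl_map_def)
  ultimately have "finite {f. weyl_map f}"
    using finite_PiE[OF finite_roots, of "\<lambda>_. roots L"] finite_roots by (meson finite_imageD finite_subset)
  moreover have "weyl_group L \<subseteq> weyl_lift ` {f. weyl_map f}"
    using weyl_group_lift by blast
  ultimately show ?thesis using finite_surj by blast
qed

section \<open>Translations and fibres of the affine Weyl group action\<close>

lemma fin_part_translation [simp]:
  "fin_part (translation L \<gamma> x) = fin_part x + scl L (snd (snd x)) \<gamma>"
  unfolding translation_def aff_ipr_K aff_ipr_emb by simp

lemma snd_translation [simp]: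
  "snd (translation L \<gamma> x) = (fst (snd x) - (ipr L (fin_part x) \<gamma> + 1/2 * snd (snd x) * ipr L \<gamma> \<gamma>), snd (snd x))"
  unfolding translation_def aff_ipr_K aff_ipr_emb by (cases "snd x") (simp add: central_K_def)

lemma lookup_translation:
  "m \<noteq> 0 \<Longrightarrow> Poly_Mapping.lookup (fst (translation L \<gamma> x)) m = Poly_Mapping.lookup (fst x) m"
  unfolding translation_def aff_ipr_K aff_ipr_emb
  by (simp add: lookup_add lookup_minus central_K_def loop_def lookup_single del: aff_scl.simps)

lemma lookup_weyl_lift:
  "m \<noteq> 0 \<Longrightarrow> Poly_Mapping.lookup (fst (weyl_lift f x)) m = Poly_Mapping.lookup (fst x) m"
  by (simp add: weyl_lift_def lookup_add loop_def lookup_single)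

lemma affine_eqI_fin_part:
  fixes x y :: "'g affine"
  assumes "fin_part x = fin_part y" "snd x = snd y"
    "\<And>m. m \<noteq> 0 \<Longrightarrow> Poly_Mapping.lookup (fst x) m = Poly_Mapping.lookup (fst y) m"
  shows "x = y"
  using assms by (intro affine_eqI) (auto simp: fin_part_def, metis)

lemma translation_add: "translation L \<gamma> (translation L \<gamma>' x) = translation L (\<gamma> + \<gamma>') x"
  by (rule affine_eqI_fin_part)
    (simp_all add: lookup_translation scale_right_distrib algebra_simps ipr_sym[of \<gamma>' \<gamma>])

lemma translation_weyl_lift:
  assumes "weyl_map f"
  shows "translation L (f \<gamma>) (weyl_lift f x) = weyl_lift f (translation L \<gamma> x)"
proof (rule affine_eqI_fin_part)
  show "fin_part (translation L (f \<gamma>) (weyl_lift f x)) = fin_part (weyl_lift f (translation L \<gamma> x))"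
    using assms by (simp add: weyl_map_def Vector_Spaces.linear_iff)
  show "snd (translation L (f \<gamma>) (weyl_lift f x)) = snd (weyl_lift f (translation L \<gamma> x))"
    using assms by (simp add: weyl_map_def)
qed (simp add: lookup_translation lookup_weyl_lift)

lemma translation_inj:
  assumes "snd (snd x) \<noteq> 0" "translation L \<gamma> x = translation L \<gamma>' x"
  shows "\<gamma> = \<gamma>'"
  using arg_cong[OF assms(2), of fin_part] assms(1) by simp

text \<open>The fibre over \<mu> of the orbit map of \<nu>, with w = u t_\<gamma> recorded as a
  pair. For \<mu> = \<nu> it is the stabilizer of \<nu>. At nonzero level \<gamma> is determined by
  u, which makes every fibre finite.\<close>

definition weyl_pairs :: "'g affine \<Rightarrow> 'g affine \<Rightarrow> (('g affine \<Rightarrow> 'g affine) \<times> 'g) set" where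
  "weyl_pairs \<nu> \<mu> = {(u, \<gamma>). u \<in> weyl_group L \<and> \<gamma> \<in> root_lattice L \<and> u (translation L \<gamma> \<nu>) = \<mu>}"

lemma finite_weyl_pairs:
  assumes "snd (snd \<nu>) \<noteq> 0"
  shows "finite (weyl_pairs \<nu> \<mu>)"
proof (rule finite_imageD)
  show "finite (fst ` weyl_pairs \<nu> \<mu>)"
    by (rule finite_subset[OF _ finite_weyl_group]) (auto simp: weyl_pairs_def)
  show "inj_on fst (weyl_pairs \<nu> \<mu>)"
  proof (rule inj_onI, clarsimp simp: weyl_pairs_def)
    fix u \<gamma> \<gamma>' assume "u \<in> weyl_group L" "u (translation L \<gamma>' \<nu>) = u (translation L \<gamma> \<nu>)"
    then show "\<gamma> = \<gamma>'" using translation_inj[OF assms] weyl_group_bij by (metis bij_pointE)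
  qed
qed

text \<open>The map is right multiplication by the stabilizer element given by u0 and \<gamma>0:
  moving u0 to the left past the translation by \<gamma> replaces \<gamma> by its image under v0,
  the inverse of u0.\<close>

lemma weyl_pairs_right_mult:
  assumes lev: "snd (snd \<nu>) \<noteq> 0" and u0: "(u0, \<gamma>0) \<in> weyl_pairs \<nu> \<nu>"
    and v0: "v0 \<in> weyl_group L" "u0 \<circ> v0 = id"
  shows "bij_betw (\<lambda>(u, \<gamma>). (u \<circ> u0, weyl_restrict v0 \<gamma> + \<gamma>0)) (weyl_pairs \<nu> \<mu>) (weyl_pairs \<nu> \<mu>)"
    (is "bij_betw ?R ?G ?G")
proof -
  have u0': "u0 \<in> weyl_group L" "\<gamma>0 \<in> root_lattice L" "u0 (translation L \<gamma>0 \<nu>) = \<nu>"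
    using u0 by (auto simp: weyl_pairs_def)
  note u = weyl_group_lift[OF u0'(1)] and v = weyl_group_lift[OF v0(1)]
  have uv: "weyl_restrict u0 (weyl_restrict v0 \<gamma>) = \<gamma>" for \<gamma>
  proof -
    have "u0 (v0 (emb \<gamma>)) = emb \<gamma>" using v0(2) by (metis comp_apply id_apply)
    then have "fin_part (weyl_lift (weyl_restrict u0) (weyl_lift (weyl_restrict v0) (emb \<gamma>))) = fin_part (emb \<gamma>)"
      using u(2) v(2) by simp
    then show ?thesis by simp
  qed
  have "?R p \<in> ?G" if p: "p \<in> ?G" for p
  proof -
    obtain w \<gamma> where p: "p = (w, \<gamma>)" "w \<in> weyl_group L" "\<gamma> \<in> root_lattice L" "w (translation L \<gamma> \<nu>) = \<mu>"
      using p by (auto simp: weyl_pairs_def)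
    have "u0 (translation L (weyl_restrict v0 \<gamma> + \<gamma>0) \<nu>)
        = weyl_lift (weyl_restrict u0) (translation L (weyl_restrict v0 \<gamma>) (translation L \<gamma>0 \<nu>))"
      using u(2) by (simp add: translation_add)
    also have "\<dots> = translation L (weyl_restrict u0 (weyl_restrict v0 \<gamma>)) (weyl_lift (weyl_restrict u0) (translation L \<gamma>0 \<nu>))"
      by (rule translation_weyl_lift[OF u(1), symmetric])
    also have "\<dots> = translation L \<gamma> \<nu>" using u(2) u0'(3) uv by simp
    finally have "(w \<circ> u0) (translation L (weyl_restrict v0 \<gamma> + \<gamma>0) \<nu>) = \<mu>" using p(4) by simp
    moreover have "weyl_restrict v0 \<gamma> + \<gamma>0 \<in> root_lattice L"
      using v(1) p(3) u0'(2) by (intro root_lattice_add) (auto simp: weyl_map_def)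
    ultimately show ?thesis using weyl_group_comp[OF p(2) u0'(1)] by (simp add: p(1) weyl_pairs_def)
  qed
  then have sub: "?R ` ?G \<subseteq> ?G" by blast
  have "inj_on ?R ?G"
  proof (rule inj_onI, clarsimp)
    fix w \<gamma> w' \<gamma>'
    assume "w \<circ> u0 = w' \<circ> u0" "weyl_restrict v0 \<gamma> = weyl_restrict v0 \<gamma>'"
    then have "w \<circ> (u0 \<circ> v0) = w' \<circ> (u0 \<circ> v0)" "\<gamma> = \<gamma>'"
      using weyl_map_inj[OF v(1)] by (auto simp: inj_eq simp flip: comp_assoc)
    then show "w = w' \<and> \<gamma> = \<gamma>'" using v0(2) by simp
  qed
  with sub show ?thesis
    using endo_inj_surj[OF finite_weyl_pairs[OF lev] sub] by (simp add: bij_betw_def)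
qed

lemma weyl_translation_inj:
  "inj_on (\<lambda>(u, \<gamma>). u \<circ> translation L \<gamma>) (weyl_group L \<times> UNIV)"
proof (rule inj_onI, clarsimp)
  fix u \<gamma> u' \<gamma>'
  assume u: "u \<in> weyl_group L" "u' \<in> weyl_group L" and eq: "u \<circ> translation L \<gamma> = u' \<circ> translation L \<gamma>'"
  note l = weyl_group_lift[OF u(1)] weyl_group_lift[OF u(2)]
  have fin: "fin_part (u x) = weyl_restrict u (fin_part x)" "fin_part (u' x) = weyl_restrict u' (fin_part x)" for x
    by (subst l(2), simp) (subst l(4), simp)
  have eq': "weyl_restrict u (fin_part x + scl L (snd (snd x)) \<gamma>) = weyl_restrict u' (fin_part x + scl L (snd (snd x)) \<gamma>')" for x
    using arg_cong[OF fun_cong[OF eq, of x], of fin_part] by (simp add: fin)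
  have "weyl_restrict u = weyl_restrict u'" using eq'[of "emb _"] by (simp add: fun_eq_iff)
  then have "u = u'" using l by metis
  \<comment> \<open>The element d has level 1 and zero finite part, so its translate has finite part
    exactly \<gamma>.\<close>
  moreover have "weyl_restrict u \<gamma> = weyl_restrict u' \<gamma>'"
    using eq'[of deriv_d] by (simp add: deriv_d_def fin_part_def)
  then have "\<gamma> = \<gamma>'" using \<open>weyl_restrict u = weyl_restrict u'\<close> weyl_map_inj[OF l(1)] by (simp add: inj_eq)
  ultimately show "u = u' \<and> \<gamma> = \<gamma>'" by blast
qed

lemma exp_sum_aff_weyl_group:
  "exp_sum (aff_weyl_group L) a (\<lambda>w. w \<nu>) \<mu> = (\<Sum>(u, \<gamma>)\<in>weyl_pairs \<nu> \<mu>. a (u \<circ> translation L \<gamma>))"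
proof -
  have "{w. w \<in> aff_weyl_group L \<and> w \<nu> = \<mu>} = (\<lambda>(u, \<gamma>). u \<circ> translation L \<gamma>) ` weyl_pairs \<nu> \<mu>"
    by (auto simp: aff_weyl_group_def weyl_pairs_def image_iff)
  moreover have "inj_on (\<lambda>(u, \<gamma>). u \<circ> translation L \<gamma>) (weyl_pairs \<nu> \<mu>)"
    by (rule inj_on_subset[OF weyl_translation_inj]) (auto simp: weyl_pairs_def)
  ultimately show ?thesis
    by (simp add: exp_sum_def sum.reindex split_def)
qed

lemma sum_act_series_exp_sum:
  assumes "snd (snd \<nu>) \<noteq> 0"
  shows "(\<Sum>u\<in>weyl_group L. e u * act_series u (exp_sum (root_lattice L) a (\<lambda>\<gamma>. translation L \<gamma> \<nu>)) \<mu>)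
    = (\<Sum>(u, \<gamma>)\<in>weyl_pairs \<nu> \<mu>. e u * a \<gamma>)"
proof -
  let ?F = "\<lambda>u. {\<gamma>. \<gamma> \<in> root_lattice L \<and> translation L \<gamma> \<nu> = inv_into UNIV u \<mu>}"
  have inv: "translation L \<gamma> \<nu> = inv_into UNIV u \<mu> \<longleftrightarrow> u (translation L \<gamma> \<nu>) = \<mu>" if "u \<in> weyl_group L" for u \<gamma>
    using weyl_group_bij[OF that] by (metis bij_inv_eq_iff)
  have fin: "finite (?F u)" for u
  proof (rule finite_subset[OF _ finite.insertI[OF finite.emptyI, of "THE \<gamma>. translation L \<gamma> \<nu> = inv_into UNIV u \<mu>"]], rule subsetI)
    fix \<gamma> assume "\<gamma> \<in> ?F u"
    then have "(THE \<gamma>. translation L \<gamma> \<nu> = inv_into UNIV u \<mu>) = \<gamma>"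
      using translation_inj[OF assms] by (intro the_equality) auto
    then show "\<gamma> \<in> {THE \<gamma>. translation L \<gamma> \<nu> = inv_into UNIV u \<mu>}" by simp
  qed
  have "(\<Sum>u\<in>weyl_group L. e u * act_series u (exp_sum (root_lattice L) a (\<lambda>\<gamma>. translation L \<gamma> \<nu>)) \<mu>)
      = (\<Sum>u\<in>weyl_group L. \<Sum>\<gamma>\<in>?F u. e u * a \<gamma>)"
    by (simp add: act_series_def exp_sum_def sum_distrib_left)
  also have "\<dots> = (\<Sum>(u, \<gamma>)\<in>(SIGMA u:weyl_group L. ?F u). e u * a \<gamma>)"
    by (rule sum.Sigma) (use fin finite_weyl_group in auto)
  also have "(SIGMA u:weyl_group L. ?F u) = weyl_pairs \<nu> \<mu>"
    using inv by (auto simp: weyl_pairs_def)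
  finally show ?thesis .
qed

end

section \<open>The character formula\<close>

context simply_laced_lie_algebra
begin

lemma additive_on_lattice_multiple:
  fixes f :: "'g \<Rightarrow> complex"
  assumes add: "\<And>\<gamma> \<gamma>'. \<gamma> \<in> root_lattice L \<Longrightarrow> \<gamma>' \<in> root_lattice L \<Longrightarrow> f (\<gamma> + \<gamma>') = f \<gamma> + f \<gamma>'"
    and \<gamma>: "\<gamma> \<in> root_lattice L"
  shows "f (scl L (of_int n) \<gamma>) = of_int n * f \<gamma>"
proof (induction n rule: int_induct[of _ 0])
  case base
  show ?case using add[OF root_lattice_0 root_lattice_0] by simp
next
  case (step1 i)
  then show ?case
    using add[OF root_lattice_scl[OF \<gamma>, of i] \<gamma>] by (simp add: scale_left_distrib algebra_simps)
next
  case (step2 i)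
  have "scl L (of_int (i - 1)) \<gamma> + \<gamma> = scl L (of_int i) \<gamma>"
    by (simp add: scale_left_diff_distrib)
  then show ?case
    using step2 add[OF root_lattice_scl[OF \<gamma>, of "i - 1"] \<gamma>] by (simp add: algebra_simps)
qed

text \<open>At level \<kappa> = 0 the root \<alpha> itself would violate (iii). For the second
  claim, u t_\<gamma> sends \<delta> - \<alpha> to n \<delta> - u \<alpha> with n =
  (\<alpha>|\<gamma>) + 1, again orthogonal to \<nu>. This root or its negative is positive, so
  (iii) identifies it with \<delta> - \<alpha> up to sign; n = 0 is excluded because (iii) demands
  \<delta>-coefficient 1.\<close>

lemma isotropic_pairing:
  assumes lev: "snd (snd \<nu>) = \<kappa>" and \<alpha>: "\<alpha> \<in> pos_roots L" and ii: "ipr L (fin_part \<nu>) \<alpha> = \<kappa>"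
    and iii: "\<forall>\<beta>\<in>aff_pos_roots L. aff_ipr L \<beta> \<nu> = 0 \<longrightarrow> \<beta> = delta - emb \<alpha>"
  shows "\<kappa> \<noteq> 0"
    "(u, \<gamma>) \<in> weyl_pairs \<nu> \<nu> \<Longrightarrow>
      weyl_restrict u \<alpha> = scl L (ipr L \<alpha> \<gamma> + 1) \<alpha>"
proof -
  have delta: "delta - emb \<alpha> = aff_elem (- \<alpha>) 1 0"
    unfolding central_K_eq emb_eq aff_elem_diff by simp
  have \<alpha>r: "\<alpha> \<in> roots L" using \<alpha> by (simp add: pos_roots_def)
  have orth: "\<beta> = - \<alpha> \<and> n = 1"
    if "\<beta> \<in> roots L" "n > 0 \<or> n = 0 \<and> \<beta> \<in> pos_roots L" "ipr L (fin_part \<nu>) \<beta> + of_int n * \<kappa> = 0" for \<beta> and n :: int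
  proof -
    have "aff_ipr L (aff_elem \<beta> (of_int n) 0) \<nu> = 0"
      unfolding aff_ipr_cartan_left lev using that(3) by (simp add: ipr_sym)
    then have "aff_elem \<beta> (of_int n) 0 = aff_elem (- \<alpha>) 1 0"
      using iii real_root_in_aff_pos_roots[OF that(1,2)] delta by metis
    then show ?thesis unfolding aff_elem_eq_iff by simp
  qed
  show "\<kappa> \<noteq> 0"
    using orth[OF \<alpha>r, of 0] \<alpha> ii by auto
  assume pair: "(u, \<gamma>) \<in> weyl_pairs \<nu> \<nu>"
  then have u: "u \<in> weyl_group L" and \<gamma>: "\<gamma> \<in> root_lattice L" and stab: "u (translation L \<gamma> \<nu>) = \<nu>"
    by (auto simp: weyl_pairs_def)
  note f = weyl_group_lift[OF u]
  let ?f = "weyl_restrict u"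
  obtain m where "ipr L \<alpha> \<gamma> = of_int m" using ipr_root_lattice_int[OF \<alpha>r \<gamma>] by (auto elim: Ints_cases)
  then obtain n :: int where n: "ipr L \<alpha> \<gamma> + 1 = of_int n" by (metis of_int_1 of_int_add)
  have f\<alpha>: "?f \<alpha> \<in> roots L" using f(1) \<alpha>r by (simp add: weyl_map_def)
  have "fin_part \<nu> = ?f (fin_part \<nu> + scl L \<kappa> \<gamma>)"
    by (subst stab[symmetric], subst f(2)) (simp add: lev)
  then have "ipr L (fin_part \<nu>) (?f \<alpha>) = ipr L (fin_part \<nu> + scl L \<kappa> \<gamma>) \<alpha>"
    using f(1) by (metis weyl_map_def)
  also have "\<dots> = of_int n * \<kappa>" by (simp add: ii n[symmetric] ipr_sym[of \<gamma>] algebra_simps)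
  finally have eq: "ipr L (fin_part \<nu>) (?f \<alpha>) = of_int n * \<kappa>" .
  have minus: "- ?f \<alpha> = - \<alpha> \<and> n = 1" if "n > 0 \<or> n = 0 \<and> - ?f \<alpha> \<in> pos_roots L"
    using orth[OF uminus_roots[OF f\<alpha>] that] eq by simp
  have plus: "?f \<alpha> = - \<alpha> \<and> - n = 1" if "- n > 0 \<or> - n = 0 \<and> ?f \<alpha> \<in> pos_roots L"
    using orth[OF f\<alpha> that] eq by simp
  have "n > 0 \<or> n < 0"
    using minus plus pos_roots_cases[OF f\<alpha>] by (cases n "0::int" rule: linorder_cases) auto
  then show "?f \<alpha> = scl L (ipr L \<alpha> \<gamma> + 1) \<alpha>"
    unfolding n using minus plus by (auto dest: minus_equation_iff[THEN iffD1])
qed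

lemma reflection_pair:
  assumes "\<alpha> \<in> roots L" "ipr L (fin_part \<nu>) \<alpha> = snd (snd \<nu>)"
  shows "(reflection L \<alpha>, - \<alpha>) \<in> weyl_pairs \<nu> \<nu>"
proof -
  \<comment> \<open>The \<delta>-term of the translation cancels: (\<nu>|\<alpha>) equals the level,
    and half the level times (\<alpha>|\<alpha>) is the level again.\<close>
  have "translation L (- \<alpha>) \<nu> = \<nu> + emb (scl L (snd (snd \<nu>)) (- \<alpha>))"
    unfolding translation_def aff_ipr_K aff_ipr_emb aff_scl_emb using assms root_norm by simp
  then have "reflection L \<alpha> (translation L (- \<alpha>) \<nu>)
      = \<nu> + (emb (scl L (snd (snd \<nu>)) (- \<alpha>)) + emb (scl L (snd (snd \<nu>)) \<alpha>))"
    unfolding reflection_def aff_ipr_emb aff_scl_emb using assms root_norm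
    by (simp add: add_diff_eq[symmetric] flip: loop_add)
  also have "\<dots> = \<nu>" by (simp flip: loop_add)
  finally show ?thesis
    using assms reflection_weyl_group root_lattice_minus roots_in_lattice by (simp add: weyl_pairs_def)
qed

lemma weyl_restrict_reflection: "weyl_restrict (reflection L \<alpha>) h = h - scl L (ipr L h \<alpha>) \<alpha>"
  unfolding weyl_restrict_def reflection_def aff_ipr_emb aff_scl_emb by simp

end

theorem theorem3p1:
  fixes L :: "('g::ab_group_add) lie_data"
    and s :: "complex \<Rightarrow> 'v::ab_group_add \<Rightarrow> 'v"
    and act :: "'g affine \<Rightarrow> 'v \<Rightarrow> 'v"
    and \<Lambda> :: "'g affine" and k :: int and \<alpha> :: 'g
    and c :: "('g affine \<Rightarrow> 'g affine) \<Rightarrow> int"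
  assumes g: "simple_simply_laced L"
    and \<Lambda>: "\<Lambda> \<in> aff_cartan L"
    and module: "is_L L \<Lambda> s act"
    and level: "aff_ipr L \<Lambda> central_K = of_int k" "k < 0"
    and i: "\<forall>i\<in>{1..rk L}. aff_ipr L \<Lambda> (emb (simple_root L i)) \<in> \<nat>"
    and ii: "\<alpha> \<in> pos_roots L" "aff_ipr L (\<Lambda> + aff_weyl_vector L) (delta - emb \<alpha>) = 0"
    and iii: "\<forall>\<beta>\<in>aff_pos_roots L. aff_ipr L \<beta> (\<Lambda> + aff_weyl_vector L) = 0 \<longrightarrow> \<beta> = delta - emb \<alpha>"
    and character_formula:
      "series_mult (aff_denominator L) (character L s act) =
         exp_sum (aff_weyl_group L) (\<lambda>w. of_int (c w)) (\<lambda>w. w (\<Lambda> + aff_weyl_vector L))"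
      "weyl_anti_invariant L c"
    and iv: "\<exists>(f :: 'g \<Rightarrow> complex) (b :: complex).
               (\<forall>\<gamma>\<in>root_lattice L. \<forall>\<gamma>'\<in>root_lattice L. f (\<gamma> + \<gamma>') = f \<gamma> + f \<gamma>') \<and>
               (\<forall>\<gamma>\<in>root_lattice L. of_int (c (translation L \<gamma>)) = f \<gamma> + b)"
  shows "series_mult (aff_denominator L) (character L s act) =
    (\<lambda>\<mu>. 1/2 * (\<Sum>w\<in>weyl_group L. weyl_sign L w *
       act_series w
         (exp_sum (root_lattice L) (\<lambda>\<gamma>. ipr L \<alpha> \<gamma> + 1)
            (\<lambda>\<gamma>. translation L \<gamma> (\<Lambda> + aff_weyl_vector L))) \<mu>))"
proof -
  interpret simply_laced_lie_algebra L by unfold_locales (rule g)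
  define \<nu> where "\<nu> = \<Lambda> + aff_weyl_vector L"
  define N where "N = series_mult (aff_denominator L) (character L s act)"
  let ?\<epsilon> = "weyl_sign L" and ?n = "\<lambda>\<gamma>. ipr L \<alpha> \<gamma> + 1" and ?r = "reflection L \<alpha>" and ?G = "weyl_pairs \<nu>"
  have \<alpha>: "\<alpha> \<in> roots L" "\<alpha> \<in> root_lattice L"
    using ii(1) roots_in_lattice by (auto simp: pos_roots_def)
  have "delta - emb \<alpha> = aff_elem (- \<alpha>) 1 0" unfolding central_K_eq emb_eq aff_elem_diff by simp
  then have pair: "ipr L (fin_part \<nu>) \<alpha> = snd (snd \<nu>)"
    using ii(2) by (simp only: \<nu>_def[symmetric] aff_ipr_cartan_right) simp
  note iso = isotropic_pairing[OF refl ii(1) pair iii[folded \<nu>_def]]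
  obtain f :: "'g \<Rightarrow> complex" and b where
    f: "\<And>\<gamma> \<gamma>'. \<gamma> \<in> root_lattice L \<Longrightarrow> \<gamma>' \<in> root_lattice L \<Longrightarrow> f (\<gamma> + \<gamma>') = f \<gamma> + f \<gamma>'"
    and cf: "\<And>\<gamma>. \<gamma> \<in> root_lattice L \<Longrightarrow> of_int (c (translation L \<gamma>)) = f \<gamma> + b"
    using iv by blast
  have aff: "u \<circ> translation L \<gamma> \<in> aff_weyl_group L" if "u \<in> weyl_group L" "\<gamma> \<in> root_lattice L" for u \<gamma>
    using that unfolding aff_weyl_group_def by blast
  have anti: "of_int (c (u \<circ> w)) = ?\<epsilon> u * of_int (c w)" if "u \<in> weyl_group L" "w \<in> aff_weyl_group L" for u w
    using character_formula(2) that unfolding weyl_anti_invariant_def by blast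
  have N_eq: "N \<mu> = (\<Sum>(u, \<gamma>)\<in>?G \<mu>. ?\<epsilon> u * (f \<gamma> + b))" for \<mu>
  proof -
    have "N \<mu> = (\<Sum>(u, \<gamma>)\<in>?G \<mu>. of_int (c (u \<circ> translation L \<gamma>)))"
      unfolding N_def character_formula(1) \<nu>_def by (rule exp_sum_aff_weyl_group)
    also have "\<dots> = (\<Sum>(u, \<gamma>)\<in>?G \<mu>. ?\<epsilon> u * (f \<gamma> + b))"
    proof (rule sum.cong[OF refl], clarsimp simp: weyl_pairs_def)
      fix u \<gamma> assume "u \<in> weyl_group L" "\<gamma> \<in> root_lattice L"
      then show "of_int (c (u \<circ> translation L \<gamma>)) = ?\<epsilon> u * (f \<gamma> + b)"
        using anti[of u "translation L \<gamma>"] aff[OF weyl_group.id] cf by simp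
    qed
    finally show ?thesis .
  qed
  have N1: "N \<nu> = 1" unfolding N_def \<nu>_def by (rule character_leading_coefficient[OF module \<Lambda>])
  \<comment> \<open>The leading coefficient 1 rules out that \<open>c\<close> vanishes
    identically.\<close>
  obtain w1 where w1: "w1 \<in> aff_weyl_group L" "c w1 \<noteq> 0"
  proof -
    have "\<exists>w\<in>aff_weyl_group L. c w \<noteq> 0"
    proof (rule ccontr)
      assume "\<not> ?thesis"
      then have "N \<nu> = 0"
        unfolding N_def character_formula(1) exp_sum_def by (intro sum.neutral) auto
      with N1 show False by simp
    qed
    then show ?thesis using that by blast
  qed
  \<comment> \<open>Anti-invariance of a nonzero family of coefficients forces the sign to be multiplicative.\<close>
  have sign_mult: "?\<epsilon> (u \<circ> u') = ?\<epsilon> u * ?\<epsilon> u'" if u: "u \<in> weyl_group L" "u' \<in> weyl_group L" for u u'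
  proof -
    obtain v \<gamma> where v: "w1 = v \<circ> translation L \<gamma>" "v \<in> weyl_group L" "\<gamma> \<in> root_lattice L"
      using w1(1) unfolding aff_weyl_group_def by blast
    have "u' \<circ> w1 \<in> aff_weyl_group L"
      unfolding v(1) comp_assoc[symmetric] by (rule aff[OF weyl_group_comp[OF u(2) v(2)] v(3)])
    then have "?\<epsilon> (u \<circ> u') * of_int (c w1) = ?\<epsilon> u * ?\<epsilon> u' * of_int (c w1)"
      using anti[OF weyl_group_comp[OF u] w1(1)] anti[OF u(1), of "u' \<circ> w1"] anti[OF u(2) w1(1)]
      by (auto simp: comp_assoc)
    then show ?thesis using w1(2) by simp
  qed
  have r: "?r \<in> weyl_group L" "(?r, - \<alpha>) \<in> ?G \<nu>" "?r \<circ> ?r = id"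
    using reflection_weyl_group reflection_pair pair reflection_involution \<alpha> by auto
  have sign_r: "?\<epsilon> (u \<circ> ?r) = - ?\<epsilon> u" if "u \<in> weyl_group L" for u
    using sign_mult[OF that r(1)] weyl_sign_reflection[OF \<alpha>(1)] by simp
  \<comment> \<open>The subtracted argument is the reflection of \<gamma> in \<alpha>, minus
    \<alpha>: the lattice part after right multiplication by the stabilizing reflection.\<close>
  have f_diff: "f \<gamma> - f (\<gamma> - scl L (?n \<gamma>) \<alpha>) = ?n \<gamma> * f \<alpha>" if \<gamma>: "\<gamma> \<in> root_lattice L" for \<gamma>
  proof -
    obtain m where "ipr L \<alpha> \<gamma> = of_int m" using ipr_root_lattice_int[OF \<alpha>(1) \<gamma>] by (auto elim: Ints_cases)
    then have n: "?n \<gamma> = of_int (m + 1)" by simp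
    note ma = root_lattice_scl[OF \<alpha>(2), of "m + 1"]
    have "f \<gamma> = f (\<gamma> - scl L (of_int (m + 1)) \<alpha>) + f (scl L (of_int (m + 1)) \<alpha>)"
      using f[OF root_lattice_diff[OF \<gamma> ma] ma] by simp
    moreover have "f (scl L (of_int (m + 1)) \<alpha>) = of_int (m + 1) * f \<alpha>"
      by (rule additive_on_lattice_multiple[OF _ \<alpha>(2)]) (rule f)
    ultimately show ?thesis unfolding n by simp
  qed
  \<comment> \<open>Add the fibre sum to its reindexing by the stabilizing reflection, which flips
    the sign; b cancels and \<open>f_diff\<close> evaluates the rest.\<close>
  have two_N: "2 * N \<mu> = f \<alpha> * (\<Sum>(u, \<gamma>)\<in>?G \<mu>. ?\<epsilon> u * ?n \<gamma>)" for \<mu>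
  proof -
    let ?R = "\<lambda>(u, \<gamma>). (u \<circ> ?r, weyl_restrict ?r \<gamma> + - \<alpha>)" and ?F = "\<lambda>(u, \<gamma>). ?\<epsilon> u * (f \<gamma> + b)"
    have "N \<mu> = (\<Sum>p\<in>?G \<mu>. ?F (?R p))"
      unfolding N_eq
      by (rule sum.reindex_bij_betw[OF weyl_pairs_right_mult[OF iso(1) r(2,1,3)], symmetric])
    also have "\<dots> = (\<Sum>(u, \<gamma>)\<in>?G \<mu>. - ?\<epsilon> u * (f (\<gamma> - scl L (?n \<gamma>) \<alpha>) + b))"
      by (rule sum.cong[OF refl])
        (auto simp: weyl_pairs_def sign_r weyl_restrict_reflection scale_left_distrib ipr_sym[of _ \<alpha>] algebra_simps)
    finally have "2 * N \<mu> = (\<Sum>p\<in>?G \<mu>. ?F p + (\<lambda>(u, \<gamma>). - ?\<epsilon> u * (f (\<gamma> - scl L (?n \<gamma>) \<alpha>) + b)) p)"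
      using N_eq[of \<mu>] by (simp only: sum.distrib mult_2)
    also have "\<dots> = (\<Sum>(u, \<gamma>)\<in>?G \<mu>. f \<alpha> * (?\<epsilon> u * ?n \<gamma>))"
    proof (rule sum.cong[OF refl], clarsimp simp: weyl_pairs_def)
      fix u \<gamma> assume "\<gamma> \<in> root_lattice L"
      then show "?\<epsilon> u * (f \<gamma> + b) - ?\<epsilon> u * (f (\<gamma> - scl L (?n \<gamma>) \<alpha>) + b) = f \<alpha> * (?\<epsilon> u * ?n \<gamma>)"
        using arg_cong[OF f_diff, of \<gamma> "\<lambda>x. ?\<epsilon> u * x"] by (simp add: algebra_simps)
    qed
    finally show ?thesis by (simp add: sum_distrib_left split_def)
  qed
  define T where "T = (\<Sum>(u, \<gamma>)\<in>?G \<nu>. ?\<epsilon> u * ?n \<gamma>)"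
  have T: "f \<alpha> * T = 2" using two_N[of \<nu>] N1 by (simp add: T_def)
  have trivial: "?\<epsilon> u0 * ?n \<gamma>0 = 1" if p0: "(u0, \<gamma>0) \<in> ?G \<nu>" for u0 \<gamma>0
  proof -
    have u0: "u0 \<in> weyl_group L" using p0 by (simp add: weyl_pairs_def)
    obtain v0 where v0: "v0 \<in> weyl_group L" "u0 \<circ> v0 = id" using weyl_group_inverse[OF u0] by blast
    \<comment> \<open>Since u0 is an isometry with inverse v0, pairing \<alpha> with the image of
      \<gamma> under v0 equals pairing u0 \<alpha> with \<gamma>, and \<open>iso\<close> makes u0
      \<alpha> the multiple \<open>?n \<gamma>0\<close> of \<alpha>.\<close>
    have n: "?n (weyl_restrict v0 \<gamma> + \<gamma>0) = ?n \<gamma>0 * ?n \<gamma>" for \<gamma>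
    proof -
      have "weyl_lift (weyl_restrict u0) (weyl_lift (weyl_restrict v0) (emb \<gamma>)) = emb \<gamma>"
        using v0(2) weyl_group_lift(2)[OF u0] weyl_group_lift(2)[OF v0(1)] by (metis comp_apply id_apply)
      from arg_cong[OF this, of fin_part]
      have "weyl_restrict u0 (weyl_restrict v0 \<gamma>) = \<gamma>" by simp
      then have "ipr L \<alpha> (weyl_restrict v0 \<gamma>) = ipr L (weyl_restrict u0 \<alpha>) \<gamma>"
        using weyl_group_lift(1)[OF u0] by (metis weyl_map_def)
      also have "\<dots> = ?n \<gamma>0 * ipr L \<alpha> \<gamma>" unfolding iso(2)[OF p0] by simp
      finally show ?thesis by (simp add: algebra_simps)
    qed
    let ?R = "\<lambda>(u, \<gamma>). (u \<circ> u0, weyl_restrict v0 \<gamma> + \<gamma>0)" and ?F = "\<lambda>(u, \<gamma>). ?\<epsilon> u * ?n \<gamma>"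
    have "T = (\<Sum>p\<in>?G \<nu>. ?F (?R p))"
      unfolding T_def
      by (rule sum.reindex_bij_betw[OF weyl_pairs_right_mult[OF iso(1) p0 v0], symmetric])
    also have "\<dots> = (\<Sum>p\<in>?G \<nu>. (?\<epsilon> u0 * ?n \<gamma>0) * ?F p)"
    proof (rule sum.cong[OF refl], clarsimp simp: weyl_pairs_def simp del: ipr_simps)
      fix u \<gamma> assume "u \<in> weyl_group L"
      then show "?\<epsilon> (u \<circ> u0) * ?n (weyl_restrict v0 \<gamma> + \<gamma>0) = ?\<epsilon> u0 * ?n \<gamma>0 * (?\<epsilon> u * ?n \<gamma>)"
        unfolding n using sign_mult[OF _ u0] by simp
    qed
    also have "\<dots> = (?\<epsilon> u0 * ?n \<gamma>0) * T" by (simp add: T_def sum_distrib_left)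
    \<comment> \<open>Reindexing has multiplied T by the value at the chosen element; T \<noteq> 0
      because its product with f(\<alpha>) is 2.\<close>
    finally show ?thesis using T by auto
  qed
  have "T = (\<Sum>p\<in>?G \<nu>. 1)" unfolding T_def by (rule sum.cong[OF refl]) (use trivial in auto)
  then have T_card: "T = of_nat (card (?G \<nu>))" by simp
  have "(id, 0) \<in> ?G \<nu>"
    using weyl_group.id root_lattice_0
    by (auto simp: weyl_pairs_def translation_def aff_ipr_emb simp del: aff_scl.simps)
  then have sub: "{(id, 0), (?r, - \<alpha>)} \<subseteq> ?G \<nu>" using r(2) by blast
  have "card {(id :: 'g affine \<Rightarrow> 'g affine, 0 :: 'g), (?r, - \<alpha>)} = 2"
    using rootsD(2)[OF \<alpha>(1)] by simp
  then have card: "card (?G \<nu>) \<ge> 2"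
    using card_mono[OF finite_weyl_pairs[OF iso(1)] sub] by simp
  have f0: "f 0 = 0" using f[OF root_lattice_0 root_lattice_0] by simp
  \<comment> \<open>Here the integrality of \<open>c\<close> enters: m times the order of the
    stabilizer is 2, and the order is at least 2, so m = 1.\<close>
  define m where "m = c (translation L \<alpha>) - c (translation L 0)"
  have m: "f \<alpha> = of_int m"
    using cf[OF \<alpha>(2)] cf[OF root_lattice_0] f0 by (simp add: m_def)
  have "(of_int (m * int (card (?G \<nu>))) :: complex) = of_int 2"
    using T unfolding T_card m by simp
  then have mc: "m * int (card (?G \<nu>)) = 2" by (simp only: of_int_eq_iff)
  then have "m > 0" by (smt (verit) mult_nonpos_nonneg of_nat_0_le_iff)
  moreover have "m < 2"
  proof (rule ccontr)
    assume "\<not> m < 2"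
    then have "2 * 2 \<le> m * int (card (?G \<nu>))" using card by (intro mult_mono) auto
    with mc show False by simp
  qed
  ultimately have "f \<alpha> = 1" using m by simp
  then have "(\<Sum>(u, \<gamma>)\<in>?G \<mu>. ?\<epsilon> u * ?n \<gamma>) = 2 * N \<mu>" for \<mu> using two_N[of \<mu>] by simp
  then have "N \<mu> = 1/2 * (\<Sum>(u, \<gamma>)\<in>?G \<mu>. ?\<epsilon> u * ?n \<gamma>)" for \<mu> by (simp only:) simp
  then show ?thesis
    unfolding N_def[symmetric] \<nu>_def[symmetric] sum_act_series_exp_sum[OF iso(1)] by (rule ext)
qed

end
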